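(* Let $d \ge 1$ and let $A$ be a convex polytope in $\mathbb{R}^d$. If $A$ weakly tiles its complement, then $A$ is centrally symmetric and all the facets of $A$ are centrally symmetric.
   Context: A bounded, measurable set $A \subset \mathbb{R}^d$ weakly tiles its complement $A^\complement = \mathbb{R}^d \setminus A$ if there exists a positive, locally finite (Borel) measure $\nu$ on $\mathbb{R}^d$ such that $\mathbf{1}_A * \nu = \mathbf{1}_{A^\complement}$ almost everywhere with respect to Lebesgue measure. A facet of a convex polytope $A \subset \mathbb{R}^d$ is a face of dimension $d-1$. A set $K$ is centrally symmetric if there is a point $c$ such that $2c - K = K$. *)

theory Defs
  imports "HOL-Analysis.Analysis"
begin

definition locally_finite_borel_measure :: "'a::topological_space measure \<Rightarrow> bool" where
  "locally_finite_borel_measure \<nu> \<longleftrightarrow>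
     sets \<nu> = sets borel \<and>
     (\<forall>x. \<exists>U. open U \<and> x \<in> U \<and> emeasure \<nu> U < \<infinity>)"

definition fun_measure_convolution ::
    "('a::real_normed_vector \<Rightarrow> ennreal) \<Rightarrow> 'a measure \<Rightarrow> 'a \<Rightarrow> ennreal" where
  "fun_measure_convolution f \<nu> x = (\<integral>\<^sup>+ y. f (x - y) \<partial>\<nu>)"

(* If A is Lebesgue but not Borel measurable, the integrand in the convolution need not be
   \<nu>-measurable for every x.  It is measurable for the completion of \<nu> for almost every x
   (sandwich A between Borel sets differing by a null set and use Tonelli), and for those x
   the nonnegative integral, a supremum over simple functions, has the intended value. *)
definition weakly_tiles_complement :: "'a::euclidean_space set \<Rightarrow> bool" where
  "weakly_tiles_complement A \<longleftrightarrow>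
     bounded A \<and> A \<in> sets lebesgue \<and>
     (\<exists>\<nu>. locally_finite_borel_measure \<nu> \<and>
          (AE x in lebesgue. fun_measure_convolution (indicator A) \<nu> x = indicator (- A) x))"

definition centrally_symmetric :: "'a::real_vector set \<Rightarrow> bool" where
  "centrally_symmetric K \<longleftrightarrow> (\<exists>c. (\<lambda>x. 2 *\<^sub>R c - x) ` K = K)"

end

theory Submission
  imports Defs
begin

text \<open>Let \<open>\<mu>\<close> be the sum of the unit mass at \<open>0\<close> and the given measure, so that \<open>1\<^sub>A * \<mu> = 1\<close>
  almost everywhere. The left-hand side cannot jump across a hyperplane with unit normal \<open>u\<close>, hence
  on each such hyperplane the contributions of the translates of \<open>A\<close> that have their top face there
  equal the contributions of those that have their bottom face there. Summed over a countable
  group of levels against a slowly decaying weight, this shows that the faces of \<open>A\<close> in the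
  directions \<open>u\<close> and \<open>- u\<close> have equal area; the sum does not vanish because \<open>\<mu>\<close> has an atom. By the uniqueness
  part of Minkowski's theorem (a polytope is determined up to translation by its facet areas) \<open>A\<close>
  is centrally symmetric. For a facet \<open>F\<close>, the balance on the hyperplanes parallel to \<open>F\<close> says that the prism
  \<open>P\<close> over \<open>F\<close> satisfies \<open>1\<^sub>P * \<mu>\<^sub>0 = 1\<^sub>-\<^sub>P * \<nu>\<^sub>0\<close>, where \<open>\<mu>\<^sub>0\<close> still has an atom. The same argument
  applies to \<open>P\<close> and shows that \<open>P\<close>, and with it \<open>F\<close>, is centrally symmetric.\<close>

section \<open>Slices of a set by parallel hyperplanes\<close>

text \<open>Areas are volumes of prisms of thickness one in the same space. So a single
  Brunn-Minkowski inequality serves bodies and sections alike, and the prism over a facet is again a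
  full-dimensional polytope to which the whole argument applies. The tiling measure has infinite
  mass, which rules out plain sums of areas. The weight exp(-e |y|) costs only a factor exp(2 e R),
  and e tends to 0. Top faces at level c belong to translates at level c - h(u), bottom faces to
  translates at level c + h(-u); hence the levels are taken from the group generated by h(u) and
  h(-u), which both shifts preserve. Uniqueness in Minkowski's theorem is proved only for P and -P:
  equal opposite areas make the volume of (1 - t) P - t P stationary to first order, so
  Brunn-Minkowski is an equality, matched cuts have equal sections, and the centroid lies midway
  between parallel supporting hyperplanes. The convolution criterion has -P on one side. For A this
  is obtained by reflecting the measure; for a facet F the bottom faces of A supply it, being
  reflected copies of F because A is already known to be symmetric.\<close>

definition level_proj :: "'a::euclidean_space \<Rightarrow> real \<Rightarrow> 'a \<Rightarrow> 'a" where
  "level_proj u z x = x + (z - x \<bullet> u) *\<^sub>R u"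

definition slab :: "'a::euclidean_space \<Rightarrow> 'a set" where
  "slab u = {x. 0 \<le> x \<bullet> u \<and> x \<bullet> u \<le> 1}"

text \<open>The volume of the prism is the area of the slice of \<open>S\<close> at level \<open>z\<close>; this avoids
  measures on hyperplanes.\<close>
definition prism :: "'a::euclidean_space \<Rightarrow> real \<Rightarrow> 'a set \<Rightarrow> 'a set" where
  "prism u z S = {x \<in> slab u. level_proj u z x \<in> S}"

lemma continuous_level_proj [continuous_intros]:
  "continuous_on T f \<Longrightarrow> continuous_on T g \<Longrightarrow> continuous_on T (\<lambda>x. level_proj u (f x) (g x))"
  unfolding level_proj_def by (intro continuous_intros)

lemma measurable_level_proj [measurable (raw)]:
  assumes "f \<in> borel_measurable M" "g \<in> borel_measurable M"
  shows "(\<lambda>x. level_proj u (f x) (g x)) \<in> borel_measurable M"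
  unfolding level_proj_def using assms by measurable

lemma closed_slab: "closed (slab u)"
  unfolding slab_def by (intro closed_Collect_conj closed_Collect_le continuous_intros)

lemma slab_borel [measurable]: "slab u \<in> sets borel"
  using closed_slab by (rule borel_closed)

lemma prism_borel: "S \<in> sets borel \<Longrightarrow> prism u z S \<in> sets borel"
proof -
  assume [measurable]: "S \<in> sets borel"
  have "{x \<in> space borel. x \<in> slab u \<and> level_proj u z x \<in> S} \<in> sets borel"
    by measurable
  then show ?thesis by (simp add: prism_def)
qed

lemma level_proj_inner: "norm u = 1 \<Longrightarrow> level_proj u z x \<bullet> u = z"
  by (simp add: level_proj_def inner_add_left dot_square_norm)

lemma level_proj_diff: "level_proj u z x - level_proj u y x = (z - y) *\<^sub>R u"
  by (simp add: level_proj_def algebra_simps)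

lemma level_proj_self: "x \<bullet> u = z \<Longrightarrow> level_proj u z x = x"
  by (simp add: level_proj_def)

lemma level_proj_shift: "level_proj u z (x + s *\<^sub>R u) = level_proj u z x" if "norm u = 1"
  using that by (simp add: level_proj_def inner_add_left dot_square_norm algebra_simps)

lemma level_proj_minus: "level_proj u z x - t = level_proj u (z - t \<bullet> u) (x - t)"
  by (simp add: level_proj_def inner_diff_left)

lemma nn_integral_lborel_translate:
  fixes f :: "'a::euclidean_space \<Rightarrow> ennreal"
  assumes "f \<in> borel_measurable borel"
  shows "(\<integral>\<^sup>+x. f (x + c) \<partial>lborel) = (\<integral>\<^sup>+x. f x \<partial>lborel)"
proof -
  have "(\<integral>\<^sup>+x. f x \<partial>lborel) = (\<integral>\<^sup>+x. f x \<partial>distr lborel borel ((+) c))"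
    by (simp add: lborel_distr_plus)
  also have "\<dots> = (\<integral>\<^sup>+x. f (c + x) \<partial>lborel)"
    using assms by (subst nn_integral_distr) auto
  finally show ?thesis by (simp add: add.commute)
qed

lemma nn_integral_lborel_uminus:
  fixes f :: "'a::euclidean_space \<Rightarrow> ennreal"
  assumes "f \<in> borel_measurable borel"
  shows "(\<integral>\<^sup>+x. f (- x) \<partial>lborel) = (\<integral>\<^sup>+x. f x \<partial>lborel)"
proof -
  have "(\<integral>\<^sup>+x. f x \<partial>lborel) = (\<integral>\<^sup>+x. f x \<partial>distr lborel borel uminus)"
    using lborel_affine[of "-1" "0::'a"] by (simp add: density_1)
  also have "\<dots> = (\<integral>\<^sup>+x. f (- x) \<partial>lborel)"
    using assms by (subst nn_integral_distr) auto
  finally show ?thesis ..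
qed

text \<open>For fixed \<open>x\<close> the substitution \<open>z + x \<bullet> u\<close> turns
  projection to a level into translation along \<open>u\<close>. After Tonelli and a translation of
  \<open>x\<close>, each point is counted once, since \<open>x - z *\<^sub>R u\<close> lies in the
  slab for an interval of \<open>z\<close> of length 1.\<close>

lemma nn_integral_slices:
  fixes f :: "'a::euclidean_space \<Rightarrow> ennreal"
  assumes u: "norm u = 1" and [measurable]: "f \<in> borel_measurable borel"
  shows "(\<integral>\<^sup>+x. f x \<partial>lborel) =
    (\<integral>\<^sup>+z. (\<integral>\<^sup>+x. indicator (slab u) x * f (level_proj u z x) \<partial>lborel) \<partial>lborel)"
proof -
  have uu: "u \<bullet> u = 1" using u by (simp add: dot_square_norm)
  have "(\<integral>\<^sup>+z. (\<integral>\<^sup>+x. indicator (slab u) x * f (level_proj u z x) \<partial>lborel) \<partial>lborel)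
      = (\<integral>\<^sup>+x. (\<integral>\<^sup>+z. indicator (slab u) x * f (level_proj u z x) \<partial>lborel) \<partial>lborel)"
    by (rule lborel_pair.Fubini') measurable
  also have "\<dots> = (\<integral>\<^sup>+x. (\<integral>\<^sup>+z. indicator (slab u) x * f (x + z *\<^sub>R u) \<partial>lborel) \<partial>lborel)"
  proof (rule nn_integral_cong)
    fix x :: 'a
    have "(\<integral>\<^sup>+z. indicator (slab u) x * f (level_proj u z x) \<partial>lborel)
      = (\<integral>\<^sup>+z. (\<lambda>w. indicator (slab u) x * f (x + w *\<^sub>R u)) (z + - (x \<bullet> u)) \<partial>lborel)"
      by (simp add: level_proj_def)
    also have "\<dots> = (\<integral>\<^sup>+z. indicator (slab u) x * f (x + z *\<^sub>R u) \<partial>lborel)"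
      by (rule nn_integral_lborel_translate) measurable
    finally show "(\<integral>\<^sup>+z. indicator (slab u) x * f (level_proj u z x) \<partial>lborel) = \<dots>" .
  qed
  also have "\<dots> = (\<integral>\<^sup>+z. (\<integral>\<^sup>+x. indicator (slab u) x * f (x + z *\<^sub>R u) \<partial>lborel) \<partial>lborel)"
    by (rule lborel_pair.Fubini') measurable
  also have "\<dots> = (\<integral>\<^sup>+z. (\<integral>\<^sup>+x. indicator (slab u) (x - z *\<^sub>R u) * f x \<partial>lborel) \<partial>lborel)"
  proof (rule nn_integral_cong)
    fix z :: real
    have "(\<integral>\<^sup>+x. indicator (slab u) x * f (x + z *\<^sub>R u) \<partial>lborel)
      = (\<integral>\<^sup>+x. (\<lambda>y. indicator (slab u) (y - z *\<^sub>R u) * f y) (x + z *\<^sub>R u) \<partial>lborel)"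
      by simp
    also have "\<dots> = (\<integral>\<^sup>+x. indicator (slab u) (x - z *\<^sub>R u) * f x \<partial>lborel)"
      by (rule nn_integral_lborel_translate) measurable
    finally show "(\<integral>\<^sup>+x. indicator (slab u) x * f (x + z *\<^sub>R u) \<partial>lborel) = \<dots>" .
  qed
  also have "\<dots> = (\<integral>\<^sup>+x. (\<integral>\<^sup>+z. indicator (slab u) (x - z *\<^sub>R u) * f x \<partial>lborel) \<partial>lborel)"
    by (rule lborel_pair.Fubini') measurable
  also have "\<dots> = (\<integral>\<^sup>+x. f x \<partial>lborel)"
  proof (rule nn_integral_cong)
    fix x :: 'a
    have "(\<integral>\<^sup>+z. indicator (slab u) (x - z *\<^sub>R u) * f x \<partial>lborel)
      = (\<integral>\<^sup>+z. indicator {x \<bullet> u - 1 .. x \<bullet> u} z \<partial>lborel) * f x"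
      by (subst nn_integral_multc[symmetric])
         (auto intro!: nn_integral_cong simp: slab_def uu inner_diff_left split: split_indicator)
    then show "(\<integral>\<^sup>+z. indicator (slab u) (x - z *\<^sub>R u) * f x \<partial>lborel) = f x"
      by simp
  qed
  finally show ?thesis by simp
qed

text \<open>Projection to a level forgets the component of \<open>t\<close> along \<open>u\<close>;
  the remaining component \<open>s\<close> is orthogonal to \<open>u\<close> and translates the slab
  to itself.\<close>

lemma nn_integral_slab_translate:
  fixes f :: "'a::euclidean_space \<Rightarrow> ennreal"
  assumes u: "norm u = 1" and [measurable]: "f \<in> borel_measurable borel"
  shows "(\<integral>\<^sup>+x. indicator (slab u) x * f (level_proj u z (x - t)) \<partial>lborel) =
    (\<integral>\<^sup>+x. indicator (slab u) x * f (level_proj u z x) \<partial>lborel)"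
proof -
  define s where "s = level_proj u 0 t"
  have su: "s \<bullet> u = 0" by (simp add: s_def level_proj_inner u)
  have *: "level_proj u z (x + s - t) = level_proj u z x" for x
    using u by (simp add: s_def level_proj_def inner_diff_left inner_add_left dot_square_norm algebra_simps)
  have "(\<integral>\<^sup>+x. indicator (slab u) x * f (level_proj u z (x - t)) \<partial>lborel)
    = (\<integral>\<^sup>+x. indicator (slab u) (x + s) * f (level_proj u z (x + s - t)) \<partial>lborel)"
    by (rule nn_integral_lborel_translate[symmetric]) measurable
  also have "\<dots> = (\<integral>\<^sup>+x. indicator (slab u) x * f (level_proj u z x) \<partial>lborel)"
    by (intro nn_integral_cong) (simp add: * slab_def inner_add_left su indicator_def)
  finally show ?thesis .
qed

lemma emeasure_prism:
  assumes "S \<in> sets borel"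
  shows "emeasure lborel (prism u z S) = (\<integral>\<^sup>+x. indicator (slab u) x * indicator S (level_proj u z x) \<partial>lborel)"
proof -
  have "emeasure lborel (prism u z S) = (\<integral>\<^sup>+x. indicator (prism u z S) x \<partial>lborel)"
    using prism_borel[OF assms, of u z] by simp
  also have "\<dots> = (\<integral>\<^sup>+x. indicator (slab u) x * indicator S (level_proj u z x) \<partial>lborel)"
    by (intro nn_integral_cong) (auto simp: prism_def split: split_indicator)
  finally show ?thesis .
qed

lemma indicator_prism: "indicator (prism u z S) x = (indicator (slab u) x * indicator S (level_proj u z x) :: ennreal)"
  by (auto simp: prism_def split: split_indicator)

lemma emeasure_slices:
  assumes u: "norm u = 1" and [measurable]: "S \<in> sets borel" "I \<in> sets borel"
  shows "emeasure lborel {x \<in> S. x \<bullet> u \<in> I} = (\<integral>\<^sup>+z. emeasure lborel (prism u z S) * indicator I z \<partial>lborel)"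
proof -
  have "{x \<in> S. x \<bullet> u \<in> I} = {x \<in> space borel. x \<in> S \<and> x \<bullet> u \<in> I}" by auto
  also have "\<dots> \<in> sets borel" by measurable
  finally have [measurable]: "{x \<in> S. x \<bullet> u \<in> I} \<in> sets borel" .
  have "emeasure lborel {x \<in> S. x \<bullet> u \<in> I} = (\<integral>\<^sup>+x. indicator {x \<in> S. x \<bullet> u \<in> I} x \<partial>lborel)"
    by simp
  also have "\<dots> = (\<integral>\<^sup>+z. (\<integral>\<^sup>+x. indicator (slab u) x * indicator {x \<in> S. x \<bullet> u \<in> I} (level_proj u z x) \<partial>lborel) \<partial>lborel)"
    by (rule nn_integral_slices[OF u]) measurable
  also have "\<dots> = (\<integral>\<^sup>+z. (\<integral>\<^sup>+x. (indicator (slab u) x * indicator S (level_proj u z x)) * indicator I z \<partial>lborel) \<partial>lborel)"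
    by (intro nn_integral_cong) (auto simp: level_proj_inner[OF u] split: split_indicator)
  also have "\<dots> = (\<integral>\<^sup>+z. emeasure lborel (prism u z S) * indicator I z \<partial>lborel)"
    by (simp add: emeasure_prism nn_integral_multc)
  finally show ?thesis .
qed

lemma norm_level_proj_le:
  assumes "norm u = 1" "x \<in> slab u"
  shows "norm x \<le> norm (level_proj u z x) + 1 + \<bar>z\<bar>"
proof -
  have "x = level_proj u z x + (x \<bullet> u - z) *\<^sub>R u" by (simp add: level_proj_def algebra_simps)
  then have "norm x \<le> norm (level_proj u z x) + norm ((x \<bullet> u - z) *\<^sub>R u)"
    by (metis norm_triangle_ineq)
  also have "norm ((x \<bullet> u - z) *\<^sub>R u) \<le> 1 + \<bar>z\<bar>" using assms by (auto simp: slab_def)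
  finally show ?thesis by simp
qed

lemma bounded_prism:
  assumes "norm u = 1" "bounded S"
  shows "bounded (prism u z S)"
proof -
  obtain R where R: "\<And>x. x \<in> S \<Longrightarrow> norm x \<le> R" using assms(2) by (auto simp: bounded_iff)
  show ?thesis
  proof (rule boundedI)
    fix x assume "x \<in> prism u z S"
    then show "norm x \<le> R + 1 + \<bar>z\<bar>"
      using norm_level_proj_le[OF assms(1), of x z] R[of "level_proj u z x"] by (auto simp: prism_def)
  qed
qed

lemma compact_prism:
  assumes "norm u = 1" "compact S"
  shows "compact (prism u z S)"
proof -
  have "prism u z S = slab u \<inter> level_proj u z -` S" by (auto simp: prism_def)
  also have "closed \<dots>"
    by (intro closed_Int closed_slab closed_vimage compact_imp_closed[OF assms(2)] continuous_intros)
  finally show ?thesis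
    using bounded_prism[OF assms(1)] assms(2) by (simp add: compact_eq_bounded_closed)
qed

lemma convex_comb_level_proj:
  assumes "a + b = (1::real)"
  shows "level_proj u (a * z + b * y) (a *\<^sub>R x + b *\<^sub>R x') = a *\<^sub>R level_proj u z x + b *\<^sub>R level_proj u y x'"
  by (simp add: level_proj_def inner_add_left algebra_simps)

lemma convex_slab: "convex (slab u)"
proof -
  have "slab u = {x. u \<bullet> x \<ge> 0} \<inter> {x. u \<bullet> x \<le> 1}" by (auto simp: slab_def inner_commute)
  then show ?thesis by (simp add: convex_halfspace_le convex_halfspace_ge convex_Int)
qed

lemma convex_prism:
  assumes "convex S"
  shows "convex (prism u z S)"
proof (rule convexI)
  fix x y a b assume h: "x \<in> prism u z S" "y \<in> prism u z S" "0 \<le> a" "0 \<le> b" "a + b = (1::real)"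
  have "a * z + b * z = z" using h(5) by (metis distrib_right mult_1)
  then have "level_proj u z (a *\<^sub>R x + b *\<^sub>R y) \<in> S"
    using convex_comb_level_proj[OF h(5), of u z z x y] h convexD[OF assms] by (auto simp: prism_def)
  then show "a *\<^sub>R x + b *\<^sub>R y \<in> prism u z S"
    using h convexD[OF convex_slab, of x u y a b] by (auto simp: prism_def)
qed

text \<open>The exceptional points form the frontier of a convex cylinder over the slice at level
  \<open>z\<close>, which is negligible. The levels must stay in \<open>{lo..hi}\<close>: on leaving
  this range the slice may drop abruptly to the empty set, and these drops are the jumps studied
  later.\<close>

lemma AE_indicator_level_proj_tendsto:
  fixes P :: "'a::euclidean_space set"
  assumes u: "norm u = 1" and P: "closed P" "convex P"
    and a: "a \<in> P" "a \<bullet> u = lo" and b: "b \<in> P" "b \<bullet> u = hi"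
    and zn: "\<And>n. zn n \<in> {lo..hi}" "zn \<longlonglongrightarrow> z"
  shows "AE x in lborel. (\<lambda>n. indicator P (level_proj u (zn n) x) :: ennreal) \<longlonglongrightarrow> indicator P (level_proj u z x)"
proof -
  define X where "X = level_proj u z -` P"
  have "closed X" unfolding X_def by (intro closed_vimage P continuous_intros)
  have "convex X"
  proof (rule convexI)
    fix x y c d assume h: "x \<in> X" "y \<in> X" "0 \<le> c" "0 \<le> d" "c + d = (1::real)"
    have "c * z + d * z = z" using h(5) by (metis distrib_right mult_1)
    then show "c *\<^sub>R x + d *\<^sub>R y \<in> X"
      using convex_comb_level_proj[OF h(5), of u z z x y] h convexD[OF P(2)] by (auto simp: X_def)
  qed
  have "negligible (frontier X)" by (rule negligible_convex_frontier[OF \<open>convex X\<close>])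
  then have "AE x in lebesgue. x \<notin> frontier X"
    by (simp add: negligible_iff_null_sets AE_not_in)
  then have AE: "AE x in lborel. x \<notin> frontier X"
    by (simp add: AE_completion_iff)
  have conv: "(\<lambda>n. level_proj u (zn n) x) \<longlonglongrightarrow> level_proj u z x" for x
    unfolding level_proj_def by (intro tendsto_intros zn)
  have zin: "z \<in> {lo..hi}"
    using closed_sequentially[OF closed_atLeastAtMost _ zn(2)] zn(1) by blast
  have key: "\<forall>\<^sub>F n in sequentially. zn n \<noteq> z \<and> 0 < s * (zn n - z) \<longrightarrow> level_proj u (zn n) x \<in> P"
    if x: "x \<in> interior X" and q: "q \<in> P" "0 < s * (q \<bullet> u - z)" for x q and s :: real
  proof -
    \<comment> \<open>\<open>th\<close> is chosen so that the projected point at level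
      \<open>zn n\<close> is the convex combination
      \<open>(1 - th n) *\<^sub>R y n + th n *\<^sub>R q\<close> with \<open>y n\<close> at level
      \<open>z\<close>. As \<open>th\<close> tends to 0, \<open>y n\<close> approaches the point
      over \<open>x\<close> and so lies in \<open>P\<close>.\<close>
    define th where "th n = (zn n - z) / (q \<bullet> u - z)" for n
    define y where "y n = inverse (1 - th n) *\<^sub>R (level_proj u (zn n) x - th n *\<^sub>R q)" for n
    have qz: "q \<bullet> u - z \<noteq> 0" using q by auto
    have th0: "th \<longlonglongrightarrow> 0"
    proof -
      have "th \<longlonglongrightarrow> (z - z) / (q \<bullet> u - z)"
        unfolding th_def by (intro tendsto_intros zn qz)
      then show ?thesis by simp
    qed
    have "y \<longlonglongrightarrow> inverse (1 - 0) *\<^sub>R (level_proj u z x - 0 *\<^sub>R q)"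
      unfolding y_def by (intro tendsto_intros conv th0) auto
    then have y0: "(\<lambda>n. x + (y n - level_proj u z x)) \<longlonglongrightarrow> x + (level_proj u z x - level_proj u z x)"
      by (intro tendsto_intros) auto
    have "\<forall>\<^sub>F n in sequentially. x + (y n - level_proj u z x) \<in> interior X"
      using y0 x by (auto intro: topological_tendstoD)
    moreover have "\<forall>\<^sub>F n in sequentially. th n < 1"
      using th0 by (auto intro: order_tendstoD)
    ultimately show ?thesis
    proof eventually_elim
      case (elim n)
      show ?case
      proof
        assume "zn n \<noteq> z \<and> 0 < s * (zn n - z)"
        then have pos: "0 < th n"
          using q(2) by (auto simp: th_def zero_less_divide_iff zero_less_mult_iff)
        have "y n \<bullet> u = inverse (1 - th n) * (zn n - th n * (q \<bullet> u))"
          by (simp add: y_def inner_diff_left level_proj_inner[OF u])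
        also have "zn n - th n * (q \<bullet> u) = (1 - th n) * z"
          using qz by (simp add: th_def field_simps)
        finally have yu: "y n \<bullet> u = z" using elim by simp
        have "level_proj u z (x + (y n - level_proj u z x)) = y n"
          using yu u by (simp add: level_proj_def inner_add_left inner_diff_left dot_square_norm algebra_simps)
        then have "y n \<in> P" using elim(1) interior_subset by (fastforce simp: X_def)
        then have "(1 - th n) *\<^sub>R y n + th n *\<^sub>R q \<in> P"
          using elim pos q by (intro convexD[OF P(2)]) auto
        moreover have "(1 - th n) *\<^sub>R y n + th n *\<^sub>R q = level_proj u (zn n) x"
          using elim by (simp add: y_def)
        ultimately show "level_proj u (zn n) x \<in> P" by simp
      qed
    qed
  qed
  show ?thesis
    using AE
  proof eventually_elim
    case (elim x)
    have "\<forall>\<^sub>F n in sequentially. indicator P (level_proj u (zn n) x) = (indicator P (level_proj u z x) :: ennreal)"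
    proof (cases "x \<in> X")
      case False
      then have "level_proj u z x \<in> - P" by (simp add: X_def)
      then have "\<forall>\<^sub>F n in sequentially. level_proj u (zn n) x \<in> - P"
        using P conv by (intro topological_tendstoD[OF conv]) auto
      then show ?thesis
        by (rule eventually_mono) (use \<open>level_proj u z x \<in> - P\<close> in auto)
    next
      case True
      then have xi: "x \<in> interior X" using elim \<open>closed X\<close> by (simp add: frontier_def)
      have "\<forall>\<^sub>F n in sequentially. zn n \<noteq> z \<and> 0 < zn n - z \<longrightarrow> level_proj u (zn n) x \<in> P"
      proof (cases "z < hi")
        case True
        then show ?thesis using key[OF xi b(1), of 1] b by simp
      next
        case False
        then have "\<not> (0 < zn n - z)" for n using zn(1)[of n] zin by auto
        then show ?thesis by simp
      qed
      moreover have "\<forall>\<^sub>F n in sequentially. zn n \<noteq> z \<and> zn n - z < 0 \<longrightarrow> level_proj u (zn n) x \<in> P"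
      proof (cases "lo < z")
        case True
        then show ?thesis using key[OF xi a(1), of "-1"] a by simp
      next
        case False
        then have "\<not> (zn n - z < 0)" for n using zn(1)[of n] zin by auto
        then show ?thesis by simp
      qed
      ultimately show ?thesis
      proof eventually_elim
        case (elim n)
        then have "level_proj u (zn n) x \<in> P" using True by (cases "zn n = z") (auto simp: X_def)
        then show ?case using True by (simp add: X_def)
      qed
    qed
    then show ?case by (rule tendsto_eventually)
  qed
qed

section \<open>Cutting a bounded set by parallel hyperplanes\<close>

lemma lborel_hyperplane_null:
  fixes u :: "'a::euclidean_space"
  assumes "u \<noteq> 0"
  shows "{x. x \<bullet> u = c} \<in> null_sets lborel"
proof -
  have "negligible {x. u \<bullet> x = c}" using assms by (intro negligible_hyperplane) auto
  then show ?thesis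
    by (simp add: negligible_iff_null_sets null_sets_completion_iff inner_commute)
qed

lemma measure_halfspace_split:
  fixes S :: "'a::euclidean_space set"
  assumes "u \<noteq> 0" and S: "bounded S" and [measurable]: "S \<in> sets borel"
  shows "measure lborel S = measure lborel (S \<inter> {x. x \<bullet> u < c}) + measure lborel (S \<inter> {x. x \<bullet> u > c})"
    and "measure lborel (S \<inter> {x. x \<bullet> u \<le> c}) = measure lborel (S \<inter> {x. x \<bullet> u < c})"
    and "measure lborel (S \<inter> {x. x \<bullet> u \<ge> c}) = measure lborel (S \<inter> {x. x \<bullet> u > c})"
proof -
  have ae: "AE x in lborel. x \<bullet> u \<noteq> c"
    using AE_not_in[OF lborel_hyperplane_null[OF assms(1), of c]] by simp
  have [measurable]: "{x. x \<bullet> u < c} \<in> sets borel" "{x. x \<bullet> u > c} \<in> sets borel"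
    "{x. x \<bullet> u \<le> c} \<in> sets borel" "{x. x \<bullet> u \<ge> c} \<in> sets borel"
    by (auto intro!: borel_open open_Collect_less borel_closed closed_Collect_le continuous_intros)
  show "measure lborel (S \<inter> {x. x \<bullet> u \<le> c}) = measure lborel (S \<inter> {x. x \<bullet> u < c})"
    by (intro measure_eq_AE) (use ae in \<open>auto elim!: eventually_mono\<close>)
  show "measure lborel (S \<inter> {x. x \<bullet> u \<ge> c}) = measure lborel (S \<inter> {x. x \<bullet> u > c})"
    by (intro measure_eq_AE) (use ae in \<open>auto elim!: eventually_mono\<close>)
  have fin: "bounded T \<Longrightarrow> emeasure lborel T \<noteq> \<infinity>" for T :: "'a set"
    using emeasure_bounded_finite[of T] by auto
  have "measure lborel S = measure lborel ((S \<inter> {x. x \<bullet> u < c}) \<union> (S \<inter> {x. x \<bullet> u > c}))"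
    by (intro measure_eq_AE) (use ae in \<open>auto elim!: eventually_mono\<close>)
  also have "\<dots> = measure lborel (S \<inter> {x. x \<bullet> u < c}) + measure lborel (S \<inter> {x. x \<bullet> u > c})"
    by (intro measure_Union fin bounded_subset[OF S]) auto
  finally show "measure lborel S = measure lborel (S \<inter> {x. x \<bullet> u < c}) + measure lborel (S \<inter> {x. x \<bullet> u > c})" .
qed

text \<open>The volume between two levels is the integral of section areas, which have a common
  bound, so the function is even Lipschitz.\<close>

lemma continuous_measure_halfspace:
  fixes S :: "'a::euclidean_space set"
  assumes u: "norm u = 1" and S: "bounded S" and [measurable]: "S \<in> sets borel"
  shows "continuous_on UNIV (\<lambda>c. measure lborel (S \<inter> {x. x \<bullet> u \<le> c}))"
proof -
  obtain R where R: "\<And>x. x \<in> S \<Longrightarrow> norm x \<le> R" using S by (auto simp: bounded_iff)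
  \<comment> \<open>A slice of \<open>S\<close> is nonempty only for
    \<open>\<bar>z\<bar> \<le> R\<close>; its prism then lies within distance
    \<open>R + 1 + \<bar>z\<bar>\<close> of the origin.\<close>
  define V where "V = measure lborel (cball (0::'a) (2 * R + 1))"
  have fin: "bounded T \<Longrightarrow> emeasure lborel T \<noteq> \<infinity>" for T :: "'a set"
    using emeasure_bounded_finite[of T] by auto
  have [measurable]: "{x. x \<bullet> u \<le> c} \<in> sets borel" for c
    by (auto intro!: borel_closed closed_Collect_le continuous_intros)
  have pr: "emeasure lborel (prism u z S) \<le> ennreal V" for z
  proof -
    have "prism u z S \<subseteq> cball 0 (2 * R + 1)"
    proof
      fix x assume x: "x \<in> prism u z S"
      then have p: "level_proj u z x \<in> S" and "x \<in> slab u" by (auto simp: prism_def)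
      have "\<bar>z\<bar> \<le> norm (level_proj u z x)"
        using Cauchy_Schwarz_ineq2[of "level_proj u z x" u] u by (simp add: level_proj_inner)
      then show "x \<in> cball 0 (2 * R + 1)"
        using norm_level_proj_le[OF u \<open>x \<in> slab u\<close>, of z] R[OF p] by simp
    qed
    then have "emeasure lborel (prism u z S) \<le> emeasure lborel (cball (0::'a) (2 * R + 1))"
      by (intro emeasure_mono) auto
    also have "\<dots> = ennreal V" unfolding V_def
      by (intro emeasure_eq_ennreal_measure) (use fin[of "cball 0 (2 * R + 1)"] in auto)
    finally show ?thesis .
  qed
  have lip: "\<bar>measure lborel (S \<inter> {x. x \<bullet> u \<le> d}) - measure lborel (S \<inter> {x. x \<bullet> u \<le> c})\<bar> \<le> V * \<bar>d - c\<bar>"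
    if "c \<le> d" for c d
  proof -
    have *: "{x \<in> S. x \<bullet> u \<in> {c<..d}} = S \<inter> {x. x \<bullet> u \<le> d} - S \<inter> {x. x \<bullet> u \<le> c}" by auto
    have "emeasure lborel {x \<in> S. x \<bullet> u \<in> {c<..d}} = (\<integral>\<^sup>+z. emeasure lborel (prism u z S) * indicator {c<..d} z \<partial>lborel)"
      by (rule emeasure_slices[OF u]) auto
    also have "\<dots> \<le> (\<integral>\<^sup>+z. ennreal V * indicator {c<..d} z \<partial>lborel)"
      by (intro nn_integral_mono mult_right_mono pr) auto
    also have "\<dots> = ennreal (V * (d - c))"
      using that by (subst nn_integral_cmult) (auto simp: ennreal_mult' V_def)
    finally have "enn2real (emeasure lborel {x \<in> S. x \<bullet> u \<in> {c<..d}}) \<le> V * (d - c)"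
      using that by (intro enn2real_leI) (auto simp: V_def)
    then have "measure lborel {x \<in> S. x \<bullet> u \<in> {c<..d}} \<le> V * (d - c)"
      unfolding measure_def .
    moreover have "measure lborel {x \<in> S. x \<bullet> u \<in> {c<..d}}
      = measure lborel (S \<inter> {x. x \<bullet> u \<le> d}) - measure lborel (S \<inter> {x. x \<bullet> u \<le> c})"
      unfolding * using that by (intro measure_Diff fin bounded_subset[OF S]) auto
    moreover have "measure lborel (S \<inter> {x. x \<bullet> u \<le> c}) \<le> measure lborel (S \<inter> {x. x \<bullet> u \<le> d})"
      using that by (intro measure_mono_fmeasurable fmeasurableI)
        (auto intro!: emeasure_bounded_finite[THEN less_le_trans] bounded_subset[OF S])
    ultimately show ?thesis using that by simp
  qed
  have "V-lipschitz_on UNIV (\<lambda>c. measure lborel (S \<inter> {x. x \<bullet> u \<le> c}))"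
  proof (rule lipschitz_onI)
    fix c d :: real
    show "dist (measure lborel (S \<inter> {x. x \<bullet> u \<le> c})) (measure lborel (S \<inter> {x. x \<bullet> u \<le> d})) \<le> V * dist c d"
      using lip[of c d] lip[of d c] by (cases "c \<le> d") (auto simp: dist_real_def abs_minus_commute)
  qed (simp add: V_def)
  then show ?thesis by (rule lipschitz_on_continuous_on)
qed

lemma measure_halfspace_level_exists:
  fixes S :: "'a::euclidean_space set"
  assumes u: "norm u = 1" and S: "bounded S" "S \<in> sets borel" and t: "0 \<le> t" "t \<le> measure lborel S"
  obtains c where "measure lborel (S \<inter> {x. x \<bullet> u \<le> c}) = t"
proof -
  obtain R where R: "\<And>x. x \<in> S \<Longrightarrow> norm x \<le> R" "R > 0" using S by (auto simp: bounded_pos)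
  have b: "\<bar>x \<bullet> u\<bar> \<le> R" if "x \<in> S" for x
    using Cauchy_Schwarz_ineq2[of x u] R(1)[OF that] u by simp
  have "S \<inter> {x. x \<bullet> u \<le> - R - 1} = {}" "S \<inter> {x. x \<bullet> u \<le> R} = S"
    using b by (force simp: abs_le_iff)+
  then have "\<exists>c. - R - 1 \<le> c \<and> c \<le> R \<and> measure lborel (S \<inter> {x. x \<bullet> u \<le> c}) = t"
    using t R continuous_on_subset[OF continuous_measure_halfspace[OF u S] subset_UNIV]
    by (intro IVT') auto
  then show ?thesis using that by blast
qed

section \<open>The Brunn-Minkowski inequality\<close>

definition msum :: "'a::real_vector set \<Rightarrow> 'a set \<Rightarrow> 'a set" where
  "msum X Y = (\<Union>x\<in>X. \<Union>y\<in>Y. {x + y})"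

lemma msumI: "x \<in> X \<Longrightarrow> y \<in> Y \<Longrightarrow> x + y \<in> msum X Y"
  by (auto simp: msum_def)

lemma msum_commute: "msum X Y = msum Y X"
  unfolding msum_def by (auto simp: add.commute)

lemma msum_mono: "X \<subseteq> X' \<Longrightarrow> Y \<subseteq> Y' \<Longrightarrow> msum X Y \<subseteq> msum X' Y'"
  by (auto simp: msum_def)

lemma open_msum: "open X \<Longrightarrow> open (msum X (Y::'a::real_normed_vector set))"
  unfolding msum_def by (rule open_sums) simp

lemma bounded_msum:
  assumes "bounded X" "bounded (Y::'a::real_normed_vector set)"
  shows "bounded (msum X Y)"
  using bounded_plus[OF assms] unfolding msum_def by (rule bounded_subset) auto

text \<open>In each coordinate the point divides the interval of the sum in some ratio
  \<open>th i\<close>; dividing both summand intervals in this ratio splits the point.\<close>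

lemma box_subset_msum:
  fixes a b c d :: "'a::euclidean_space"
  assumes "box a b \<noteq> {}" "box c d \<noteq> {}"
  shows "box (a + c) (b + d) \<subseteq> msum (box a b) (box c d)"
proof
  fix x assume x: "x \<in> box (a + c) (b + d)"
  have ab: "a \<bullet> i < b \<bullet> i" and cd: "c \<bullet> i < d \<bullet> i" if "i \<in> Basis" for i
    using assms that by (auto simp: box_ne_empty)
  define th where "th i = (x \<bullet> i - a \<bullet> i - c \<bullet> i) / (b \<bullet> i + d \<bullet> i - a \<bullet> i - c \<bullet> i)" for i
  have th: "0 < th i" "th i < 1" "th i * (b \<bullet> i + d \<bullet> i - a \<bullet> i - c \<bullet> i) = x \<bullet> i - a \<bullet> i - c \<bullet> i" if "i \<in> Basis" for i
    using x ab[OF that] cd[OF that] that by (auto simp: th_def mem_box inner_add_left field_simps)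
  define y where "y = (\<Sum>i\<in>Basis. (a \<bullet> i + th i * (b \<bullet> i - a \<bullet> i)) *\<^sub>R i)"
  define w where "w = (\<Sum>i\<in>Basis. (c \<bullet> i + th i * (d \<bullet> i - c \<bullet> i)) *\<^sub>R i)"
  have yi: "y \<bullet> i = a \<bullet> i + th i * (b \<bullet> i - a \<bullet> i)" and wi: "w \<bullet> i = c \<bullet> i + th i * (d \<bullet> i - c \<bullet> i)"
    if "i \<in> Basis" for i
    using that by (auto simp: y_def w_def)
  have ex: "0 < th i * (b \<bullet> i - a \<bullet> i)" "th i * (b \<bullet> i - a \<bullet> i) < b \<bullet> i - a \<bullet> i"
    "0 < th i * (d \<bullet> i - c \<bullet> i)" "th i * (d \<bullet> i - c \<bullet> i) < d \<bullet> i - c \<bullet> i" if "i \<in> Basis" for i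
    using th[OF that] ab[OF that] cd[OF that]
      mult_strict_right_mono[of "th i" 1 "b \<bullet> i - a \<bullet> i"] mult_strict_right_mono[of "th i" 1 "d \<bullet> i - c \<bullet> i"]
    by auto
  have "y \<in> box a b" "w \<in> box c d"
    using ex by (auto simp: mem_box yi wi less_diff_eq[symmetric] add.commute[of "_ \<bullet> _" "_ * _"])
  moreover have "x = y + w"
  proof (rule euclidean_eqI)
    fix i :: 'a assume i: "i \<in> Basis"
    show "x \<bullet> i = (y + w) \<bullet> i"
      using th(3)[OF i] unfolding inner_add_left yi[OF i] wi[OF i] by (simp only: algebra_simps)
  qed
  ultimately show "x \<in> msum (box a b) (box c d)" by (auto intro: msumI)
qed

lemma sqrt_prod: "finite A \<Longrightarrow> (\<Prod>i\<in>A. sqrt (f i)) = sqrt (\<Prod>i\<in>A. f i)"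
  by (induction A rule: finite_induct) (auto simp: real_sqrt_mult)

text \<open>The arithmetic-geometric mean inequality in every coordinate. The geometric-mean form is
  used throughout because it scales linearly when both sets are cut in the same proportion.\<close>

lemma brunn_minkowski_boxes:
  fixes a b c d :: "'a::euclidean_space"
  assumes "box a b \<noteq> {}" "box c d \<noteq> {}"
  shows "2 ^ DIM('a) * sqrt (measure lborel (box a b) * measure lborel (box c d))
    \<le> measure lborel (msum (box a b) (box c d))"
proof -
  have ab: "a \<bullet> i < b \<bullet> i" and cd: "c \<bullet> i < d \<bullet> i" if "i \<in> Basis" for i
    using assms that by (auto simp: box_ne_empty)
  have sq: "2 * sqrt (s * t) \<le> s + t" if "0 \<le> s" "0 \<le> t" for s t :: real
    using arith_geo_mean_sqrt[OF that] by simp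
  have "2 ^ DIM('a) * sqrt (measure lborel (box a b) * measure lborel (box c d))
    = (\<Prod>i\<in>Basis. 2 * sqrt (((b - a) \<bullet> i) * ((d - c) \<bullet> i)))"
    using ab cd by (simp add: measure_lborel_box_eq less_imp_le prod.distrib sqrt_prod real_sqrt_mult)
  also have "\<dots> \<le> (\<Prod>i\<in>Basis. ((b + d) - (a + c)) \<bullet> i)"
  proof (intro prod_mono conjI)
    fix i :: 'a assume i: "i \<in> Basis"
    then have p: "0 \<le> (b - a) \<bullet> i" "0 \<le> (d - c) \<bullet> i" using ab cd by (auto simp: inner_diff_left less_imp_le)
    then show "0 \<le> 2 * sqrt (((b - a) \<bullet> i) * ((d - c) \<bullet> i))" by simp
    show "2 * sqrt (((b - a) \<bullet> i) * ((d - c) \<bullet> i)) \<le> ((b + d) - (a + c)) \<bullet> i"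
      using sq[OF p] by (simp add: inner_diff_left inner_add_left)
  qed
  also have "\<dots> = measure lborel (box (a + c) (b + d))"
    using ab cd by (subst measure_lborel_box_eq) (force simp: inner_add_left intro!: add_mono less_imp_le)
  also have "\<dots> \<le> measure lborel (msum (box a b) (box c d))"
    by (intro measure_mono_fmeasurable box_subset_msum assms fmeasurableI emeasure_bounded_finite bounded_msum)
       (auto intro!: borel_open open_msum)
  finally show ?thesis .
qed

definition box_family :: "'a::euclidean_space set set \<Rightarrow> bool" where
  "box_family D \<longleftrightarrow> finite D \<and> disjoint D \<and> (\<forall>K\<in>D. K \<noteq> {} \<and> (\<exists>a b. K = box a b))"

text \<open>Empty pieces are dropped so that the number of boxes falls as soon as one box misses
  \<open>H\<close>; this number drives the induction.\<close>

definition cut :: "'a set set \<Rightarrow> 'a set \<Rightarrow> 'a set set" where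
  "cut D H = (\<lambda>K. K \<inter> H) ` D - {{}}"

lemma Union_cut: "\<Union>(cut D H) = \<Union>D \<inter> H"
  by (auto simp: cut_def)

lemma box_Int_halfspace:
  fixes a b :: "'a::euclidean_space"
  assumes i: "i \<in> Basis"
  shows "\<exists>a' b'. box a b \<inter> {x. x \<bullet> i < c} = box a' b'"
    and "\<exists>a' b'. box a b \<inter> {x. x \<bullet> i > c} = box a' b'"
proof -
  have e: "(b + (min (b \<bullet> i) c - b \<bullet> i) *\<^sub>R i) \<bullet> j = (if j = i then min (b \<bullet> i) c else b \<bullet> j)" 
    "(a + (max (a \<bullet> i) c - a \<bullet> i) *\<^sub>R i) \<bullet> j = (if j = i then max (a \<bullet> i) c else a \<bullet> j)" if "j \<in> Basis" for j
    using i that by (auto simp: inner_add_left inner_Basis)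
  have "box a b \<inter> {x. x \<bullet> i < c} = box a (b + (min (b \<bullet> i) c - b \<bullet> i) *\<^sub>R i)"
    using i by (auto simp: mem_box e split: if_splits)
  then show "\<exists>a' b'. box a b \<inter> {x. x \<bullet> i < c} = box a' b'" by blast
  have "box a b \<inter> {x. x \<bullet> i > c} = box (a + (max (a \<bullet> i) c - a \<bullet> i) *\<^sub>R i) b"
    using i by (auto simp: mem_box e split: if_splits)
  then show "\<exists>a' b'. box a b \<inter> {x. x \<bullet> i > c} = box a' b'" by blast
qed

lemma box_family_cut:
  assumes "box_family D" "i \<in> Basis"
  shows "box_family (cut D {x. x \<bullet> i < c})" "box_family (cut D {x. x \<bullet> i > c})"
proof -
  have dis: "disjoint (cut D H)" for H
  proof (rule disjointI)
    fix a b assume "a \<in> cut D H" "b \<in> cut D H" "a \<noteq> b"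
    then obtain K L where "K \<in> D" "L \<in> D" "K \<noteq> L" "a = K \<inter> H" "b = L \<inter> H"
      by (auto simp: cut_def)
    then show "a \<inter> b = {}" using assms(1) by (auto simp: box_family_def disjoint_def)
  qed
  show "box_family (cut D {x. x \<bullet> i < c})" "box_family (cut D {x. x \<bullet> i > c})"
    using assms dis box_Int_halfspace[OF assms(2)] by (auto simp: box_family_def cut_def)
qed

lemma card_cut:
  assumes "finite D"
  shows "card (cut D H) \<le> card D" "K \<in> D \<Longrightarrow> K \<inter> H = {} \<Longrightarrow> card (cut D H) < card D"
proof -
  have "card (cut D H) \<le> card ((\<lambda>K. K \<inter> H) ` D)"
    unfolding cut_def using assms by (intro card_mono) auto
  also have "\<dots> \<le> card D" by (rule card_image_le[OF assms])
  finally show "card (cut D H) \<le> card D" .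
  assume K: "K \<in> D" "K \<inter> H = {}"
  then have "cut D H \<subseteq> (\<lambda>K. K \<inter> H) ` (D - {K})" by (auto simp: cut_def)
  then have "card (cut D H) \<le> card ((\<lambda>K. K \<inter> H) ` (D - {K}))"
    using assms by (intro card_mono) auto
  also have "\<dots> \<le> card (D - {K})" using assms by (intro card_image_le) auto
  also have "\<dots> < card D" using K assms by (intro psubset_card_mono) auto
  finally show "card (cut D H) < card D" .
qed

lemma box_family_Union:
  assumes "box_family D"
  shows "open (\<Union>D)" "bounded (\<Union>D)" "\<Union>D \<in> sets borel"
proof -
  show "open (\<Union>D)" "bounded (\<Union>D)"
    using assms unfolding box_family_def by (intro open_Union bounded_Union; metis open_box bounded_box)+
  then show "\<Union>D \<in> sets borel" by simp
qed

text \<open>Disjoint nonempty boxes have disjoint projections to some axis, and an endpoint between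
  the two intervals serves as \<open>t\<close>.\<close>

lemma separating_coordinate:
  fixes a b c d :: "'a::euclidean_space"
  assumes "box a b \<noteq> {}" "box c d \<noteq> {}" "box a b \<inter> box c d = {}"
  obtains i t where "i \<in> Basis" "(box a b \<subseteq> {x. x \<bullet> i < t} \<and> box c d \<subseteq> {x. x \<bullet> i > t}) \<or> (box a b \<subseteq> {x. x \<bullet> i > t} \<and> box c d \<subseteq> {x. x \<bullet> i < t})"
proof -
  obtain i where i: "i \<in> Basis" "b \<bullet> i \<le> a \<bullet> i \<or> d \<bullet> i \<le> c \<bullet> i \<or> b \<bullet> i \<le> c \<bullet> i \<or> d \<bullet> i \<le> a \<bullet> i"
    using assms(3) unfolding disjoint_interval by blast
  moreover have "a \<bullet> i < b \<bullet> i" "c \<bullet> i < d \<bullet> i" using assms i by (auto simp: box_ne_empty)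
  ultimately consider "b \<bullet> i \<le> c \<bullet> i" | "d \<bullet> i \<le> a \<bullet> i" by linarith
  then show ?thesis
  proof cases
    case 1
    then show ?thesis using i(1) by (intro that[of i "b \<bullet> i"]) (force simp: mem_box)+
  next
    case 2
    then show ?thesis using i(1) by (intro that[of i "d \<bullet> i"]) (force simp: mem_box)+
  qed
qed

text \<open>The argument of Hadwiger and Ohmann: a coordinate hyperplane that separates two boxes
  of one family is matched with the parallel hyperplane that cuts the other family in the
  same proportion.\<close>
lemma brunn_minkowski_step:
  fixes D E :: "'a::euclidean_space set set"
  assumes D: "box_family D" "K \<in> D" "L \<in> D" "K \<noteq> L" and E: "box_family E"
    and IH: "\<And>D' E' :: 'a set set. box_family D' \<Longrightarrow> box_family E' \<Longrightarrow> card D' < card D \<Longrightarrow> card E' \<le> card E \<Longrightarrow>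
      2 ^ DIM('a) * sqrt (measure lborel (\<Union>D') * measure lborel (\<Union>E')) \<le> measure lborel (msum (\<Union>D') (\<Union>E'))"
  shows "2 ^ DIM('a) * sqrt (measure lborel (\<Union>D) * measure lborel (\<Union>E)) \<le> measure lborel (msum (\<Union>D) (\<Union>E))"
proof -
  obtain a b c d where KL: "K = box a b" "L = box c d" "K \<noteq> {}" "L \<noteq> {}"
    using D unfolding box_family_def by metis
  have "K \<inter> L = {}" using D by (auto simp: box_family_def disjoint_def)
  then obtain i t where i: "i \<in> Basis" and sep: "(K \<subseteq> {x. x \<bullet> i < t} \<and> L \<subseteq> {x. x \<bullet> i > t}) \<or> (K \<subseteq> {x. x \<bullet> i > t} \<and> L \<subseteq> {x. x \<bullet> i < t})"
    using separating_coordinate[of a b c d] KL by metis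
  have fD: "finite D" and fE: "finite E" using D E by (auto simp: box_family_def)
  define X Y where "X = \<Union>D" and "Y = \<Union>E"
  have X: "open X" "bounded X" "X \<in> sets borel" and Y: "open Y" "bounded Y" "Y \<in> sets borel"
    unfolding X_def Y_def using box_family_Union[OF D(1)] box_family_Union[OF E] by auto
  define X1 X2 where "X1 = X \<inter> {x. x \<bullet> i < t}" and "X2 = X \<inter> {x. x \<bullet> i > t}"
  have i0: "i \<noteq> 0" "norm i = 1" using i by auto
  have Xs: "measure lborel X = measure lborel X1 + measure lborel X2"
    unfolding X1_def X2_def by (rule measure_halfspace_split[OF i0(1) X(2,3)])
  have KX: "K \<subseteq> X" using D by (auto simp: X_def)
  have "0 < measure lborel K"
    using KL by (auto simp: measure_lborel_box_eq box_ne_empty less_imp_le inner_diff_left intro!: prod_pos)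
  also have "\<dots> \<le> measure lborel X"
    using X KX KL by (intro measure_mono_fmeasurable fmeasurableI emeasure_bounded_finite) auto
  finally have Xpos: "0 < measure lborel X" .
  \<comment> \<open>The fraction of \<open>X\<close> below the separating hyperplane;
    \<open>s\<close> is then chosen to cut off the same fraction of \<open>Y\<close>. The induction
    hypothesis contributes \<open>r\<close> and \<open>1 - r\<close> times the desired
    bound.\<close>
  define r where "r = measure lborel X1 / measure lborel X"
  have r: "0 \<le> r" "r \<le> 1" "measure lborel X1 = r * measure lborel X" "measure lborel X2 = (1 - r) * measure lborel X"
    using Xpos Xs by (auto simp: r_def field_simps)
  obtain s where s: "measure lborel (Y \<inter> {x. x \<bullet> i \<le> s}) = r * measure lborel Y"
    using measure_halfspace_level_exists[OF i0(2) Y(2,3), of "r * measure lborel Y"] r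
    by (auto simp: mult_left_le_one_le)
  define Y1 Y2 where "Y1 = Y \<inter> {x. x \<bullet> i < s}" and "Y2 = Y \<inter> {x. x \<bullet> i > s}"
  have Ys: "measure lborel Y1 = r * measure lborel Y" "measure lborel Y2 = (1 - r) * measure lborel Y"
    using measure_halfspace_split[OF i0(1) Y(2,3), of s] s by (auto simp: Y1_def Y2_def algebra_simps)
  have sq: "sqrt (q * v * (q * w)) = q * sqrt (v * w)" if "0 \<le> q" for q v w
  proof -
    have "q * v * (q * w) = q\<^sup>2 * (v * w)" by (simp add: power2_eq_square)
    then show ?thesis using that by (simp add: real_sqrt_mult)
  qed
  have cardD: "card (cut D {x. x \<bullet> i < t}) < card D" "card (cut D {x. x \<bullet> i > t}) < card D"
  proof -
    \<comment> \<open>Each open half-space misses one of the two separated boxes, so both halves of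
      \<open>D\<close> have fewer boxes; the number of boxes in \<open>E\<close> at least does not
      grow.\<close>
    have "K \<inter> {x. x \<bullet> i < t} = {} \<or> L \<inter> {x. x \<bullet> i < t} = {}" using sep by force
    then show "card (cut D {x. x \<bullet> i < t}) < card D"
      using card_cut(2)[OF fD D(2)] card_cut(2)[OF fD D(3)] by blast
    have "K \<inter> {x. x \<bullet> i > t} = {} \<or> L \<inter> {x. x \<bullet> i > t} = {}" using sep by force
    then show "card (cut D {x. x \<bullet> i > t}) < card D"
      using card_cut(2)[OF fD D(2)] card_cut(2)[OF fD D(3)] by blast
  qed
  have "2 ^ DIM('a) * sqrt (measure lborel X1 * measure lborel Y1) \<le> measure lborel (msum X1 Y1)"
    unfolding X1_def X_def Y1_def Y_def Union_cut[symmetric]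
    by (rule IH, rule box_family_cut(1)[OF D(1) i], rule box_family_cut(1)[OF E i], rule cardD(1), rule card_cut(1)[OF fE])
  then have 1: "2 ^ DIM('a) * (r * sqrt (measure lborel X * measure lborel Y)) \<le> measure lborel (msum X1 Y1)"
    unfolding Ys r(3,4) by (subst (asm) sq) (use r in auto)
  have "2 ^ DIM('a) * sqrt (measure lborel X2 * measure lborel Y2) \<le> measure lborel (msum X2 Y2)"
    unfolding X2_def X_def Y2_def Y_def Union_cut[symmetric]
    by (rule IH, rule box_family_cut(2)[OF D(1) i], rule box_family_cut(2)[OF E i], rule cardD(2), rule card_cut(1)[OF fE])
  then have 2: "2 ^ DIM('a) * ((1 - r) * sqrt (measure lborel X * measure lborel Y)) \<le> measure lborel (msum X2 Y2)"
    unfolding Ys r(3,4) by (subst (asm) sq) (use r in auto)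
  have o: "open (msum X1 Y1)" "open (msum X2 Y2)" "open (msum X Y)"
    using X(1) by (auto simp: X1_def X2_def intro!: open_msum open_Int open_Collect_less continuous_intros)
  have sub: "msum X1 Y1 \<union> msum X2 Y2 \<subseteq> msum X Y"
    by (auto simp: msum_def X1_def X2_def Y1_def Y2_def)
  have bd: "bounded (msum X Y)" using X Y by (auto intro: bounded_msum)
  \<comment> \<open>Sums of lower parts lie below level \<open>t + s\<close>, sums of upper parts
    above it, so their volumes add up inside \<open>msum X Y\<close>.\<close>
  have dj: "msum X1 Y1 \<inter> msum X2 Y2 = {}"
  proof -
    have "z \<bullet> i < t + s" if "z \<in> msum X1 Y1" for z
      using that by (auto simp: msum_def X1_def Y1_def inner_add_left)
    moreover have "z \<bullet> i > t + s" if "z \<in> msum X2 Y2" for z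
      using that by (auto simp: msum_def X2_def Y2_def inner_add_left)
    ultimately show ?thesis by fastforce
  qed
  have fin: "emeasure lborel (msum X1 Y1) \<noteq> \<infinity>" "emeasure lborel (msum X2 Y2) \<noteq> \<infinity>"
    using emeasure_bounded_finite[of "msum X1 Y1"] emeasure_bounded_finite[of "msum X2 Y2"] bounded_subset[OF bd] sub
    by auto
  have "measure lborel (msum X1 Y1) + measure lborel (msum X2 Y2) = measure lborel (msum X1 Y1 \<union> msum X2 Y2)"
    using o dj fin by (intro measure_Union[symmetric]) auto
  also have "\<dots> \<le> measure lborel (msum X Y)"
    using o sub bd by (intro measure_mono_fmeasurable fmeasurableI emeasure_bounded_finite) auto
  finally show ?thesis using 1 2 by (simp add: X_def[symmetric] Y_def[symmetric] algebra_simps)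
qed

text \<open>Induction on the total number of boxes. Two single boxes are the base case; otherwise
  the family with two members is cut, and commutativity of the sum lets it be either one.\<close>

lemma brunn_minkowski_box_families:
  fixes D E :: "'a::euclidean_space set set"
  assumes "box_family D" "box_family E"
  shows "2 ^ DIM('a) * sqrt (measure lborel (\<Union>D) * measure lborel (\<Union>E)) \<le> measure lborel (msum (\<Union>D) (\<Union>E))"
  using assms
proof (induction "card D + card E" arbitrary: D E rule: less_induct)
  case less
  consider "D = {}" | "E = {}" | K L where "D = {K}" "E = {L}" 
    | K L where "K \<in> D" "L \<in> D" "K \<noteq> L" | K L where "K \<in> E" "L \<in> E" "K \<noteq> L"
    by blast
  then show ?case
  proof cases
    case 3
    then obtain a b c d where "K = box a b" "box a b \<noteq> {}" "L = box c d" "box c d \<noteq> {}"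
      using less.prems unfolding box_family_def by (metis singletonI)
    then show ?thesis using brunn_minkowski_boxes[of a b c d] 3 by simp
  next
    case 4
    show ?thesis
      by (rule brunn_minkowski_step[OF less.prems(1) 4 less.prems(2)]) (rule less.hyps, auto)
  next
    case 5
    have "2 ^ DIM('a) * sqrt (measure lborel (\<Union>E) * measure lborel (\<Union>D)) \<le> measure lborel (msum (\<Union>E) (\<Union>D))"
    proof (rule brunn_minkowski_step[OF less.prems(2) 5 less.prems(1)])
      fix D' E' :: "'a set set"
      assume "box_family D'" "box_family E'" "card D' < card E" "card E' \<le> card D"
      then show "2 ^ DIM('a) * sqrt (measure lborel (\<Union>D') * measure lborel (\<Union>E')) \<le> measure lborel (msum (\<Union>D') (\<Union>E'))"
        by (intro less.hyps) auto
    qed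
    then show ?thesis by (simp add: msum_commute mult.commute)
  qed auto
qed

text \<open>An open set is exhausted by finite unions of closed boxes. Such a union has a division
  into boxes with disjoint interiors, and passing to these interiors loses only negligible
  frontiers.\<close>

lemma open_inner_box_family:
  fixes S :: "'a::euclidean_space set"
  assumes S: "open S" "bounded S" and e: "e < measure lborel S"
  obtains D where "box_family D" "\<Union>D \<subseteq> S" "e < measure lborel (\<Union>D)"
proof -
  obtain C where C: "countable C" "C \<subseteq> Pow S" "\<And>X. X \<in> C \<Longrightarrow> \<exists>a b. X = cbox a b" "\<Union>C = S"
    using open_countable_Union_open_cbox[OF S(1)] by metis
  show ?thesis
  proof (cases "C = {}")
    case True
    then show ?thesis using that[of "{}"] e C by (auto simp: box_family_def disjoint_def)
  next
    case False
    define F where "F n = (\<Union>k<n. from_nat_into C k)" for n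
    have inC: "from_nat_into C k \<in> C" for k using False by (rule from_nat_into)
    have Fcl: "closed (F n)" for n
      unfolding F_def using C(3)[OF inC] by (intro closed_UN) (auto, metis closed_cbox)
    have US: "(\<Union>n. F n) = S"
    proof -
      have "(\<Union>n. F n) = \<Union>(range (from_nat_into C))" by (auto simp: F_def)
      then show ?thesis using C(4) range_from_nat_into[OF False C(1)] by simp
    qed
    have Smb: "S \<in> fmeasurable lborel"
      using S by (intro fmeasurableI emeasure_bounded_finite) auto
    have "(\<lambda>n. measure lborel (F n)) \<longlonglongrightarrow> measure lborel (\<Union>n. F n)"
    proof (rule Lim_measure_incseq)
      show "range F \<subseteq> sets lborel" using Fcl by auto
      show "incseq F" unfolding incseq_def F_def by (intro allI impI UN_mono) auto
      show "emeasure lborel (\<Union>n. F n) \<noteq> \<infinity>" using US emeasure_bounded_finite[OF S(2)] by auto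
    qed
    then have "\<forall>\<^sub>F n in sequentially. e < measure lborel (F n)"
      using e unfolding US by (auto intro: order_tendstoD)
    then obtain n where n: "e < measure lborel (F n)" by (auto simp: eventually_sequentially)
    obtain p where "p division_of \<Union>(from_nat_into C ` {..<n})"
    proof (rule elementary_unions_intervals)
      show "finite (from_nat_into C ` {..<n})" by simp
    qed (use C(3)[OF inC] in auto)
    then have p: "p division_of F n" by (simp add: F_def)
    define D where "D = interior ` p - {{}}"
    have D: "box_family D"
      unfolding box_family_def
    proof (intro conjI ballI)
      show "finite D" using p by (auto simp: D_def)
      show "disjoint D" using division_ofD(5)[OF p] by (auto simp: D_def disjoint_def)
      fix K assume "K \<in> D"
      then obtain L where "L \<in> p" "K = interior L" "K \<noteq> {}" by (auto simp: D_def)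
      then show "K \<noteq> {}" "\<exists>a b. K = box a b" using division_ofD(4)[OF p, of L] by (auto, metis interior_cbox)
    qed
    have DF: "\<Union>D \<subseteq> F n" using division_ofD(2)[OF p] interior_subset by (fastforce simp: D_def)
    have "measure lborel (F n) = measure lborel (\<Union>D)"
    proof -
      have "AE x in lborel. x \<notin> (\<Union>K\<in>p. frontier K)"
      proof -
        have "negligible (\<Union>K\<in>p. frontier K)"
        proof (intro negligible_Union)
          show "finite (frontier ` p)" using p by auto
          fix t assume "t \<in> frontier ` p"
          then obtain L where "L \<in> p" "t = frontier L" by blast
          moreover then have "convex L" using division_ofD(4)[OF p] by (metis convex_box(1))
          ultimately show "negligible t" by (simp add: negligible_convex_frontier)
        qed
        then have "(\<Union>K\<in>p. frontier K) \<in> null_sets lebesgue"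
          unfolding negligible_iff_null_sets .
        from AE_not_in[OF this] show ?thesis unfolding AE_completion_iff .
      qed
      then have "AE x in lborel. x \<in> F n \<longleftrightarrow> x \<in> \<Union>D"
      proof (rule eventually_mono)
        fix x assume x: "x \<notin> (\<Union>K\<in>p. frontier K)"
        have "x \<in> \<Union>D" if "x \<in> F n"
        proof -
          have "x \<in> \<Union>p" unfolding division_ofD(6)[OF p] by (rule that)
          then obtain K where K: "K \<in> p" "x \<in> K" by (rule UnionE)
          then have "closed K" using division_ofD(4)[OF p] by (metis closed_cbox)
          moreover have "x \<notin> frontier K" using x K by blast
          ultimately have "x \<in> interior K" using K(2) by (simp add: frontier_def)
          then show ?thesis using K unfolding D_def by blast
        qed
        then show "x \<in> F n \<longleftrightarrow> x \<in> \<Union>D" using DF by blast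
      qed
      then show ?thesis
        using Fcl[of n] box_family_Union[OF D] by (intro measure_eq_AE) auto
    qed
    moreover have "F n \<subseteq> S" using US by auto
    ultimately show ?thesis using that[OF D] DF n by auto
  qed
qed

text \<open>Inner approximation by box families up to a factor \<open>z < 1\<close>; the factor
  comes out of the square root unchanged and is removed at the end.\<close>

lemma brunn_minkowski_open:
  fixes X Y :: "'a::euclidean_space set"
  assumes X: "open X" "bounded X" and Y: "open Y" "bounded Y"
  shows "2 ^ DIM('a) * sqrt (measure lborel X * measure lborel Y) \<le> measure lborel (msum X Y)"
proof (rule field_le_mult_one_interval)
  fix z :: real assume z: "0 < z" "z < 1"
  have "bounded (msum X Y)" using X Y by (auto intro: bounded_msum)
  show "z * (2 ^ DIM('a) * sqrt (measure lborel X * measure lborel Y)) \<le> measure lborel (msum X Y)"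
  proof (cases "measure lborel X = 0 \<or> measure lborel Y = 0")
    case True
    then show ?thesis by auto
  next
    case False
    then have pos: "0 < measure lborel X" "0 < measure lborel Y" by (auto simp: zero_less_measure_iff)
    obtain D where D: "box_family D" "\<Union>D \<subseteq> X" "z * measure lborel X < measure lborel (\<Union>D)"
      using open_inner_box_family[OF X, of "z * measure lborel X"] z pos by auto
    obtain E where E: "box_family E" "\<Union>E \<subseteq> Y" "z * measure lborel Y < measure lborel (\<Union>E)"
      using open_inner_box_family[OF Y, of "z * measure lborel Y"] z pos by auto
    have "z * sqrt (measure lborel X * measure lborel Y) = sqrt ((z * measure lborel X) * (z * measure lborel Y))"
      using z by (simp add: real_sqrt_mult mult_ac)
    also have "\<dots> \<le> sqrt (measure lborel (\<Union>D) * measure lborel (\<Union>E))"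
      using D E z by (intro real_sqrt_le_mono mult_mono) auto
    finally have "z * (2 ^ DIM('a) * sqrt (measure lborel X * measure lborel Y))
       \<le> 2 ^ DIM('a) * sqrt (measure lborel (\<Union>D) * measure lborel (\<Union>E))" by simp
    also have "\<dots> \<le> measure lborel (msum (\<Union>D) (\<Union>E))"
      by (rule brunn_minkowski_box_families[OF D(1) E(1)])
    also have "\<dots> \<le> measure lborel (msum X Y)"
      using \<open>bounded (msum X Y)\<close> X D E box_family_Union[OF D(1)]
      by (intro measure_mono_fmeasurable fmeasurableI emeasure_bounded_finite msum_mono) (auto intro!: borel_open open_msum)
    finally show ?thesis .
  qed
qed

lemma measure_interior_convex:
  fixes S :: "'a::euclidean_space set"
  assumes "convex S" "compact S"
  shows "measure lborel (interior S) = measure lborel S"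
proof -
  have "AE x in lebesgue. x \<notin> frontier S"
    using negligible_convex_frontier[OF assms(1)] unfolding negligible_iff_null_sets by (rule AE_not_in)
  then have "AE x in lborel. x \<notin> frontier S" by (simp add: AE_completion_iff)
  then have "AE x in lborel. x \<in> interior S \<longleftrightarrow> x \<in> S"
    using interior_subset[of S] assms(2) by (auto elim!: eventually_mono simp: frontier_def compact_imp_closed)
  then show ?thesis using assms by (intro measure_eq_AE) (auto simp: compact_imp_closed)
qed

text \<open>The sum of the interiors lies in the doubled set \<open>Z\<close>, and doubling
  multiplies the volume by \<open>2 ^ DIM('a)\<close>, which cancels. Passing to interiors costs no
  volume for convex bodies.\<close>

lemma brunn_minkowski_midpoint:
  fixes X Y Z :: "'a::euclidean_space set"
  assumes X: "convex X" "compact X" and Y: "convex Y" "compact Y" and Z: "compact Z"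
    and mid: "\<And>x y. x \<in> X \<Longrightarrow> y \<in> Y \<Longrightarrow> (1/2) *\<^sub>R (x + y) \<in> Z"
  shows "sqrt (measure lborel X * measure lborel Y) \<le> measure lborel Z"
proof -
  let ?M = "msum (interior X) (interior Y)"
  have bd: "bounded (interior X)" "bounded (interior Y)"
    using X Y interior_subset by (blast intro: bounded_subset compact_imp_bounded)+
  have M: "open ?M" "bounded ?M" using bd by (auto intro: open_msum bounded_msum)
  have "2 ^ DIM('a) * sqrt (measure lborel X * measure lborel Y) \<le> measure lborel ?M"
    using brunn_minkowski_open[of "interior X" "interior Y"] bd
    by (simp add: measure_interior_convex X Y)
  also have "measure lborel ?M = measure lebesgue ?M" using M by (simp add: measure_completion)
  also have "\<dots> \<le> measure lebesgue ((*\<^sub>R) 2 ` Z)"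
  proof (rule measure_mono_fmeasurable)
    show "?M \<subseteq> (*\<^sub>R) 2 ` Z"
    proof
      fix z assume "z \<in> ?M"
      then obtain x y where "x \<in> X" "y \<in> Y" "z = x + y" using interior_subset by (fastforce simp: msum_def)
      then show "z \<in> (*\<^sub>R) 2 ` Z" using mid[of x y] by (intro image_eqI[of _ _ "(1/2) *\<^sub>R (x + y)"]) auto
    qed
    show "?M \<in> sets lebesgue" using M by auto
    show "(*\<^sub>R) 2 ` Z \<in> lmeasurable" using Z by (intro lmeasurable_compact compact_scaling)
  qed
  also have "\<dots> = 2 ^ DIM('a) * measure lebesgue Z"
    using emeasure_lebesgue_affine[of 2 0 Z] by (simp add: measure_def enn2real_mult)
  also have "measure lebesgue Z = measure lborel Z" using Z by (simp add: measure_completion compact_imp_closed)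
  finally show ?thesis by simp
qed

section \<open>Facet areas and first variation of volume\<close>

lemma measure_mono_bounded:
  fixes A B :: "'a::euclidean_space set"
  assumes "A \<subseteq> B" "A \<in> sets borel" "B \<in> sets borel" "bounded B"
  shows "measure lborel A \<le> measure lborel B"
  using assms by (intro measure_mono_fmeasurable fmeasurableI emeasure_bounded_finite) auto

lemma emeasure_bounded_eq:
  fixes A :: "'a::euclidean_space set"
  assumes "bounded A"
  shows "emeasure lborel A = ennreal (measure lborel A)"
  using emeasure_bounded_finite[OF assms] by (intro emeasure_eq_ennreal_measure) auto

text \<open>The support function.\<close>

definition supp :: "'a::euclidean_space set \<Rightarrow> 'a \<Rightarrow> real" where
  "supp P u = (SUP x\<in>P. x \<bullet> u)"

text \<open>For a unit vector \<open>u\<close> and a polytope \<open>P\<close> this is the area, in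
  one dimension less, of the face in direction \<open>u\<close>. It vanishes when that face is not a
  facet, so sums over too many directions do no harm.\<close>

definition face_area :: "'a::euclidean_space set \<Rightarrow> 'a \<Rightarrow> real" where
  "face_area P u = measure lborel (prism u (supp P u) P)"

lemma supp_attained:
  assumes "compact P" "P \<noteq> {}"
  obtains x where "x \<in> P" "x \<bullet> u = supp P u"
proof -
  have "continuous_on P (\<lambda>x. x \<bullet> u)" by (intro continuous_intros)
  from continuous_attains_sup[OF assms this] obtain x where x: "x \<in> P" "\<forall>y\<in>P. y \<bullet> u \<le> x \<bullet> u" by blast
  then have "supp P u = x \<bullet> u" unfolding supp_def by (intro cSup_eq_maximum) auto
  then show ?thesis using that x by auto
qed

lemma supp_upper:
  assumes "compact P" "x \<in> P"
  shows "x \<bullet> u \<le> supp P u"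
proof -
  have "compact ((\<lambda>x. x \<bullet> u) ` P)" by (intro compact_continuous_image continuous_intros assms)
  then show ?thesis unfolding supp_def
    using assms(2) by (intro cSUP_upper bounded_imp_bdd_above compact_imp_bounded)
qed

lemma supp_least:
  assumes "compact P" "P \<noteq> {}" "\<And>x. x \<in> P \<Longrightarrow> x \<bullet> u \<le> b"
  shows "supp P u \<le> b"
  using supp_attained[OF assms(1,2), of u] assms(3) by metis

lemma supp_lower:
  assumes "compact P" "x \<in> P"
  shows "- supp P (- u) \<le> x \<bullet> u"
  using supp_upper[OF assms, of "- u"] by simp

lemma supp_interior:
  assumes "compact P" "p \<in> interior P" "u \<noteq> 0"
  shows "p \<bullet> u < supp P u"
proof -
  obtain e where e: "e > 0" "cball p e \<subseteq> P" using assms(2) by (auto simp: mem_interior_cball)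
  have "p + (e / norm u) *\<^sub>R u \<in> P" using e assms(3) by (intro subsetD[OF e(2)]) (simp add: dist_norm)
  from supp_upper[OF assms(1) this, of u] show ?thesis
    using e assms(3) by (simp add: inner_add_left) (smt (verit) inner_gt_zero_iff zero_less_divide_iff zero_less_mult_iff zero_less_norm_iff)
qed

text \<open>Each defining half-space may be replaced by the supporting one with the same normal.
  Negatives are adjoined so that opposite directions can be exchanged in sums over \<open>U\<close>;
  the inequalities added are valid on \<open>P\<close>, if possibly redundant.\<close>

lemma polytope_unit_normals:
  fixes P :: "'a::euclidean_space set"
  assumes "polytope P" "P \<noteq> {}"
  obtains U where "finite U" "\<And>w. w \<in> U \<Longrightarrow> norm w = 1" "\<And>w. w \<in> U \<Longrightarrow> - w \<in> U"
    "P = {x. \<forall>w\<in>U. x \<bullet> w \<le> supp P w}"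
proof -
  have cP: "compact P" using assms(1) by (rule polytope_imp_compact)
  obtain F where F: "finite F" "P = \<Inter>F" "\<And>h. h \<in> F \<Longrightarrow> \<exists>a b. a \<noteq> 0 \<and> h = {x. a \<bullet> x \<le> b}"
    using polytope_imp_polyhedron[OF assms(1)] unfolding polyhedron_def by metis
  obtain a b where ab: "\<And>h. h \<in> F \<Longrightarrow> a h \<noteq> 0 \<and> h = {x. a h \<bullet> x \<le> b h}"
    using F(3) by metis
  define V where "V = (\<lambda>h. (1 / norm (a h)) *\<^sub>R a h) ` F"
  define U where "U = V \<union> uminus ` V"
  show ?thesis
  proof (rule that)
    show "finite U" using F(1) by (simp add: U_def V_def)
    show "norm w = 1" if "w \<in> U" for w using that ab by (auto simp: U_def V_def)
    show "- w \<in> U" if "w \<in> U" for w using that by (auto simp: U_def)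
    show "P = {x. \<forall>w\<in>U. x \<bullet> w \<le> supp P w}"
    proof (intro equalityI subsetI)
      fix x assume "x \<in> P"
      then show "x \<in> {x. \<forall>w\<in>U. x \<bullet> w \<le> supp P w}" using supp_upper[OF cP] by auto
    next
      fix x assume x: "x \<in> {x. \<forall>w\<in>U. x \<bullet> w \<le> supp P w}"
      have "x \<in> h" if h: "h \<in> F" for h
      proof -
        let ?w = "(1 / norm (a h)) *\<^sub>R a h"
        have "supp P ?w \<le> b h / norm (a h)"
        proof (rule supp_least[OF cP assms(2)])
          fix y assume "y \<in> P"
          then have "a h \<bullet> y \<le> b h" using F(2) ab[OF h] h by auto
          then show "y \<bullet> ?w \<le> b h / norm (a h)" by (simp add: inner_commute divide_right_mono)
        qed
        moreover have "x \<bullet> ?w \<le> supp P ?w" using x h unfolding U_def V_def by blast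
        ultimately have "a h \<bullet> x / norm (a h) \<le> b h / norm (a h)" by (simp add: inner_commute)
        then have "a h \<bullet> x \<le> b h" using ab[OF h] by (simp add: divide_le_cancel)
        then show "x \<in> h" using ab[OF h] by auto
      qed
      then show "x \<in> P" using F(2) by auto
    qed
  qed
qed

text \<open>Perturbs the bounds of the inequalities in direction \<open>w\<close> by
  \<open>c w\<close>. These bounds need not be the support numbers of the result, since an
  inequality may become redundant.\<close>

definition enlarge :: "'a::euclidean_space set \<Rightarrow> 'a set \<Rightarrow> ('a \<Rightarrow> real) \<Rightarrow> 'a set" where
  "enlarge U P c = {x. \<forall>w\<in>U. x \<bullet> w \<le> supp P w + c w}"

lemma closed_enlarge: "closed (enlarge U P c)"
proof -
  have "enlarge U P c = (\<Inter>w\<in>U. {x. x \<bullet> w \<le> supp P w + c w})" by (auto simp: enlarge_def)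
  also have "closed \<dots>" by (intro closed_INT ballI closed_Collect_le continuous_intros)
  finally show ?thesis .
qed

text \<open>The interior point \<open>p\<close> acts as an origin: all distances
  \<open>supp P w - p \<bullet> w\<close> to the supporting hyperplanes are positive.\<close>

locale polytope_body =
  fixes U P :: "'a::euclidean_space set" and p :: 'a
  assumes fin: "finite U" and unit: "\<And>w. w \<in> U \<Longrightarrow> norm w = 1" and cP: "compact P"
    and P_eq: "P = {x. \<forall>w\<in>U. x \<bullet> w \<le> supp P w}" and p: "p \<in> interior P"
begin

lemma p_P: "p \<in> P"
  using p interior_subset by blast

lemma P_borel: "P \<in> sets borel"
  using cP by (intro borel_closed compact_imp_closed)

lemma P_ne: "P \<noteq> {}"
  using p_P by auto

lemma p_less: "w \<in> U \<Longrightarrow> p \<bullet> w < supp P w"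
  using supp_interior[OF cP p, of w] unit[of w] by (metis norm_zero zero_neq_one)

lemma dilate_eq:
  assumes "l \<ge> 0"
  shows "(\<lambda>x. (1 + l) *\<^sub>R x + - (l *\<^sub>R p)) ` P = enlarge U P (\<lambda>w. l * (supp P w - p \<bullet> w))"
proof (intro equalityI subsetI)
  fix y assume "y \<in> (\<lambda>x. (1 + l) *\<^sub>R x + - (l *\<^sub>R p)) ` P"
  then obtain x where x: "x \<in> P" "y = (1 + l) *\<^sub>R x + - (l *\<^sub>R p)" by auto
  have "(1 + l) * (x \<bullet> w) \<le> (1 + l) * supp P w" for w
    using supp_upper[OF cP x(1)] assms by (intro mult_left_mono) auto
  then show "y \<in> enlarge U P (\<lambda>w. l * (supp P w - p \<bullet> w))"
    by (simp add: enlarge_def x(2) inner_diff_left inner_add_left algebra_simps)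
next
  fix y assume y: "y \<in> enlarge U P (\<lambda>w. l * (supp P w - p \<bullet> w))"
  define x where "x = (1 / (1 + l)) *\<^sub>R (y + l *\<^sub>R p)"
  have "x \<bullet> w \<le> supp P w" if "w \<in> U" for w
  proof -
    have "y \<bullet> w + l * (p \<bullet> w) \<le> (1 + l) * supp P w"
      using y that by (auto simp: enlarge_def algebra_simps)
    then have "(y \<bullet> w + l * (p \<bullet> w)) / (1 + l) \<le> supp P w"
      using assms by (simp add: pos_divide_le_eq mult.commute)
    then show ?thesis by (simp add: x_def inner_add_left add_divide_distrib)
  qed
  then have "x \<in> P" using P_eq by auto
  moreover have "y = (1 + l) *\<^sub>R x + - (l *\<^sub>R p)" using assms by (simp add: x_def)
  ultimately show "y \<in> (\<lambda>x. (1 + l) *\<^sub>R x + - (l *\<^sub>R p)) ` P" by blast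
qed

text \<open>A homothety with centre \<open>p\<close> moves every supporting hyperplane outwards by a
  multiple of its positive distance from \<open>p\<close>, so a large enough dilate of
  \<open>P\<close> contains the enlarged set.\<close>

lemma bounded_enlarge: "bounded (enlarge U P c)"
proof -
  define M where "M = (\<Sum>w\<in>U. \<bar>c w\<bar> / (supp P w - p \<bullet> w))"
  have M0: "M \<ge> 0" unfolding M_def using p_less by (intro sum_nonneg divide_nonneg_nonneg) (auto simp: less_imp_le)
  have "c w \<le> M * (supp P w - p \<bullet> w)" if w: "w \<in> U" for w
  proof -
    have "\<bar>c w\<bar> / (supp P w - p \<bullet> w) \<le> M"
      unfolding M_def using p_less by (intro member_le_sum w fin divide_nonneg_nonneg) (auto simp: less_imp_le)
    then show ?thesis using p_less[OF w] by (simp add: pos_divide_le_eq)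
  qed
  then have "enlarge U P c \<subseteq> enlarge U P (\<lambda>w. M * (supp P w - p \<bullet> w))"
    unfolding enlarge_def by fastforce
  also have "\<dots> = (\<lambda>x. (1 + M) *\<^sub>R x + - (M *\<^sub>R p)) ` P" using dilate_eq[OF M0] ..
  also have "bounded \<dots>"
    by (intro compact_imp_bounded compact_continuous_image continuous_intros cP)
  finally (bounded_subset[rotated]) show ?thesis .
qed

text \<open>Outer and inner approximations of the prism over the face in direction \<open>w\<close>:
  the inequalities are relaxed by \<open>d\<close> here, those other than \<open>w\<close> are
  tightened by \<open>d\<close> in \<open>inner_prism\<close>. They bound all slices of a thin layer
  outside the face.\<close>

definition outer_prism :: "'a \<Rightarrow> real \<Rightarrow> 'a set" where
  "outer_prism w d = prism w (supp P w) (enlarge U P (\<lambda>_. d))"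

definition inner_prism :: "'a \<Rightarrow> real \<Rightarrow> 'a set" where
  "inner_prism w d = prism w (supp P w) {x \<in> P. \<forall>w'\<in>U - {w}. x \<bullet> w' \<le> supp P w' - d}"

lemma inner_borel: "{x \<in> P. \<forall>w'\<in>U - {w}. x \<bullet> w' \<le> supp P w' - d} \<in> sets borel"
proof -
  have "{x \<in> P. \<forall>w'\<in>U - {w}. x \<bullet> w' \<le> supp P w' - d} = P \<inter> (\<Inter>w'\<in>U - {w}. {x. x \<bullet> w' \<le> supp P w' - d})" by auto
  also have "closed \<dots>"
    using cP by (intro closed_Int closed_INT ballI closed_Collect_le continuous_intros compact_imp_closed)
  finally show ?thesis by (rule borel_closed)
qed

text \<open>The outer prisms decrease to the prism over the face itself, so continuity of measure
  from above applies.\<close>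

lemma outer_prism_limit:
  assumes w: "w \<in> U" and e: "e > 0"
  obtains d where "d > 0" "\<And>t. 0 < t \<Longrightarrow> t \<le> d \<Longrightarrow> measure lborel (outer_prism w t) \<le> face_area P w + e"
proof -
  let ?Z = "\<lambda>n. outer_prism w (inverse (real (Suc n)))"
  have bd: "bounded (outer_prism w d)" for d
    unfolding outer_prism_def by (intro bounded_prism bounded_enlarge unit w)
  have bo: "outer_prism w d \<in> sets borel" for d
    unfolding outer_prism_def by (intro prism_borel borel_closed closed_enlarge)
  have mono: "outer_prism w s \<subseteq> outer_prism w t" if "s \<le> t" for s t
    unfolding outer_prism_def prism_def enlarge_def using that by fastforce
  have "(\<Inter>n. ?Z n) = prism w (supp P w) P"
  proof (intro equalityI subsetI)
    fix x assume x: "x \<in> (\<Inter>n. ?Z n)"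
    have "level_proj w (supp P w) x \<bullet> w' \<le> supp P w'" if "w' \<in> U" for w'
    proof (rule LIMSEQ_le_const)
      show "(\<lambda>n. supp P w' + inverse (real (Suc n))) \<longlonglongrightarrow> supp P w'"
        using tendsto_add[OF tendsto_const LIMSEQ_inverse_real_of_nat, of "supp P w'"] by simp
      show "\<exists>N. \<forall>n\<ge>N. level_proj w (supp P w) x \<bullet> w' \<le> supp P w' + inverse (real (Suc n))"
        using x that by (auto simp: outer_prism_def prism_def enlarge_def)
    qed
    then have "level_proj w (supp P w) x \<in> P" using P_eq by blast
    then show "x \<in> prism w (supp P w) P" using x by (auto simp: outer_prism_def prism_def)
  next
    fix x assume "x \<in> prism w (supp P w) P"
    then show "x \<in> (\<Inter>n. ?Z n)"
      using supp_upper[OF cP] by (auto simp: outer_prism_def prism_def enlarge_def intro: add_increasing2)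
  qed
  moreover have "(\<lambda>n. measure lborel (?Z n)) \<longlonglongrightarrow> measure lborel (\<Inter>n. ?Z n)"
  proof (rule Lim_measure_decseq)
    show "range ?Z \<subseteq> sets lborel" using bo by auto
    show "decseq ?Z" unfolding decseq_def by (intro allI impI mono le_imp_inverse_le) auto
    show "emeasure lborel (?Z i) \<noteq> \<infinity>" for i using emeasure_bounded_finite[OF bd] by (simp add: less_top)
  qed
  ultimately have "\<forall>\<^sub>F n in sequentially. measure lborel (?Z n) < face_area P w + e"
    using e by (intro order_tendstoD(2)) (auto simp: face_area_def)
  then obtain n where n: "measure lborel (?Z n) < face_area P w + e" by (auto simp: eventually_sequentially)
  show ?thesis
  proof (rule that)
    fix t assume t: "0 < t" "t \<le> inverse (real (Suc n))"
    have "measure lborel (outer_prism w t) \<le> measure lborel (?Z n)"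
      by (intro measure_mono_bounded mono t bo bd)
    then show "measure lborel (outer_prism w t) \<le> face_area P w + e" using n by linarith
  qed simp
qed

text \<open>The inner prisms increase to the prism over the face without the points where another
  inequality is tight, and these points are null.\<close>

lemma inner_prism_limit:
  assumes w: "w \<in> U" and e: "e > 0"
  obtains d where "d > 0" "\<And>t. 0 < t \<Longrightarrow> t \<le> d \<Longrightarrow> face_area P w - e \<le> measure lborel (inner_prism w t)"
proof -
  let ?Y = "\<lambda>n. inner_prism w (inverse (real (Suc n)))"
  let ?h = "supp P w"
  have bd: "bounded (inner_prism w d)" for d
    unfolding inner_prism_def by (intro bounded_prism bounded_subset[OF compact_imp_bounded[OF cP]] unit w) auto
  have bo: "inner_prism w d \<in> sets borel" for d
    unfolding inner_prism_def by (intro prism_borel inner_borel)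
  have mono: "inner_prism w s \<subseteq> inner_prism w t" if "t \<le> s" for s t
  proof
    fix x assume x: "x \<in> inner_prism w s"
    have "level_proj w (supp P w) x \<bullet> w' \<le> supp P w' - t" if "w' \<in> U - {w}" for w'
    proof -
      have "level_proj w (supp P w) x \<bullet> w' \<le> supp P w' - s"
        using x that by (auto simp: inner_prism_def prism_def)
      then show ?thesis using \<open>t \<le> s\<close> by linarith
    qed
    then show "x \<in> inner_prism w t" using x by (auto simp: inner_prism_def prism_def)
  qed
  have Yu: "(\<Union>n. ?Y n) = prism w ?h {x \<in> P. \<forall>w'\<in>U - {w}. x \<bullet> w' < supp P w'}"
  proof (intro equalityI subsetI)
    fix x assume "x \<in> (\<Union>n. ?Y n)"
    then obtain n where "x \<in> ?Y n" by auto
    then have x: "x \<in> slab w" "level_proj w ?h x \<in> P"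
      "\<And>w'. w' \<in> U - {w} \<Longrightarrow> level_proj w ?h x \<bullet> w' \<le> supp P w' - inverse (real (Suc n))"
      by (auto simp: inner_prism_def prism_def)
    moreover have "inverse (real (Suc n)) > 0" by simp
    ultimately have "level_proj w ?h x \<bullet> w' < supp P w'" if "w' \<in> U - {w}" for w'
      using that by (smt (verit))
    then show "x \<in> prism w ?h {x \<in> P. \<forall>w'\<in>U - {w}. x \<bullet> w' < supp P w'}" using x by (auto simp: prism_def)
  next
    fix x assume x: "x \<in> prism w ?h {x \<in> P. \<forall>w'\<in>U - {w}. x \<bullet> w' < supp P w'}"
    have "\<forall>\<^sub>F n in sequentially. \<forall>w'\<in>U - {w}. inverse (real (Suc n)) < supp P w' - level_proj w ?h x \<bullet> w'"
      using x fin LIMSEQ_inverse_real_of_nat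
      by (intro eventually_ball_finite ballI order_tendstoD(2)) (auto simp: prism_def)
    then obtain n where "\<forall>w'\<in>U - {w}. inverse (real (Suc n)) < supp P w' - level_proj w ?h x \<bullet> w'"
      by (auto simp: eventually_sequentially)
    then have "x \<in> ?Y n" using x by (force simp: inner_prism_def prism_def)
    then show "x \<in> (\<Union>n. ?Y n)" by blast
  qed
  \<comment> \<open>The points in question form a hyperplane whose normal is the part of
    \<open>w'\<close> orthogonal to \<open>w\<close>. This part vanishes only for
    \<open>w' = - w\<close>, and then the interior point \<open>p\<close> separates the two parallel
    supporting hyperplanes.\<close>
  have null: "AE x in lborel. level_proj w ?h x \<bullet> w' \<noteq> supp P w'" if w': "w' \<in> U - {w}" for w'
  proof (cases "w' = (w \<bullet> w') *\<^sub>R w")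
    case True
    then have "\<bar>w \<bullet> w'\<bar> = 1" using unit[OF w] unit[of w'] w' by (metis DiffD1 mult.right_neutral norm_scaleR)
    then have "w' = - w" using True w' by (auto simp: abs_if split: if_splits)
    then have l: "level_proj w ?h x \<bullet> w' = - ?h" for x
      using level_proj_inner[OF unit[OF w]] by simp
    have "p \<bullet> w < ?h" "p \<bullet> w' < supp P w'" using p_less w w' by auto
    then have "- ?h < supp P w'" using \<open>w' = - w\<close> by simp
    then show ?thesis unfolding l by simp
  next
    case False
    let ?v = "w' - (w \<bullet> w') *\<^sub>R w"
    have "?v \<noteq> 0" using False by simp
    have "AE x in lborel. x \<notin> {x. x \<bullet> ?v = supp P w' - ?h * (w \<bullet> w')}"
      by (rule AE_not_in[OF lborel_hyperplane_null[OF \<open>?v \<noteq> 0\<close>]])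
    then show ?thesis
      by (rule eventually_mono) (auto simp: level_proj_def inner_add_left inner_diff_right algebra_simps)
  qed
  have "AE x in lborel. \<forall>w'\<in>U - {w}. level_proj w ?h x \<bullet> w' \<noteq> supp P w'"
    using null fin by (intro AE_finite_allI) auto
  then have "AE x in lborel. x \<in> (\<Union>n. ?Y n) \<longleftrightarrow> x \<in> prism w ?h P"
  proof (rule eventually_mono)
    fix x assume x: "\<forall>w'\<in>U - {w}. level_proj w ?h x \<bullet> w' \<noteq> supp P w'"
    have "level_proj w ?h x \<bullet> w' < supp P w'" if "w' \<in> U - {w}" "x \<in> prism w ?h P" for w'
    proof -
      have "level_proj w ?h x \<bullet> w' \<le> supp P w'"
        using that(2) by (intro supp_upper[OF cP]) (simp add: prism_def)
      moreover have "level_proj w ?h x \<bullet> w' \<noteq> supp P w'" using x that(1) by blast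
      ultimately show ?thesis by simp
    qed
    then show "x \<in> (\<Union>n. ?Y n) \<longleftrightarrow> x \<in> prism w ?h P" unfolding Yu prism_def by blast
  qed
  then have eq: "measure lborel (\<Union>n. ?Y n) = face_area P w"
    unfolding face_area_def using bo prism_borel[OF P_borel] by (intro measure_eq_AE) auto
  have sub: "(\<Union>n. ?Y n) \<subseteq> prism w ?h P" unfolding Yu prism_def by blast
  have "(\<lambda>n. measure lborel (?Y n)) \<longlonglongrightarrow> measure lborel (\<Union>n. ?Y n)"
  proof (rule Lim_measure_incseq)
    show "range ?Y \<subseteq> sets lborel" using bo by auto
    show "incseq ?Y" unfolding incseq_def by (intro allI impI mono le_imp_inverse_le) auto
    have "bounded (\<Union>n. ?Y n)"
      by (rule bounded_subset[OF _ sub]) (intro bounded_prism unit w compact_imp_bounded cP)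
    then show "emeasure lborel (\<Union>n. ?Y n) \<noteq> \<infinity>" using emeasure_bounded_finite by (simp add: less_top)
  qed
  then have "\<forall>\<^sub>F n in sequentially. face_area P w - e < measure lborel (?Y n)"
    using e unfolding eq by (intro order_tendstoD(1)) auto
  then obtain n where n: "face_area P w - e < measure lborel (?Y n)" by (auto simp: eventually_sequentially)
  show ?thesis
  proof (rule that)
    fix t assume t: "0 < t" "t \<le> inverse (real (Suc n))"
    have "measure lborel (?Y n) \<le> measure lborel (inner_prism w t)"
      by (intro measure_mono_bounded mono t bo bd)
    then show "face_area P w - e \<le> measure lborel (inner_prism w t)" using n by linarith
  qed simp
qed

text \<open>Projecting a slice of the layer back to the face level moves points by at most
  \<open>l * C\<close>, and the other inequalities were relaxed by at most \<open>l * C\<close>;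
  hence the parameter \<open>2 * l * C\<close>.\<close>

lemma layer_upper:
  assumes w: "w \<in> U" and l: "0 \<le> l" and c: "\<And>w. w \<in> U \<Longrightarrow> 0 \<le> c w" "\<And>w. w \<in> U \<Longrightarrow> c w \<le> C"
  shows "measure lborel {x \<in> enlarge U P (\<lambda>w. l * c w). x \<bullet> w \<in> {supp P w <.. supp P w + l * c w}}
    \<le> l * c w * measure lborel (outer_prism w (2 * l * C))"
proof -
  let ?h = "supp P w" and ?E = "enlarge U P (\<lambda>w. l * c w)"
  have E: "?E \<in> sets borel" by (intro borel_closed closed_enlarge)
  have bd: "bounded (outer_prism w d)" for d
    unfolding outer_prism_def by (intro bounded_prism bounded_enlarge unit w)
  have bo: "outer_prism w d \<in> sets borel" for d
    unfolding outer_prism_def by (intro prism_borel borel_closed closed_enlarge)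
  have lc: "0 \<le> l * c w" using l c w by simp
  have sub: "prism w z ?E \<subseteq> outer_prism w (2 * l * C)" if z: "z \<in> {?h <.. ?h + l * c w}" for z
  proof
    fix x assume x: "x \<in> prism w z ?E"
    have "level_proj w ?h x \<bullet> w' \<le> supp P w' + 2 * l * C" if w': "w' \<in> U" for w'
    proof -
      have "level_proj w ?h x = level_proj w z x + (?h - z) *\<^sub>R w"
        using level_proj_diff[of w ?h x z] by (simp add: algebra_simps)
      then have "level_proj w ?h x \<bullet> w' = level_proj w z x \<bullet> w' + (?h - z) * (w \<bullet> w')"
        by (simp add: inner_add_left)
      moreover have "\<bar>(?h - z) * (w \<bullet> w')\<bar> \<le> l * c w * 1"
        unfolding abs_mult using z Cauchy_Schwarz_ineq2[of w w'] unit w w'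
        by (intro mult_mono) auto
      moreover have "level_proj w z x \<bullet> w' \<le> supp P w' + l * c w'"
        using x w' by (auto simp: prism_def enlarge_def)
      moreover have "l * c w \<le> l * C" "l * c w' \<le> l * C" using c w w' l by (auto intro: mult_left_mono)
      ultimately show ?thesis by linarith
    qed
    then show "x \<in> outer_prism w (2 * l * C)" using x by (auto simp: outer_prism_def prism_def enlarge_def)
  qed
  have "emeasure lborel {x \<in> ?E. x \<bullet> w \<in> {?h <.. ?h + l * c w}}
    = (\<integral>\<^sup>+z. emeasure lborel (prism w z ?E) * indicator {?h <.. ?h + l * c w} z \<partial>lborel)"
    by (rule emeasure_slices[OF unit[OF w] E]) simp
  also have "\<dots> \<le> (\<integral>\<^sup>+z. ennreal (measure lborel (outer_prism w (2 * l * C))) * indicator {?h <.. ?h + l * c w} z \<partial>lborel)"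
    using sub bo by (intro nn_integral_mono) (auto simp: emeasure_bounded_eq[OF bd, symmetric] intro!: emeasure_mono split: split_indicator)
  also have "\<dots> = ennreal (l * c w * measure lborel (outer_prism w (2 * l * C)))"
    using lc by (subst nn_integral_cmult) (auto simp: ennreal_mult'[symmetric] mult.commute)
  finally have "enn2real (emeasure lborel {x \<in> ?E. x \<bullet> w \<in> {?h <.. ?h + l * c w}}) \<le> l * c w * measure lborel (outer_prism w (2 * l * C))"
    using lc by (intro enn2real_leI) auto
  then show ?thesis unfolding measure_def .
qed

text \<open>Here the other inequalities keep their original bounds, so only the displacement by at
  most \<open>l * C\<close> has to be compensated. Unrelaxed bounds also make the layers of
  different directions disjoint.\<close>

lemma layer_lower:
  assumes w: "w \<in> U" and l: "0 \<le> l" and c: "\<And>w. w \<in> U \<Longrightarrow> 0 \<le> c w" "\<And>w. w \<in> U \<Longrightarrow> c w \<le> C"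
  shows "l * c w * measure lborel (inner_prism w (l * C)) \<le>
    measure lborel {x \<in> {x. \<forall>w'\<in>U - {w}. x \<bullet> w' \<le> supp P w'}. x \<bullet> w \<in> {supp P w <.. supp P w + l * c w}}"
    (is "_ \<le> measure lborel {x \<in> ?E. _}")
proof -
  let ?h = "supp P w"
  have "?E = (\<Inter>w'\<in>U - {w}. {x. x \<bullet> w' \<le> supp P w'})" by auto
  also have "closed \<dots>" by (intro closed_INT ballI closed_Collect_le continuous_intros)
  finally have E: "?E \<in> sets borel" by (rule borel_closed)
  have bd: "bounded (inner_prism w d)" for d
    unfolding inner_prism_def by (intro bounded_prism bounded_subset[OF compact_imp_bounded[OF cP]] unit w) auto
  have bo: "inner_prism w d \<in> sets borel" for d
    unfolding inner_prism_def by (intro prism_borel inner_borel)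
  have lc: "0 \<le> l * c w" using l c w by simp
  have sub: "inner_prism w (l * C) \<subseteq> prism w z ?E" if z: "z \<in> {?h <.. ?h + l * c w}" for z
  proof
    fix x assume x: "x \<in> inner_prism w (l * C)"
    have "level_proj w z x \<bullet> w' \<le> supp P w'" if w': "w' \<in> U - {w}" for w'
    proof -
      have "level_proj w z x = level_proj w ?h x + (z - ?h) *\<^sub>R w"
        using level_proj_diff[of w z x ?h] by (simp add: algebra_simps)
      then have "level_proj w z x \<bullet> w' = level_proj w ?h x \<bullet> w' + (z - ?h) * (w \<bullet> w')"
        by (simp add: inner_add_left)
      moreover have "\<bar>(z - ?h) * (w \<bullet> w')\<bar> \<le> l * c w * 1"
        unfolding abs_mult using z Cauchy_Schwarz_ineq2[of w w'] unit w w'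
        by (intro mult_mono) auto
      moreover have "level_proj w ?h x \<bullet> w' \<le> supp P w' - l * C"
        using x w' by (auto simp: prism_def inner_prism_def)
      moreover have "l * c w \<le> l * C" using c w l by (auto intro: mult_left_mono)
      ultimately show ?thesis by linarith
    qed
    then show "x \<in> prism w z ?E" using x by (auto simp: inner_prism_def prism_def)
  qed
  let ?F = "{x \<in> ?E. x \<bullet> w \<in> {?h <.. ?h + l * c w}}"
  have "ennreal (l * c w * measure lborel (inner_prism w (l * C)))
    = (\<integral>\<^sup>+z. ennreal (measure lborel (inner_prism w (l * C))) * indicator {?h <.. ?h + l * c w} z \<partial>lborel)"
    using lc by (subst nn_integral_cmult) (auto simp: ennreal_mult'[symmetric] mult.commute)
  also have "\<dots> \<le> (\<integral>\<^sup>+z. emeasure lborel (prism w z ?E) * indicator {?h <.. ?h + l * c w} z \<partial>lborel)"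
    using sub by (intro nn_integral_mono) (auto simp: emeasure_bounded_eq[OF bd, symmetric] intro!: emeasure_mono prism_borel E split: split_indicator)
  also have "\<dots> = emeasure lborel ?F"
    by (rule emeasure_slices[OF unit[OF w] E, symmetric]) simp
  also have "\<dots> = ennreal (measure lborel ?F)"
  proof (rule emeasure_bounded_eq)
    have "?F \<subseteq> enlarge U P (\<lambda>w. l * c w)"
    proof
      fix x assume x: "x \<in> ?F"
      have "x \<bullet> w' \<le> supp P w' + l * c w'" if "w' \<in> U" for w'
        using x that l c(1)[OF that] by (cases "w' = w") (auto intro: add_increasing2)
      then show "x \<in> enlarge U P (\<lambda>w. l * c w)" by (simp add: enlarge_def)
    qed
    then show "bounded ?F" using bounded_enlarge bounded_subset by blast
  qed
  finally show ?thesis by (simp add: ennreal_le_iff)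
qed

lemma finite_eventually_bound:
  fixes g :: "'a \<Rightarrow> real \<Rightarrow> bool"
  assumes "\<And>w. w \<in> U \<Longrightarrow> \<exists>d>0. \<forall>t. 0 < t \<longrightarrow> t \<le> d \<longrightarrow> g w t"
  shows "\<exists>d>0. \<forall>t. 0 < t \<longrightarrow> t \<le> d \<longrightarrow> (\<forall>w\<in>U. g w t)"
proof -
  obtain d where d: "\<And>w. w \<in> U \<Longrightarrow> d w > 0 \<and> (\<forall>t. 0 < t \<longrightarrow> t \<le> d w \<longrightarrow> g w t)"
    using assms by metis
  let ?m = "Min (insert 1 (d ` U))"
  have "?m > 0" using fin d by auto
  moreover have "?m \<le> d w" if "w \<in> U" for w using fin that by (intro Min_le) auto
  ultimately show ?thesis using d by (intro exI[of _ ?m]) (meson order_trans)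
qed

text \<open>A point of the enlarged set outside \<open>P\<close> violates some original inequality
  and so lies in the corresponding layer; the layer volumes are added without regard to
  overlap.\<close>

lemma measure_enlarge_upper:
  assumes c: "\<And>w. w \<in> U \<Longrightarrow> 0 \<le> c w" and e: "e > 0"
  shows "\<exists>l0>0. \<forall>l. 0 < l \<longrightarrow> l \<le> l0 \<longrightarrow>
    measure lborel (enlarge U P (\<lambda>w. l * c w)) \<le> measure lborel P + l * (\<Sum>w\<in>U. c w * (face_area P w + e))"
proof -
  \<comment> \<open>A common bound for all \<open>c w\<close>, with 1 added so that division by it
    is safe.\<close>
  define C where "C = (\<Sum>w\<in>U. c w) + 1"
  have C: "c w \<le> C" if "w \<in> U" for w
    using member_le_sum[OF that _ fin, of c] c by (auto simp: C_def)
  have C0: "C > 0" using sum_nonneg[of U c] c by (auto simp: C_def intro: add_nonneg_pos)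
  obtain d where d: "d > 0" "\<And>t w. 0 < t \<Longrightarrow> t \<le> d \<Longrightarrow> w \<in> U \<Longrightarrow> measure lborel (outer_prism w t) \<le> face_area P w + e"
    using finite_eventually_bound[of "\<lambda>w t. measure lborel (outer_prism w t) \<le> face_area P w + e"]
      outer_prism_limit[OF _ e] by metis
  have "measure lborel (enlarge U P (\<lambda>w. l * c w)) \<le> measure lborel P + l * (\<Sum>w\<in>U. c w * (face_area P w + e))"
    if l: "0 < l" "l \<le> d / (2 * C)" for l
  proof -
    let ?E = "enlarge U P (\<lambda>w. l * c w)"
    let ?L = "\<lambda>w. {x \<in> ?E. x \<bullet> w \<in> {supp P w <.. supp P w + l * c w}}"
    have E: "?E \<in> sets borel" by (intro borel_closed closed_enlarge)
    have L: "?L w \<in> sets borel" for w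
    proof -
      have "?L w = {x \<in> space borel. x \<in> ?E \<and> x \<bullet> w \<in> {supp P w <.. supp P w + l * c w}}" by simp
      also have "\<dots> \<in> sets borel" using E by measurable
      finally show ?thesis .
    qed
    have bL: "bounded (?L w)" for w by (rule bounded_subset[OF bounded_enlarge]) auto
    have "?E \<subseteq> P \<union> (\<Union>w\<in>U. ?L w)"
    proof
      fix x assume x: "x \<in> ?E"
      show "x \<in> P \<union> (\<Union>w\<in>U. ?L w)"
      proof (cases "x \<in> P")
        case False
        then have "\<not> (\<forall>w\<in>U. x \<bullet> w \<le> supp P w)" by (subst (asm) P_eq) simp
        then obtain w where w: "w \<in> U" "supp P w < x \<bullet> w" by (auto simp: not_le)
        moreover have "x \<bullet> w \<le> supp P w + l * c w" using x w(1) by (simp add: enlarge_def)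
        ultimately have "x \<in> ?L w" using x by simp
        then show ?thesis using w(1) by blast
      qed simp
    qed
    then have "measure lborel ?E \<le> measure lborel (P \<union> (\<Union>w\<in>U. ?L w))"
    proof (rule measure_mono_bounded)
      show "P \<union> (\<Union>w\<in>U. ?L w) \<in> sets borel" by (intro sets.Un sets.finite_UN fin P_borel L)
      have "bounded (\<Union>w\<in>U. ?L w)" using fin bL by (intro bounded_UN) auto
      then show "bounded (P \<union> (\<Union>w\<in>U. ?L w))" using cP by (simp add: compact_imp_bounded)
    qed (rule E)
    also have "\<dots> \<le> measure lborel P + measure lborel (\<Union>w\<in>U. ?L w)"
    proof (rule measure_Un_le)
      show "P \<in> sets lborel" using P_borel by simp
      show "(\<Union>w\<in>U. ?L w) \<in> sets lborel" using L fin by (intro sets.finite_UN) auto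
    qed
    also have "measure lborel (\<Union>w\<in>U. ?L w) \<le> (\<Sum>w\<in>U. measure lborel (?L w))"
      using L by (intro measure_UNION_le fin) auto
    also have "\<dots> \<le> (\<Sum>w\<in>U. l * (c w * (face_area P w + e)))"
    proof (rule sum_mono)
      fix w assume w: "w \<in> U"
      have "measure lborel (?L w) \<le> l * c w * measure lborel (outer_prism w (2 * l * C))"
        using l c C by (intro layer_upper w) auto
      also have "\<dots> \<le> l * c w * (face_area P w + e)"
        using l c[OF w] C0 w by (intro mult_left_mono d) (auto simp: field_simps)
      finally show "measure lborel (?L w) \<le> l * (c w * (face_area P w + e))" by (simp add: mult.assoc)
    qed
    finally show ?thesis by (simp add: sum_distrib_left)
  qed
  then show ?thesis using d C0 by (intro exI[of _ "d / (2 * C)"]) auto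
qed

text \<open>The layers that leave all other inequalities at their original bounds lie in the
  enlarged set, are pairwise disjoint and do not meet \<open>P\<close>.\<close>

lemma measure_enlarge_lower:
  assumes c: "\<And>w. w \<in> U \<Longrightarrow> 0 \<le> c w" and e: "e > 0"
  shows "\<exists>l0>0. \<forall>l. 0 < l \<longrightarrow> l \<le> l0 \<longrightarrow>
    measure lborel P + l * (\<Sum>w\<in>U. c w * (face_area P w - e)) \<le> measure lborel (enlarge U P (\<lambda>w. l * c w))"
proof -
  define C where "C = (\<Sum>w\<in>U. c w) + 1"
  have C: "c w \<le> C" if "w \<in> U" for w
    using member_le_sum[OF that _ fin, of c] c by (auto simp: C_def)
  have C0: "C > 0" using sum_nonneg[of U c] c by (auto simp: C_def intro: add_nonneg_pos)
  obtain d where d: "d > 0" "\<And>t w. 0 < t \<Longrightarrow> t \<le> d \<Longrightarrow> w \<in> U \<Longrightarrow> face_area P w - e \<le> measure lborel (inner_prism w t)"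
    using finite_eventually_bound[of "\<lambda>w t. face_area P w - e \<le> measure lborel (inner_prism w t)"]
      inner_prism_limit[OF _ e] by metis
  have "measure lborel P + l * (\<Sum>w\<in>U. c w * (face_area P w - e)) \<le> measure lborel (enlarge U P (\<lambda>w. l * c w))"
    if l: "0 < l" "l \<le> d / C" for l
  proof -
    let ?E = "enlarge U P (\<lambda>w. l * c w)"
    let ?D = "\<lambda>w. {x. \<forall>w'\<in>U - {w}. x \<bullet> w' \<le> supp P w'}"
    let ?L = "\<lambda>w. {x \<in> ?D w. x \<bullet> w \<in> {supp P w <.. supp P w + l * c w}}"
    have E: "?E \<in> sets borel" by (intro borel_closed closed_enlarge)
    have D: "?D w \<in> sets borel" for w
    proof -
      have "?D w = (\<Inter>w'\<in>U - {w}. {x. x \<bullet> w' \<le> supp P w'})" by auto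
      also have "closed \<dots>" by (intro closed_INT ballI closed_Collect_le continuous_intros)
      finally show ?thesis by (rule borel_closed)
    qed
    have L: "?L w \<in> sets borel" for w
    proof -
      have "?L w = {x \<in> space borel. x \<in> ?D w \<and> x \<bullet> w \<in> {supp P w <.. supp P w + l * c w}}" by simp
      also have "\<dots> \<in> sets borel" using D by measurable
      finally show ?thesis .
    qed
    have LE: "?L w \<subseteq> ?E" for w
    proof
      fix x assume x: "x \<in> ?L w"
      have "x \<bullet> w' \<le> supp P w' + l * c w'" if "w' \<in> U" for w'
        using x that l c[OF that] by (cases "w' = w") (auto intro: add_increasing2)
      then show "x \<in> ?E" by (simp add: enlarge_def)
    qed
    have PE: "P \<subseteq> ?E"
      using supp_upper[OF cP] c l by (auto simp: enlarge_def intro!: add_increasing2)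
    have bL: "bounded (?L w)" for w by (rule bounded_subset[OF bounded_enlarge LE])
    have dj: "disjoint_family_on ?L U"
    proof (unfold disjoint_family_on_def, intro ballI impI)
      fix v w assume vw: "v \<in> U" "w \<in> U" "v \<noteq> w"
      have "x \<bullet> v \<le> supp P v" if "x \<in> ?L w" for x using that vw by blast
      then show "?L v \<inter> ?L w = {}" by fastforce
    qed
    have PL: "P \<inter> (\<Union>w\<in>U. ?L w) = {}"
    proof -
      have "x \<notin> ?L w" if "x \<in> P" for x w using supp_upper[OF cP that, of w] by simp
      then show ?thesis by blast
    qed
    have fe: "emeasure lborel (?L w) \<noteq> \<infinity>" for w using emeasure_bounded_finite[OF bL, of w] by auto
    have "l * (\<Sum>w\<in>U. c w * (face_area P w - e)) = (\<Sum>w\<in>U. l * c w * (face_area P w - e))"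
      by (simp add: sum_distrib_left mult.assoc)
    also have "\<dots> \<le> (\<Sum>w\<in>U. measure lborel (?L w))"
    proof (rule sum_mono)
      fix w assume w: "w \<in> U"
      have "l * c w * (face_area P w - e) \<le> l * c w * measure lborel (inner_prism w (l * C))"
        using l c[OF w] C0 w by (intro mult_left_mono d) (auto simp: field_simps)
      also have "\<dots> \<le> measure lborel (?L w)"
        using l c C by (intro layer_lower w) auto
      finally show "l * c w * (face_area P w - e) \<le> measure lborel (?L w)" .
    qed
    also have "\<dots> = measure lborel (\<Union>w\<in>U. ?L w)"
      using L fe dj by (intro measure_finite_Union[symmetric] fin) auto
    finally have "measure lborel P + l * (\<Sum>w\<in>U. c w * (face_area P w - e))
      \<le> measure lborel P + measure lborel (\<Union>w\<in>U. ?L w)" by simp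
    also have "\<dots> = measure lborel (P \<union> (\<Union>w\<in>U. ?L w))"
    proof (rule measure_Union[symmetric])
      show "emeasure lborel P \<noteq> \<infinity>" using emeasure_compact_finite[OF cP] by auto
      have "bounded (\<Union>w\<in>U. ?L w)" using fin bL by (intro bounded_UN) auto
      then show "emeasure lborel (\<Union>w\<in>U. ?L w) \<noteq> \<infinity>" using emeasure_bounded_finite[of "\<Union>w\<in>U. ?L w"] by auto
      show "P \<in> sets lborel" using cP by (simp add: compact_imp_closed)
      show "(\<Union>w\<in>U. ?L w) \<in> sets lborel" using L fin by (intro sets.finite_UN) auto
    qed (rule PL)
    also have "\<dots> \<le> measure lborel ?E"
    proof (rule measure_mono_bounded[OF _ _ E bounded_enlarge])
      show "P \<union> (\<Union>w\<in>U. ?L w) \<subseteq> ?E" using PE LE by blast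
      show "P \<union> (\<Union>w\<in>U. ?L w) \<in> sets borel" by (intro sets.Un sets.finite_UN fin P_borel L)
    qed
    finally show ?thesis .
  qed
  then show ?thesis using d C0 by (intro exI[of _ "d / C"]) auto
qed

end

section \<open>Volume of the Minkowski interpolation between a polytope and its reflection\<close>

definition reflected_sum :: "'a::real_vector set \<Rightarrow> real \<Rightarrow> 'a set" where
  "reflected_sum P t = (\<lambda>(x, y). (1 - t) *\<^sub>R x - t *\<^sub>R y) ` (P \<times> P)"

lemma reflected_sumI: "x \<in> P \<Longrightarrow> y \<in> P \<Longrightarrow> (1 - t) *\<^sub>R x - t *\<^sub>R y \<in> reflected_sum P t"
  by (auto simp: reflected_sum_def)

lemma compact_reflected_sum: "compact P \<Longrightarrow> compact (reflected_sum P t)" for P :: "'a::euclidean_space set"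
  unfolding reflected_sum_def case_prod_beta
  by (intro compact_continuous_image compact_Times continuous_intros)

lemma convex_reflected_sum:
  assumes "convex P"
  shows "convex (reflected_sum P t)"
proof (rule convexI)
  fix x y and a b :: real assume h: "x \<in> reflected_sum P t" "y \<in> reflected_sum P t" "0 \<le> a" "0 \<le> b" "a + b = 1"
  obtain x1 x2 y1 y2 where e: "x1 \<in> P" "x2 \<in> P" "y1 \<in> P" "y2 \<in> P"
    "x = (1 - t) *\<^sub>R x1 - t *\<^sub>R x2" "y = (1 - t) *\<^sub>R y1 - t *\<^sub>R y2"
    using h by (auto simp: reflected_sum_def)
  have "a *\<^sub>R x + b *\<^sub>R y = (1 - t) *\<^sub>R (a *\<^sub>R x1 + b *\<^sub>R y1) - t *\<^sub>R (a *\<^sub>R x2 + b *\<^sub>R y2)"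
    unfolding e by (simp add: algebra_simps)
  then show "a *\<^sub>R x + b *\<^sub>R y \<in> reflected_sum P t"
    using convexD[OF assms e(1,3) h(3-5)] convexD[OF assms e(2,4) h(3-5)] reflected_sumI by metis
qed

lemma measure_affine:
  fixes S :: "'a::euclidean_space set"
  assumes "compact S"
  shows "measure lborel ((\<lambda>x. m *\<^sub>R x + c) ` S) = \<bar>m\<bar> ^ DIM('a) * measure lborel S"
proof -
  have c: "compact ((\<lambda>x. m *\<^sub>R x + c) ` S)" by (intro compact_continuous_image continuous_intros assms)
  have "measure lborel ((\<lambda>x. m *\<^sub>R x + c) ` S) = measure lebesgue ((\<lambda>x. m *\<^sub>R x + c) ` S)"
    using c by (simp add: measure_completion compact_imp_closed)
  also have "\<dots> = \<bar>m\<bar> ^ DIM('a) * measure lebesgue S"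
    using emeasure_lebesgue_affine[of m c S] by (simp add: measure_def enn2real_mult)
  also have "measure lebesgue S = measure lborel S"
    using assms by (simp add: measure_completion compact_imp_closed)
  finally show ?thesis .
qed

lemma measure_interior_pos:
  fixes P :: "'a::euclidean_space set"
  assumes "bounded P" "P \<in> sets borel" "p \<in> interior P"
  shows "0 < measure lborel P"
proof -
  obtain e where e: "e > 0" "ball p e \<subseteq> P" using assms(3) by (auto simp: mem_interior)
  have "0 < measure lborel (ball p e)" using e by (simp add: content_ball_pos)
  also have "\<dots> \<le> measure lborel P" using e assms by (intro measure_mono_bounded) auto
  finally show ?thesis .
qed

locale balanced_polytope = polytope_body U P p for U P :: "'a::euclidean_space set" and p +
  assumes sym: "\<And>w. w \<in> U \<Longrightarrow> - w \<in> U"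
    and area_sym: "\<And>w. w \<in> U \<Longrightarrow> face_area P (- w) = face_area P w"
    and conv: "convex P"
begin

lemma pos: "0 < measure lborel P"
  using measure_interior_pos[OF compact_imp_bounded[OF cP] P_borel p] .

text \<open>Half of the formula that decomposes \<open>P\<close> into cones with apex
  \<open>p\<close>. Enlarging by multiples of the distances from \<open>p\<close> is a dilation,
  whose volume has derivative \<open>DIM('a) * measure lborel P\<close>, while the layers give at
  least the sum on the left.\<close>

lemma sum_area_le: "(\<Sum>w\<in>U. (supp P w - p \<bullet> w) * face_area P w) \<le> DIM('a) * measure lborel P"
proof -
  define c where "c w = supp P w - p \<bullet> w" for w
  have c0: "0 \<le> c w" if "w \<in> U" for w using p_less[OF that] by (simp add: c_def)
  have "(\<Sum>w\<in>U. c w * (face_area P w - e)) \<le> DIM('a) * measure lborel P" if e: "e > 0" for e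
  proof -
    obtain l0 where l0: "l0 > 0" "\<And>l. 0 < l \<Longrightarrow> l \<le> l0 \<Longrightarrow>
      measure lborel P + l * (\<Sum>w\<in>U. c w * (face_area P w - e)) \<le> measure lborel (enlarge U P (\<lambda>w. l * c w))"
      using measure_enlarge_lower[of c, OF c0 e] by blast
    have ineq: "(\<Sum>w\<in>U. c w * (face_area P w - e)) \<le> ((1 + l) ^ DIM('a) - (1 + 0) ^ DIM('a)) / (l - 0) * measure lborel P"
      if l: "0 < l" "l < l0" for l
    proof -
      have "measure lborel (enlarge U P (\<lambda>w. l * c w)) = (1 + l) ^ DIM('a) * measure lborel P"
        using dilate_eq[of l] measure_affine[OF cP, of "1 + l" "- (l *\<^sub>R p)"] l by (simp add: c_def)
      then have "l * (\<Sum>w\<in>U. c w * (face_area P w - e)) \<le> ((1 + l) ^ DIM('a) - 1) * measure lborel P"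
        using l0(2)[of l] l by (simp add: algebra_simps)
      then show ?thesis using l by (simp add: field_simps)
    qed
    have "((\<lambda>l::real. (1 + l) ^ DIM('a)) has_field_derivative DIM('a)) (at 0)"
      by (auto intro!: derivative_eq_intros)
    then have "((\<lambda>l::real. ((1 + l) ^ DIM('a) - (1 + 0) ^ DIM('a)) / (l - 0)) \<longlongrightarrow> DIM('a)) (at 0)"
      unfolding has_field_derivative_iff .
    then have lim: "((\<lambda>l::real. ((1 + l) ^ DIM('a) - (1 + 0) ^ DIM('a)) / (l - 0) * measure lborel P) \<longlongrightarrow> DIM('a) * measure lborel P) (at_right 0)"
      by (intro tendsto_mult tendsto_const) (rule filterlim_mono[OF _ order_refl at_le], auto)
    show ?thesis
      by (rule tendsto_lowerbound[OF lim]) (use ineq l0(1) in \<open>auto simp: eventually_at_right_field intro!: exI[of _ l0]\<close>)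
  qed
  then have *: "(\<Sum>w\<in>U. c w * face_area P w) - e * (\<Sum>w\<in>U. c w) \<le> DIM('a) * measure lborel P" if "e > 0" for e
    using that by (simp add: algebra_simps sum_subtractf sum_distrib_left)
  have "((\<lambda>e. (\<Sum>w\<in>U. c w * face_area P w) - e * (\<Sum>w\<in>U. c w)) \<longlongrightarrow> (\<Sum>w\<in>U. c w * face_area P w) - 0 * (\<Sum>w\<in>U. c w)) (at_right 0)"
    by (intro tendsto_intros)
  then have "(\<Sum>w\<in>U. c w * face_area P w) - 0 * (\<Sum>w\<in>U. c w) \<le> DIM('a) * measure lborel P"
    by (rule tendsto_upperbound) (use * in \<open>auto simp: eventually_at_right_field intro!: exI[of _ 1]\<close>)
  then show ?thesis by (simp add: c_def)
qed

text \<open>The place where equality of opposite face areas enters. The left side is the first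
  variation of the volume of \<open>P\<close> in the direction of \<open>p - P\<close>; exchanging
  \<open>w\<close> and \<open>- w\<close> identifies it with the one for dilation about
  \<open>p\<close>.\<close>

lemma sum_area_reflect:
  "(\<Sum>w\<in>U. (p \<bullet> w + supp P (- w)) * face_area P w) = (\<Sum>w\<in>U. (supp P w - p \<bullet> w) * face_area P w)"
  by (rule sum.reindex_bij_witness[of _ uminus uminus]) (use sym area_sym in auto)

text \<open>The numbers \<open>c w\<close> are the support numbers of \<open>p - P\<close>, so the
  sum \<open>P + l (p - P)\<close> lies in the enlargement by \<open>l * c w\<close>.\<close>

lemma measure_reflected_upper:
  assumes e: "e > 0"
  shows "\<exists>l0>0. \<forall>l. 0 < l \<longrightarrow> l \<le> l0 \<longrightarrow>
    measure lborel ((\<lambda>(x, y). x + l *\<^sub>R (p - y)) ` (P \<times> P)) \<le> measure lborel P + l * (DIM('a) * measure lborel P + e)"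
proof -
  define c where "c w = p \<bullet> w + supp P (- w)" for w
  have c0: "0 \<le> c w" if "w \<in> U" for w using p_less[OF sym[OF that]] by (simp add: c_def)
  \<comment> \<open>Spreads the error \<open>e\<close> over the facets: the total error is
    \<open>e'\<close> times the sum of all \<open>c w\<close>.\<close>
  define e' where "e' = e / ((\<Sum>w\<in>U. c w) + 1)"
  have s0: "0 \<le> (\<Sum>w\<in>U. c w)" using c0 by (rule sum_nonneg)
  then have e': "e' > 0" using e by (simp add: e'_def)
  have "e' * (\<Sum>w\<in>U. c w) \<le> e" using e s0 by (simp add: e'_def field_simps)
  obtain l0 where l0: "l0 > 0" "\<And>l. 0 < l \<Longrightarrow> l \<le> l0 \<Longrightarrow>
    measure lborel (enlarge U P (\<lambda>w. l * c w)) \<le> measure lborel P + l * (\<Sum>w\<in>U. c w * (face_area P w + e'))"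
    using measure_enlarge_upper[of c, OF c0 e'] by blast
  have "measure lborel ((\<lambda>(x, y). x + l *\<^sub>R (p - y)) ` (P \<times> P)) \<le> measure lborel P + l * (DIM('a) * measure lborel P + e)"
    if l: "0 < l" "l \<le> l0" for l
  proof -
    have "(\<lambda>(x, y). x + l *\<^sub>R (p - y)) ` (P \<times> P) \<subseteq> enlarge U P (\<lambda>w. l * c w)"
    proof clarify
      fix x y assume xy: "x \<in> P" "y \<in> P"
      have "(x + l *\<^sub>R (p - y)) \<bullet> w \<le> supp P w + l * c w" for w
      proof -
        have "l * ((p - y) \<bullet> w) \<le> l * c w"
          using supp_upper[OF cP xy(2), of "- w"] l by (intro mult_left_mono) (auto simp: c_def inner_diff_left)
        then show ?thesis using supp_upper[OF cP xy(1), of w] by (simp add: inner_add_left)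
      qed
      then show "x + l *\<^sub>R (p - y) \<in> enlarge U P (\<lambda>w. l * c w)" by (simp add: enlarge_def)
    qed
    moreover have "compact ((\<lambda>(x, y). x + l *\<^sub>R (p - y)) ` (P \<times> P))"
      unfolding case_prod_beta by (intro compact_continuous_image compact_Times continuous_intros cP)
    ultimately have "measure lborel ((\<lambda>(x, y). x + l *\<^sub>R (p - y)) ` (P \<times> P)) \<le> measure lborel (enlarge U P (\<lambda>w. l * c w))"
      by (intro measure_mono_bounded bounded_enlarge borel_closed closed_enlarge) (auto intro: compact_imp_closed)
    also have "\<dots> \<le> measure lborel P + l * (\<Sum>w\<in>U. c w * (face_area P w + e'))" by (rule l0(2)[OF l])
    also have "(\<Sum>w\<in>U. c w * (face_area P w + e')) = (\<Sum>w\<in>U. c w * face_area P w) + e' * (\<Sum>w\<in>U. c w)"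
      by (simp add: distrib_left sum.distrib sum_distrib_left mult.commute)
    also have "\<dots> \<le> DIM('a) * measure lborel P + e"
      using sum_area_le sum_area_reflect \<open>e' * (\<Sum>w\<in>U. c w) \<le> e\<close> by (simp add: c_def)
    finally show ?thesis using l by simp
  qed
  then show ?thesis using l0(1) by blast
qed

text \<open>Up to translation \<open>(1 - t) P - t P\<close> is \<open>P + l (p - P)\<close> scaled
  by \<open>1 - t\<close>, with \<open>l = t / (1 - t)\<close>. The shrinking factor is at most
  exp(-t d) and the growth at most exp(l (d + e/2)), where d is the dimension; the first-order terms
  in d cancel.\<close>

lemma ln_measure_reflected_small:
  assumes e: "e > 0"
  shows "\<exists>t0>0. \<forall>t. 0 < t \<longrightarrow> t < t0 \<longrightarrow> t < 1 \<and>
    measure lborel (reflected_sum P t) \<le> exp (t * e) * measure lborel P"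
proof -
  define V where "V = measure lborel P"
  have V: "V > 0" using pos by (simp add: V_def)
  obtain l0 where l0: "l0 > 0" "\<And>l. 0 < l \<Longrightarrow> l \<le> l0 \<Longrightarrow>
    measure lborel ((\<lambda>(x, y). x + l *\<^sub>R (p - y)) ` (P \<times> P)) \<le> V + l * (DIM('a) * V + (e / 2) * V)"
    using measure_reflected_upper[of "(e / 2) * V"] e V by (auto simp: V_def)
  have "((\<lambda>t::real. (DIM('a) + e / 2) / (1 - t) - DIM('a)) \<longlongrightarrow> (DIM('a) + e / 2) / (1 - 0) - DIM('a)) (at_right 0)"
    by (intro tendsto_intros) auto
  from order_tendstoD(2)[OF this, of e] have "\<forall>\<^sub>F t in at_right 0. (DIM('a) + e / 2) / (1 - t) - DIM('a) < e"
    using e by simp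
  moreover have "((\<lambda>t::real. t / (1 - t)) \<longlongrightarrow> 0 / (1 - 0)) (at_right 0)" by (intro tendsto_intros) auto
  from order_tendstoD(2)[OF this, of l0] have "\<forall>\<^sub>F t in at_right 0. t / (1 - t) < l0"
    using l0 by simp
  moreover have "\<forall>\<^sub>F t::real in at_right 0. t < 1" by (auto simp: eventually_at_right_field intro!: exI[of _ 1])
  ultimately have "\<forall>\<^sub>F t in at_right 0. t < 1 \<and> t / (1 - t) < l0 \<and> (DIM('a) + e / 2) / (1 - t) - DIM('a) < e"
    by eventually_elim auto
  then obtain t0 where t0: "t0 > 0" "\<And>t. 0 < t \<Longrightarrow> t < t0 \<Longrightarrow> t < 1 \<and> t / (1 - t) < l0 \<and> (DIM('a) + e / 2) / (1 - t) - DIM('a) < e"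
    by (auto simp: eventually_at_right_field)
  have "measure lborel (reflected_sum P t) \<le> exp (t * e) * V" if t: "0 < t" "t < t0" for t
  proof -
    have t': "t < 1" "t / (1 - t) < l0" "(DIM('a) + e / 2) / (1 - t) - DIM('a) < e" using t0(2)[OF t] by auto
    define l where "l = t / (1 - t)"
    have l: "0 < l" "l \<le> l0" "(1 - t) * l = t" using t t' by (auto simp: l_def)
    let ?S = "(\<lambda>(x, y). x + l *\<^sub>R (p - y)) ` (P \<times> P)"
    have cS: "compact ?S"
      unfolding case_prod_beta by (intro compact_continuous_image compact_Times continuous_intros cP)
    have "reflected_sum P t = (\<lambda>x. (1 - t) *\<^sub>R x + - (t *\<^sub>R p)) ` ?S"
      unfolding reflected_sum_def image_image case_prod_beta
      by (intro image_cong refl) (simp add: scaleR_right_distrib scaleR_right_diff_distrib l(3))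
    then have "measure lborel (reflected_sum P t) = (1 - t) ^ DIM('a) * measure lborel ?S"
      using measure_affine[OF cS, of "1 - t" "- (t *\<^sub>R p)"] t' by simp
    also have "\<dots> \<le> (1 - t) ^ DIM('a) * (V + l * (DIM('a) * V + (e / 2) * V))"
      using l0(2)[OF l(1,2)] t' by (intro mult_left_mono) auto
    also have "\<dots> = (1 - t) ^ DIM('a) * (1 + l * (DIM('a) + e / 2)) * V" by (simp add: algebra_simps)
    also have "\<dots> \<le> exp (- t) ^ DIM('a) * exp (l * (DIM('a) + e / 2)) * V"
      using exp_ge_add_one_self[of "- t"] exp_ge_add_one_self[of "l * (DIM('a) + e / 2)"] t' l V e
      by (intro mult_right_mono mult_mono power_mono) auto
    also have "exp (- t) ^ DIM('a) * exp (l * (DIM('a) + e / 2)) = exp (t * ((DIM('a) + e / 2) / (1 - t) - DIM('a)))"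
      unfolding exp_of_nat_mult[symmetric] exp_add[symmetric] l_def by (simp add: right_diff_distrib mult.commute)
    also have "\<dots> \<le> exp (t * e)" using t t' by simp
    finally show ?thesis using V by simp
  qed
  then show ?thesis using t0 by (auto simp: V_def intro!: exI[of _ t0])
qed

lemma measure_reflected_halving:
  assumes t: "0 < t" "t < 1"
  shows "measure lborel P * measure lborel (reflected_sum P t) \<le> (measure lborel (reflected_sum P (t / 2)))\<^sup>2"
proof -
  have "sqrt (measure lborel P * measure lborel (reflected_sum P t)) \<le> measure lborel (reflected_sum P (t / 2))"
  proof (rule brunn_minkowski_midpoint)
    fix x y assume xy: "x \<in> P" "y \<in> reflected_sum P t"
    then obtain a b where ab: "a \<in> P" "b \<in> P" "y = (1 - t) *\<^sub>R a - t *\<^sub>R b" by (auto simp: reflected_sum_def)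
    \<comment> \<open>In \<open>x + y\<close> the points of \<open>P\<close> with positive
      coefficient are \<open>x\<close> and \<open>(1 - t) *\<^sub>R a\<close>, of total weight
      \<open>2 - t\<close>. Normalizing them to one point of \<open>P\<close> exhibits the midpoint
      as an element for the parameter \<open>t / 2\<close>.\<close>
    have "(1 / (2 - t)) *\<^sub>R x + ((1 - t) / (2 - t)) *\<^sub>R a \<in> P"
      using t xy ab by (intro convexD[OF conv]) (auto simp: field_simps)
    moreover have "(1/2) *\<^sub>R (x + y) = (1 - t / 2) *\<^sub>R ((1 / (2 - t)) *\<^sub>R x + ((1 - t) / (2 - t)) *\<^sub>R a) - (t / 2) *\<^sub>R b"
    proof -
      have "(1 - t / 2) * (1 / (2 - t)) = 1 / 2" "(1 - t / 2) * ((1 - t) / (2 - t)) = (1 - t) / 2"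
        using t by (auto simp: field_simps)
      then show ?thesis
        unfolding ab(3) scaleR_right_distrib scaleR_right_diff_distrib scaleR_scaleR by (simp only: mult_1 times_divide_eq_left) simp
    qed
    ultimately show "(1/2) *\<^sub>R (x + y) \<in> reflected_sum P (t / 2)" using ab(2) reflected_sumI by metis
  qed (use conv cP in \<open>auto intro: convex_reflected_sum compact_reflected_sum\<close>)
  then have "(sqrt (measure lborel P * measure lborel (reflected_sum P t)))\<^sup>2 \<le> (measure lborel (reflected_sum P (t / 2)))\<^sup>2"
    by (intro power_mono) auto
  then show ?thesis by simp
qed

text \<open>By the Brunn-Minkowski inequality the volume of \<open>(1 - t) P - t P\<close> is a log-concave
  function of \<open>t\<close>; the symmetry of the facet areas makes its derivative at \<open>0\<close> nonpositive.\<close>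
lemma measure_reflected_sum_le: "measure lborel (reflected_sum P (1 / 2)) \<le> measure lborel P"
proof (rule ccontr)
  define V where "V = measure lborel P"
  define r where "r t = measure lborel (reflected_sum P t) / V" for t
  assume "\<not> ?thesis"
  then have r1: "r (1 / 2) > 1" using pos by (simp add: r_def V_def)
  have V: "V > 0" using pos by (simp add: V_def)
  have half: "r t \<le> (r (t / 2))\<^sup>2" if "0 < t" "t < 1" for t
    using measure_reflected_halving[OF that] V by (simp add: r_def V_def field_simps power2_eq_square)
  \<comment> \<open>Log-concavity enters through repeated halving of the parameter, which transports
    an excess of volume at \<open>1 / 2\<close> to arbitrarily small parameters.\<close>
  have it: "r (1 / 2 ^ Suc n) > 0 \<and> ln (r (1 / 2)) \<le> 2 ^ n * ln (r (1 / 2 ^ Suc n))" for n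
  proof (induction n)
    case 0
    then show ?case using r1 by simp
  next
    case (Suc n)
    let ?t = "1 / 2 ^ Suc n :: real"
    have t: "0 < ?t" "?t < 1" by (auto simp: power_Suc[symmetric] intro: one_less_power simp del: power_Suc)
    have e: "?t / 2 = 1 / 2 ^ Suc (Suc n)" by simp
    have h: "r ?t \<le> (r (1 / 2 ^ Suc (Suc n)))\<^sup>2" using half[OF t] unfolding e .
    moreover have "r (1 / 2 ^ Suc (Suc n)) \<ge> 0" using V by (simp add: r_def)
    ultimately have p: "r (1 / 2 ^ Suc (Suc n)) > 0" using Suc by (cases "r (1 / 2 ^ Suc (Suc n)) = 0") auto
    have "ln (r ?t) \<le> ln ((r (1 / 2 ^ Suc (Suc n)))\<^sup>2)" using h Suc by (subst ln_le_cancel_iff) auto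
    also have "\<dots> = 2 * ln (r (1 / 2 ^ Suc (Suc n)))" using p by (simp add: ln_realpow)
    finally have "2 ^ n * ln (r ?t) \<le> 2 ^ n * (2 * ln (r (1 / 2 ^ Suc (Suc n))))" by (intro mult_left_mono) auto
    also have "\<dots> = 2 ^ Suc n * ln (r (1 / 2 ^ Suc (Suc n)))" by simp
    finally show ?case using Suc p by (auto intro: order_trans)
  qed
  \<comment> \<open>With this rate the bound near 0, taken at \<open>1 / 2 ^ Suc n\<close> and
    multiplied by \<open>2 ^ n\<close>, yields only \<open>e / 2\<close>, whereas halving demands
    \<open>e\<close>.\<close>
  define e where "e = ln (r (1 / 2))"
  have e: "e > 0" using r1 by (simp add: e_def)
  obtain t0 where t0: "t0 > 0" "\<And>t. 0 < t \<Longrightarrow> t < t0 \<Longrightarrow> measure lborel (reflected_sum P t) \<le> exp (t * e) * V"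
    using ln_measure_reflected_small[OF e] by (auto simp: V_def)
  obtain n where n: "(1 / 2) ^ n < t0" using real_arch_pow_inv[OF t0(1), of "1 / 2"] by auto
  let ?t = "1 / 2 ^ Suc n :: real"
  have "?t \<le> (1 / 2) ^ n" by (simp add: power_one_over divide_simps)
  then have t: "0 < ?t" "?t < t0" using n by auto
  have "r ?t \<le> exp (?t * e)" using t0(2)[OF t] V by (simp add: r_def field_simps)
  then have "ln (r ?t) \<le> ln (exp (?t * e))" using it[of n] by (subst ln_le_cancel_iff) auto
  then have "ln (r ?t) \<le> ?t * e" by (simp only: ln_exp)
  then have "2 ^ n * ln (r ?t) \<le> 2 ^ n * (?t * e)" by (intro mult_left_mono) auto
  also have "\<dots> = e / 2" by simp
  finally show False using it[of n] e by (simp add: e_def)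
qed

end

section \<open>Equality in the Brunn-Minkowski inequality\<close>

definition section_area :: "'a::euclidean_space \<Rightarrow> 'a set \<Rightarrow> real \<Rightarrow> real" where
  "section_area u S z = measure lborel (prism u z S)"

definition below :: "'a::euclidean_space \<Rightarrow> 'a set \<Rightarrow> real \<Rightarrow> real" where
  "below u S z = measure lborel (S \<inter> {x. x \<bullet> u \<le> z})"

locale convex_body =
  fixes u :: "'a::euclidean_space" and S :: "'a set" and q :: 'a
  assumes u: "norm u = 1" and cS: "compact S" and convS: "convex S" and q: "q \<in> interior S"
begin

abbreviation "lo \<equiv> - supp S (- u)"
abbreviation "hi \<equiv> supp S u"

lemma S_ne: "S \<noteq> {}" and S_borel: "S \<in> sets borel" and S_bdd: "bounded S"
  using q interior_subset cS by (auto intro: borel_closed compact_imp_closed compact_imp_bounded)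

lemma u_ne: "u \<noteq> 0" using u by auto

lemma lo_less: "lo < q \<bullet> u" and hi_greater: "q \<bullet> u < hi"
  using supp_interior[OF cS q, of u] supp_interior[OF cS q, of "- u"] u_ne by auto

lemma inner_bounds: "x \<in> S \<Longrightarrow> lo \<le> x \<bullet> u" "x \<in> S \<Longrightarrow> x \<bullet> u \<le> hi"
  using supp_lower[OF cS] supp_upper[OF cS] by auto

lemma prism_empty: "z \<notin> {lo..hi} \<Longrightarrow> prism u z S = {}"
  using inner_bounds level_proj_inner[OF u] by (fastforce simp: prism_def)

lemma emeasure_section: "emeasure lborel (prism u z S) = ennreal (section_area u S z)"
  unfolding section_area_def by (intro emeasure_bounded_eq bounded_prism u S_bdd)

lemma section_nonneg: "0 \<le> section_area u S z"
  by (simp add: section_area_def)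

text \<open>Dominated convergence for the indicators of the prisms. Continuity includes the end
  levels, approached from inside, where the section may have positive area when the extreme face is
  a facet.\<close>

lemma continuous_section: "continuous_on {lo..hi} (section_area u S)"
proof (unfold continuous_on_sequentially, intro ballI allI impI, elim conjE)
  fix z and zn :: "nat \<Rightarrow> real"
  assume zn: "z \<in> {lo..hi}" "\<forall>n. zn n \<in> {lo..hi}" "zn \<longlonglongrightarrow> z"
  obtain a where a: "a \<in> S" "a \<bullet> u = lo" using supp_attained[OF cS S_ne, of "- u"] by (metis inner_minus_right minus_minus)
  obtain b where b: "b \<in> S" "b \<bullet> u = hi" using supp_attained[OF cS S_ne, of u] by metis
  obtain R where R: "\<And>x. x \<in> S \<Longrightarrow> norm x \<le> R" using S_bdd by (auto simp: bounded_iff)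
  define B where "B = R + 1 + max \<bar>lo\<bar> \<bar>hi\<bar>"
  have sub: "x \<in> cball 0 B" if "x \<in> prism u y S" "y \<in> {lo..hi}" for x y
    using norm_level_proj_le[OF u, of x y] R[of "level_proj u y x"] that by (auto simp: prism_def B_def)
  have mS: "S \<in> sets borel" by (rule S_borel)
  have "(\<lambda>n. \<integral>\<^sup>+x. indicator (prism u (zn n) S) x \<partial>lborel) \<longlonglongrightarrow> (\<integral>\<^sup>+x. indicator (prism u z S) x \<partial>lborel)"
  proof (rule nn_integral_dominated_convergence[where w = "indicator (cball (0::'a) B)"])
    show "(\<lambda>x. indicator (prism u y S) x :: ennreal) \<in> borel_measurable lborel" for y
      using prism_borel[OF mS] by simp
    then show "(\<lambda>x. indicator (prism u y S) x :: ennreal) \<in> borel_measurable lborel" for y .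
    show "AE x in lborel. (indicator (prism u (zn n) S) x :: ennreal) \<le> indicator (cball 0 B) x" for n
      using sub zn(2) by (intro AE_I2) (auto split: split_indicator)
    show "(\<integral>\<^sup>+x. indicator (cball (0::'a) B) x \<partial>lborel) < \<infinity>"
      using emeasure_bounded_finite[of "cball 0 B :: 'a set"] by simp
    have "AE x in lborel. (\<lambda>n. indicator S (level_proj u (zn n) x) :: ennreal) \<longlonglongrightarrow> indicator S (level_proj u z x)"
      using zn by (intro AE_indicator_level_proj_tendsto[OF u compact_imp_closed[OF cS] convS a b]) auto
    then show "AE x in lborel. (\<lambda>n. indicator (prism u (zn n) S) x :: ennreal) \<longlonglongrightarrow> indicator (prism u z S) x"
    proof (rule eventually_mono)
      fix x assume "(\<lambda>n. indicator S (level_proj u (zn n) x) :: ennreal) \<longlonglongrightarrow> indicator S (level_proj u z x)"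
      then show "(\<lambda>n. indicator (prism u (zn n) S) x :: ennreal) \<longlonglongrightarrow> indicator (prism u z S) x"
        unfolding indicator_prism by (cases "x \<in> slab u") auto
    qed
  qed (simp_all add: borel_measurable_indicator)
  then have "(\<lambda>n. ennreal (section_area u S (zn n))) \<longlonglongrightarrow> ennreal (section_area u S z)"
    using prism_borel[OF mS] by (simp add: emeasure_section)
  then show "(section_area u S \<circ> zn) \<longlonglongrightarrow> section_area u S z"
    by (simp add: o_def section_nonneg)
qed

lemma section_pos:
  assumes "z \<in> {lo<..<hi}"
  shows "0 < section_area u S z"
proof -
  obtain a where a: "a \<in> S" "a \<bullet> u = lo" using supp_attained[OF cS S_ne, of "- u"] by (metis inner_minus_right minus_minus)
  obtain b where b: "b \<in> S" "b \<bullet> u = hi" using supp_attained[OF cS S_ne, of u] by metis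
  \<comment> \<open>On the segment from a point at an extreme level to the interior point
    \<open>q\<close>, every point except possibly the first is interior.\<close>
  obtain x where x: "x \<in> interior S" "x \<bullet> u = z"
  proof (cases "z \<le> q \<bullet> u")
    case True
    define t where "t = (z - lo) / (q \<bullet> u - lo)"
    have t: "0 < t" "t \<le> 1" "t * (q \<bullet> u - lo) = z - lo" using assms True lo_less by (auto simp: t_def)
    have "a - t *\<^sub>R (a - q) \<in> interior S" using a t by (intro mem_interior_convex_shrink convS q) auto
    moreover have "(a - t *\<^sub>R (a - q)) \<bullet> u = z" using t(3) a by (simp add: inner_diff_left algebra_simps)
    ultimately show ?thesis using that by blast
  next
    case False
    define t where "t = (hi - z) / (hi - q \<bullet> u)"
    have t: "0 < t" "t \<le> 1" "t * (hi - q \<bullet> u) = hi - z" using assms False hi_greater by (auto simp: t_def)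
    have "b - t *\<^sub>R (b - q) \<in> interior S" using b t by (intro mem_interior_convex_shrink convS q) auto
    moreover have "(b - t *\<^sub>R (b - q)) \<bullet> u = z" using t(3) b by (simp add: inner_diff_left algebra_simps)
    ultimately show ?thesis using that by blast
  qed
  obtain e where e: "e > 0" "ball x e \<subseteq> S" using x(1) by (auto simp: mem_interior)
  \<comment> \<open>Level \<open>1 / 2\<close> is the middle of the slab, so a ball of radius at
    most \<open>1 / 2\<close> around \<open>y\<close> stays in it; projection to level
    \<open>z\<close> does not increase distances.\<close>
  define y where "y = level_proj u (1 / 2) x"
  have "ball y (min e (1 / 2)) \<subseteq> prism u z S"
  proof
    fix w assume w: "w \<in> ball y (min e (1 / 2))"
    have yu: "y \<bullet> u = 1 / 2" by (simp add: y_def level_proj_inner[OF u])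
    have d: "norm (w - y) < e" "norm (w - y) < 1 / 2" using w by (auto simp: dist_norm norm_minus_commute)
    have i: "\<bar>(w - y) \<bullet> u\<bar> \<le> norm (w - y)" using Cauchy_Schwarz_ineq2[of "w - y" u] u by simp
    have "\<bar>w \<bullet> u - 1 / 2\<bar> < 1 / 2" using i d(2) yu by (simp add: inner_diff_left)
    then have "w \<in> slab u" unfolding slab_def mem_Collect_eq by linarith
    moreover have "level_proj u z w \<in> ball x e"
    proof -
      have "level_proj u z w - x = level_proj u 0 (w - y)"
        using x(2) yu u by (simp add: y_def level_proj_def inner_diff_left inner_add_left dot_square_norm algebra_simps)
      moreover have "norm (level_proj u 0 v) \<le> norm v" for v
      proof -
        have "norm v ^ 2 = norm (level_proj u 0 v) ^ 2 + (v \<bullet> u) ^ 2"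
        proof -
          have uu: "u \<bullet> u = 1" using u by (simp add: dot_square_norm)
          show ?thesis
            unfolding level_proj_def power2_norm_eq_inner
            by (simp add: inner_add_left inner_add_right inner_commute uu algebra_simps power2_eq_square)
        qed
        then have "norm (level_proj u 0 v) ^ 2 \<le> norm v ^ 2" by simp
        then show ?thesis by (rule power2_le_imp_le) simp
      qed
      ultimately show ?thesis using d(1) by (simp add: dist_norm norm_minus_commute) (metis le_less_trans norm_minus_commute)
    qed
    ultimately show "w \<in> prism u z S" using e by (auto simp: prism_def)
  qed
  then have "y \<in> interior (prism u z S)" using e by (auto simp: mem_interior intro!: exI[of _ "min e (1/2)"])
  then show ?thesis unfolding section_area_def
    by (intro measure_interior_pos bounded_prism u S_bdd prism_borel S_borel)
qed

lemma below_eq_integral: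
  assumes "z \<in> {lo..hi}"
  shows "(section_area u S has_integral below u S z) {lo..z}"
proof -
  have c: "continuous_on {lo..z} (section_area u S)"
    using continuous_section by (rule continuous_on_subset) (use assms in auto)
  then have int: "section_area u S integrable_on {lo..z}" by (rule integrable_continuous_interval)
  have *: "S \<inter> {x. x \<bullet> u \<le> z} = {x \<in> S. x \<bullet> u \<in> {lo..z}}" using inner_bounds by auto
  have bd: "bounded (S \<inter> {x. x \<bullet> u \<le> z})" using S_bdd by (rule bounded_subset) auto
  have m: "(\<lambda>z'. section_area u S z' * indicator {lo..z} z') \<in> borel_measurable borel"
    using borel_measurable_continuous_on_indicator[OF _ c] by (simp add: mult.commute)
  have "ennreal (below u S z) = emeasure lborel (S \<inter> {x. x \<bullet> u \<le> z})"
    unfolding below_def by (rule emeasure_bounded_eq[OF bd, symmetric])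
  also have "\<dots> = emeasure lborel {x \<in> S. x \<bullet> u \<in> {lo..z}}" by (simp only: *)
  also have "\<dots> = (\<integral>\<^sup>+z'. ennreal (section_area u S z' * indicator {lo..z} z') \<partial>lborel)"
    by (subst emeasure_slices[OF u S_borel])
       (auto simp: emeasure_section intro!: nn_integral_cong split: split_indicator)
  finally have "((\<lambda>z'. section_area u S z' * indicator {lo..z} z') has_integral below u S z) UNIV"
    by (intro nn_integral_has_integral[OF m]) (auto simp: section_nonneg below_def)
  then have "((\<lambda>z'. if z' \<in> {lo..z} then section_area u S z' else 0) has_integral below u S z) UNIV"
    by (rule has_integral_eq[rotated]) auto
  then show ?thesis by (simp only: has_integral_restrict_UNIV)
qed

lemma DERIV_below:
  assumes "z \<in> {lo<..<hi}"
  shows "(below u S has_real_derivative section_area u S z) (at z)"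
proof -
  have "((\<lambda>z. integral {lo..z} (section_area u S)) has_real_derivative section_area u S z) (at z within {lo..hi})"
    using assms by (intro integral_has_real_derivative continuous_section) auto
  then have "((\<lambda>z. integral {lo..z} (section_area u S)) has_real_derivative section_area u S z) (at z)"
    using assms by (simp add: at_within_Icc_at)
  then show ?thesis
    by (rule DERIV_cong_ev[THEN iffD1, OF refl _ refl, rotated])
       (use eventually_nhds_in_open[of "{lo<..<hi}" z] assms below_eq_integral in
         \<open>auto elim!: eventually_mono intro!: integral_unique\<close>)
qed

lemma continuous_below: "continuous_on UNIV (below u S)"
  unfolding below_def[abs_def] by (rule continuous_measure_halfspace[OF u S_bdd S_borel])

lemma below_lo: "below u S lo = 0" 
proof -
  have "(section_area u S has_integral below u S lo) {lo}"
    using below_eq_integral[of lo] lo_less hi_greater by simp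
  then show ?thesis using has_integral_unique has_integral_refl(2) by blast
qed

lemma below_hi: "below u S hi = measure lborel S"
proof -
  have "S \<inter> {x. x \<bullet> u \<le> hi} = S" using inner_bounds by auto
  then show ?thesis by (simp add: below_def)
qed

lemma below_strict_mono:
  assumes "x \<in> {lo..hi}" "y \<in> {lo..hi}" "x < y"
  shows "below u S x < below u S y"
  using assms by (intro DERIV_pos_imp_increasing_open[OF assms(3)] continuous_on_subset[OF continuous_below])
    (auto intro!: DERIV_below section_pos exI)

end

section \<open>Matching the sections of a body and of its reflection\<close>

lemma supp_uminus_image: "supp (uminus ` P) w = supp P (- w)"
  by (simp add: supp_def image_image)

lemma measure_uminus_image:
  fixes S :: "'a::euclidean_space set"
  assumes "compact S"
  shows "measure lborel (uminus ` S) = measure lborel S"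
  using measure_affine[OF assms, of "-1" 0] by simp

lemma section_area_uminus:
  assumes u: "norm u = 1" and P: "compact P"
  shows "section_area u (uminus ` P) z = section_area u P (- z)"
proof -
  have uu: "u \<bullet> u = 1" using u by (simp add: dot_square_norm)
  have e: "level_proj u z (u - x) = - level_proj u (- z) x" for x z
    using uu by (simp add: level_proj_def inner_diff_left algebra_simps)
  have "prism u z (uminus ` P) = (\<lambda>x. (-1) *\<^sub>R x + u) ` prism u (- z) P"
  proof (intro equalityI subsetI)
    fix x assume "x \<in> prism u z (uminus ` P)"
    then obtain y where x: "x \<in> slab u" "y \<in> P" "level_proj u z x = - y" by (auto simp: prism_def)
    have "level_proj u (- z) (u - x) = - level_proj u z x" using e[of "-z" x] by simp
    then have "u - x \<in> prism u (- z) P" using x uu by (auto simp: prism_def slab_def inner_diff_left)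
    then show "x \<in> (\<lambda>x. (-1) *\<^sub>R x + u) ` prism u (- z) P" by (intro image_eqI[of _ _ "u - x"]) auto
  next
    fix x assume "x \<in> (\<lambda>x. (-1) *\<^sub>R x + u) ` prism u (- z) P"
    then obtain y where y: "y \<in> slab u" "level_proj u (- z) y \<in> P" "x = u - y" by (auto simp: prism_def)
    then show "x \<in> prism u z (uminus ` P)"
      using e[of z y] uu by (auto simp: prism_def slab_def inner_diff_left)
  qed
  then show ?thesis
    unfolding section_area_def using measure_affine[OF compact_prism[OF u P], of "-1" u "- z"] by simp
qed

text \<open>The quantile function of the volume distribution along \<open>u\<close>, which exists
  because positive section areas make \<open>below\<close> strictly increasing.\<close>

lemma (in convex_body) below_inverse:
  obtains g where "continuous_on {0..measure lborel S} g"
    "\<And>t. t \<in> {0<..<measure lborel S} \<Longrightarrow> g t \<in> {lo<..<hi} \<and> below u S (g t) = t"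
    "\<And>y. y \<in> {lo..hi} \<Longrightarrow> g (below u S y) = y"
proof -
  let ?B = "below u S" and ?g = "inv_into {lo..hi} (below u S)"
  have lh: "lo < hi" using lo_less hi_greater by linarith
  have inj: "inj_on ?B {lo..hi}"
    by (rule linorder_inj_onI') (use below_strict_mono in fastforce)
  have g: "?g (?B y) = y" if "y \<in> {lo..hi}" for y using inv_into_f_f[OF inj that] .
  have img: "?B ` {lo..hi} = {0..measure lborel S}"
  proof (intro equalityI subsetI)
    fix t assume "t \<in> ?B ` {lo..hi}"
    then obtain y where y: "y \<in> {lo..hi}" "t = ?B y" by auto
    have "?B lo \<le> ?B y" using below_strict_mono[of lo y] y lh by (cases "lo = y") auto
    moreover have "?B y \<le> ?B hi" using below_strict_mono[of y hi] y lh by (cases "hi = y") auto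
    ultimately show "t \<in> {0..measure lborel S}" using y by (simp add: below_lo below_hi)
  next
    fix t assume "t \<in> {0..measure lborel S}"
    then have "\<exists>y. lo \<le> y \<and> y \<le> hi \<and> ?B y = t"
      using lh by (intro IVT' continuous_on_subset[OF continuous_below]) (auto simp: below_lo below_hi)
    then show "t \<in> ?B ` {lo..hi}" by auto
  qed
  have "continuous_on (?B ` {lo..hi}) ?g"
    by (rule continuous_on_inv) (use g in \<open>auto intro: continuous_on_subset[OF continuous_below]\<close>)
  then have c: "continuous_on {0..measure lborel S} ?g" unfolding img .
  have r: "?g t \<in> {lo<..<hi} \<and> ?B (?g t) = t" if t: "t \<in> {0<..<measure lborel S}" for t
  proof -
    have "t \<in> ?B ` {lo..hi}" unfolding img using t by auto
    then obtain y where y: "y \<in> {lo..hi}" "t = ?B y" by auto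
    then have "y \<noteq> lo" "y \<noteq> hi" using t by (auto simp: below_lo below_hi)
    then show ?thesis using y g by auto
  qed
  show ?thesis by (rule that[OF c r g])
qed

text \<open>Both intervals have length \<open>h + b\<close>, so a translation taking one into the
  other must match their endpoints.\<close>

lemma interval_shift_unique:
  fixes b h c :: real
  assumes "- b < h" and T: "\<And>x. x \<in> {- b<..<h} \<Longrightarrow> x + c \<in> {- h<..<b}"
  shows "c = b - h"
proof (rule antisym)
  have m: "- b < (h - b) / 2" "(h - b) / 2 < h" using assms(1) by (auto simp: field_simps)
  show "c \<le> b - h"
  proof (rule ccontr)
    assume "\<not> c \<le> b - h"
    then have "max ((h - b) / 2) (b - c) \<in> {- b<..<h}" using m by (auto simp: less_max_iff_disj)
    from T[OF this] have "max ((h - b) / 2) (b - c) + c < b" by simp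
    moreover have "b - c \<le> max ((h - b) / 2) (b - c)" by simp
    ultimately show False by linarith
  qed
  show "b - h \<le> c"
  proof (rule ccontr)
    assume "\<not> b - h \<le> c"
    then have "min ((h - b) / 2) (- h - c) \<in> {- b<..<h}" using m by (auto simp: min_less_iff_disj)
    from T[OF this] have "- h < min ((h - b) / 2) (- h - c) + c" by simp
    moreover have "min ((h - b) / 2) (- h - c) \<le> - h - c" by simp
    ultimately show False by linarith
  qed
qed

context balanced_polytope
begin

text \<open>Let \<open>T\<close> match the levels at which \<open>P\<close> and \<open>- P\<close> are cut in the same proportion. Since the
  Brunn-Minkowski inequality for \<open>P\<close> and \<open>- P\<close> is an equality, it is one for both parts of the cut,
  and this forces matched sections to have equal area, hence \<open>T' = 1\<close>.\<close>
lemma section_symmetric: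
  assumes u: "norm u = 1" and z: "z \<in> {- supp P (- u)<..<supp P u}"
  shows "section_area u P z = section_area u P (supp P u - supp P (- u) - z)"
proof -
  define Q where "Q = uminus ` P"
  define K where "K = reflected_sum P (1 / 2)"
  define V where "V = measure lborel P"
  have cQ: "compact Q" "convex Q" unfolding Q_def using cP conv by (auto intro: compact_negations convex_negations)
  have cK: "compact K" "convex K" unfolding K_def using cP conv by (auto intro: compact_reflected_sum convex_reflected_sum)
  have "- p \<in> interior Q" unfolding Q_def interior_negations using p by auto
  moreover have "0 \<in> interior K"
  proof -
    obtain e where e: "e > 0" "ball p e \<subseteq> P" using p by (auto simp: mem_interior)
    have "ball 0 (e / 2) \<subseteq> K"
    proof
      fix y :: 'a assume "y \<in> ball 0 (e / 2)"
      then have "p + 2 *\<^sub>R y \<in> P" using e by (auto simp: dist_norm)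
      from reflected_sumI[OF this p_P, of "1 / 2"] show "y \<in> K"
        by (simp add: K_def scaleR_right_distrib)
    qed
    then show ?thesis using e by (auto simp: mem_interior intro!: exI[of _ "e / 2"])
  qed
  ultimately interpret Pb: convex_body u P p + Qb: convex_body u Q "- p" + Kb: convex_body u K 0
    using u cP conv p cQ cK by unfold_locales auto
  have VQ: "measure lborel Q = V" unfolding Q_def V_def by (rule measure_uminus_image[OF cP])
  have VK: "measure lborel K \<le> V" unfolding K_def V_def by (rule measure_reflected_sum_le)
  have sQ: "supp Q u = supp P (- u)" "supp Q (- u) = supp P u" by (simp_all add: Q_def supp_uminus_image)
  let ?h = "supp P u" and ?b = "supp P (- u)"
  have mid: "(1/2) *\<^sub>R (x + y) \<in> K" if "x \<in> P" "y \<in> Q" for x y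
    using that reflected_sumI[of x P "- y" "1 / 2"] by (auto simp: K_def Q_def scaleR_right_distrib)
  \<comment> \<open>Guarantees that the midpoint of two matched levels is strictly between the
    extreme levels of \<open>K\<close>, where \<open>below u K\<close> is differentiable.\<close>
  have hK: "(?h + ?b) / 2 \<le> supp K u" "(?h + ?b) / 2 \<le> supp K (- u)"
  proof -
    obtain x where x: "x \<in> P" "x \<bullet> u = ?h" using supp_attained[OF cP P_ne, of u] by metis
    obtain y where y: "y \<in> P" "y \<bullet> - u = ?b" using supp_attained[OF cP P_ne, of "- u"] by metis
    have yu: "y \<bullet> u = - ?b" using y(2) by simp
    have "(1/2) *\<^sub>R (x + - y) \<in> K" "(1/2) *\<^sub>R (y + - x) \<in> K" using x y mid[of x "- y"] mid[of y "- x"] by (auto simp: Q_def)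
    note k = supp_upper[OF cK(1) this(1), of u] supp_upper[OF cK(1) this(2), of "- u"]
    have "((1/2) *\<^sub>R (x + - y)) \<bullet> u = (?h + ?b) / 2" "((1/2) *\<^sub>R (y + - x)) \<bullet> (- u) = (?h + ?b) / 2"
      using x(2) yu by (simp_all add: inner_diff_left field_simps)
    then show "(?h + ?b) / 2 \<le> supp K u" "(?h + ?b) / 2 \<le> supp K (- u)"
      using k by (simp_all only:)
  qed
  obtain g where g: "continuous_on {0..V} g"
    "\<And>t. t \<in> {0<..<V} \<Longrightarrow> g t \<in> {- ?h<..<?b} \<and> below u Q (g t) = t"
    "\<And>y. y \<in> {- ?h..?b} \<Longrightarrow> g (below u Q y) = y"
    using Qb.below_inverse unfolding VQ sQ by metis
  have range: "below u P x \<in> {0<..<V}" if "x \<in> {- ?b<..<?h}" for x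
    using Pb.below_strict_mono[of "- ?b" x] Pb.below_strict_mono[of x ?h] that
    by (auto simp: Pb.below_lo Pb.below_hi V_def)
  define T where "T x = g (below u P x)" for x
  have Tin: "T x \<in> {- ?h<..<?b}" "below u Q (T x) = below u P x" if "x \<in> {- ?b<..<?h}" for x
    using g(2)[OF range[OF that]] by (auto simp: T_def)
  have dg: "(g has_real_derivative inverse (section_area u Q (g t))) (at t)" if t: "t \<in> {0<..<V}" for t
  proof (rule DERIV_inverse_function)
    show "(below u Q has_real_derivative section_area u Q (g t)) (at (g t))"
      using g(2)[OF t] by (intro Qb.DERIV_below) (simp add: sQ)
    have "0 < section_area u Q (g t)" using g(2)[OF t] by (intro Qb.section_pos) (simp add: sQ)
    then show "section_area u Q (g t) \<noteq> 0" by simp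
    show "0 < t" "t < V" using t by auto
    show "below u Q (g y) = y" if "0 < y" "y < V" for y using g(2)[of y] that by auto
    show "isCont g t" using g(1) t by (simp add: continuous_on_interior)
  qed
  have dT: "(T has_real_derivative section_area u P x / section_area u Q (T x)) (at x)" if x: "x \<in> {- ?b<..<?h}" for x
  proof -
    have "((\<lambda>x. g (below u P x)) has_real_derivative inverse (section_area u Q (g (below u P x))) * section_area u P x) (at x)"
      by (rule DERIV_chain2[where f = g and g = "below u P", OF dg[OF range[OF x]]]) (use x in \<open>intro Pb.DERIV_below, simp\<close>)
    then show ?thesis unfolding T_def[abs_def] by (simp add: field_simps)
  qed
  \<comment> \<open>The midpoints of the two lower parts lie in the lower part of \<open>K\<close>,
    and likewise for the upper parts. Since matched parts have equal volume, the two inequalities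
    add up to the volume of \<open>P\<close>, and \<open>K\<close> has no more; so both are
    equalities.\<close>
  have bK: "below u K ((x + T x) / 2) = below u P x" if x: "x \<in> {- ?b<..<?h}" for x
  proof -
    let ?k = "(x + T x) / 2"
    have ge: "measure lborel (S \<inter> {y. y \<bullet> u \<ge> c}) = measure lborel S - measure lborel (S \<inter> {y. y \<bullet> u \<le> c})"
      if "compact S" for S :: "'a set" and c
      using measure_halfspace_split[of u S c, OF Pb.u_ne compact_imp_bounded[OF that] borel_compact[OF that]] by linarith
    have hs: "closed {y. y \<bullet> u \<le> c}" "closed {y. y \<bullet> u \<ge> c}" "convex {y. y \<bullet> u \<le> c}" "convex {y. y \<bullet> u \<ge> c}" for c
      using convex_halfspace_le[where a = u and b = c] convex_halfspace_ge[where a = u and b = c]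
      by (auto intro!: closed_Collect_le continuous_intros simp: inner_commute)
    have "sqrt (below u P x * below u Q (T x)) \<le> below u K ?k"
      unfolding below_def
    proof (rule brunn_minkowski_midpoint)
      fix a b assume "a \<in> P \<inter> {y. y \<bullet> u \<le> x}" "b \<in> Q \<inter> {y. y \<bullet> u \<le> T x}"
      then show "(1/2) *\<^sub>R (a + b) \<in> K \<inter> {y. y \<bullet> u \<le> ?k}" using mid[of a b] by (auto simp: inner_add_left)
    qed (intro convex_Int compact_Int_closed hs cP conv cQ cK)+
    then have 1: "below u P x \<le> below u K ?k" using Tin[OF x] range[OF x] by simp
    have "sqrt (measure lborel (P \<inter> {y. y \<bullet> u \<ge> x}) * measure lborel (Q \<inter> {y. y \<bullet> u \<ge> T x})) \<le> measure lborel (K \<inter> {y. y \<bullet> u \<ge> ?k})"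
    proof (rule brunn_minkowski_midpoint)
      fix a b assume "a \<in> P \<inter> {y. y \<bullet> u \<ge> x}" "b \<in> Q \<inter> {y. y \<bullet> u \<ge> T x}"
      then show "(1/2) *\<^sub>R (a + b) \<in> K \<inter> {y. y \<bullet> u \<ge> ?k}" using mid[of a b] by (auto simp: inner_add_left)
    qed (intro convex_Int compact_Int_closed hs cP conv cQ cK)+
    then have "sqrt ((V - below u P x) * (V - below u P x)) \<le> measure lborel K - below u K ?k"
      unfolding ge[OF cP] ge[OF cQ(1)] ge[OF cK(1)] below_def[symmetric] using Tin[OF x] by (simp add: VQ V_def)
    then have 2: "V - below u P x \<le> measure lborel K - below u K ?k" using range[OF x] by simp
    show ?thesis using 1 2 VK by linarith
  qed
  \<comment> \<open>Differentiating the previous identity gives \<open>k (1 + m / n) / 2 = m\<close>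
    for the section areas \<open>m\<close>, \<open>n\<close>, \<open>k\<close> of \<open>P\<close>,
    \<open>Q\<close>, \<open>K\<close>. Brunn-Minkowski for the prisms gives
    \<open>sqrt (m n) \<le> k\<close>, so the arithmetic mean of \<open>m\<close> and
    \<open>n\<close> is at most the geometric one.\<close>
  have eq: "section_area u P x = section_area u Q (T x)" if x: "x \<in> {- ?b<..<?h}" for x
  proof -
    let ?k = "(x + T x) / 2" and ?m = "section_area u P x" and ?n = "section_area u Q (T x)"
    have mn: "0 < ?m" "0 < ?n" using x Tin[OF x] by (auto intro!: Pb.section_pos Qb.section_pos simp: sQ)
    have k: "?k \<in> {- supp K (- u)<..<supp K u}" using x Tin[OF x] hK by auto
    have "((\<lambda>x. below u K ((x + T x) / 2)) has_real_derivative section_area u K ?k * ((1 + ?m / ?n) / 2)) (at x)"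
      by (rule DERIV_chain2[where f = "below u K" and g = "\<lambda>x. (x + T x) / 2", OF Kb.DERIV_below[OF k]]) (auto intro!: derivative_eq_intros dT x)
    moreover have "((\<lambda>x. below u K ((x + T x) / 2)) has_real_derivative ?m) (at x)"
      by (rule DERIV_cong_ev[THEN iffD1, OF refl _ refl Pb.DERIV_below])
         (use eventually_nhds_in_open[of "{- ?b<..<?h}" x] x bK in \<open>auto elim!: eventually_mono\<close>)
    ultimately have e: "section_area u K ?k * ((1 + ?m / ?n) / 2) = ?m" by (rule DERIV_unique)
    have "sqrt (?m * ?n) \<le> section_area u K ?k"
      unfolding section_area_def
    proof (rule brunn_minkowski_midpoint)
      fix a b assume ab: "a \<in> prism u x P" "b \<in> prism u (T x) Q"
      have "level_proj u ?k ((1/2) *\<^sub>R (a + b)) = (1/2) *\<^sub>R (level_proj u x a + level_proj u (T x) b)"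
        by (simp add: level_proj_def inner_add_left scaleR_right_distrib add_divide_distrib diff_divide_distrib algebra_simps)
      then show "(1/2) *\<^sub>R (a + b) \<in> prism u ?k K"
        using ab mid[of "level_proj u x a" "level_proj u (T x) b"] by (auto simp: prism_def slab_def inner_add_left)
    qed (use u cP conv cQ cK in \<open>auto intro: convex_prism compact_prism\<close>)
    then have "sqrt (?m * ?n) * ((1 + ?m / ?n) / 2) \<le> ?m" using e mn
      by (metis add_nonneg_nonneg divide_nonneg_nonneg less_imp_le mult_right_mono zero_le_numeral zero_le_one)
    then have a: "sqrt (?m * ?n) * (?m + ?n) \<le> 2 * (?m * ?n)" using mn by (simp add: field_simps)
    have s: "sqrt (?m * ?n) * sqrt (?m * ?n) = ?m * ?n" "0 < sqrt (?m * ?n)" using mn by auto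
    then have "sqrt (?m * ?n) * (?m + ?n) \<le> sqrt (?m * ?n) * (2 * sqrt (?m * ?n))" using a by (simp add: mult_ac)
    then have "?m + ?n \<le> 2 * sqrt (?m * ?n)" using s(2) by (simp only: mult_le_cancel_left_pos)
    then have "(sqrt ?m - sqrt ?n)\<^sup>2 \<le> 0" using mn by (simp add: power2_diff real_sqrt_mult)
    then have "sqrt ?m = sqrt ?n" by simp
    then show ?thesis by simp
  qed
  have "(T has_real_derivative 1) (at x within {- ?b<..<?h})" if "x \<in> {- ?b<..<?h}" for x
  proof -
    have "0 < section_area u P x" using that by (intro Pb.section_pos)
    then have "section_area u P x / section_area u Q (T x) = 1" using eq[OF that] by simp
    then show ?thesis using dT[OF that] by (metis has_field_derivative_at_within)
  qed
  then have "((\<lambda>x. T x - x) has_real_derivative 0) (at x within {- ?b<..<?h})" if "x \<in> {- ?b<..<?h}" for x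
    using that by (auto intro!: derivative_eq_intros)
  then have "\<exists>c. \<forall>x\<in>{- ?b<..<?h}. T x - x = c"
    by (intro has_field_derivative_zero_constant) auto
  then obtain c where c: "\<And>x. x \<in> {- ?b<..<?h} \<Longrightarrow> T x = x + c" by (metis diff_eq_eq add.commute)
  have nz: "- ?b < ?h" using z by auto
  have "c = ?b - ?h"
    by (rule interval_shift_unique[OF nz]) (use Tin(1) c in auto)
  then have "section_area u P z = section_area u Q (z + (?b - ?h))" using eq[OF z] c[OF z] by simp
  also have "\<dots> = section_area u P (?h - ?b - z)"
    unfolding Q_def section_area_uminus[OF u cP] by (simp add: algebra_simps)
  finally show ?thesis .
qed

end

section \<open>The centroid as centre of symmetry\<close>

context balanced_polytope
begin

text \<open>The section areas are symmetric about the level midway between the two supporting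
  hyperplanes, so the centroid has this level.\<close>

lemma first_moment:
  assumes u: "norm u = 1"
  shows "2 * ((\<integral>x. indicator P x *\<^sub>R x \<partial>lborel) \<bullet> u) = (supp P u - supp P (- u)) * measure lborel P"
proof -
  interpret Pb: convex_body u P p using u cP conv p by unfold_locales
  let ?h = "supp P u" and ?b = "supp P (- u)"
  let ?s = "\<lambda>z. emeasure lborel (prism u z P)"
  have mP [measurable]: "P \<in> sets borel" by (rule P_borel)
  have ms [measurable]: "?s \<in> borel_measurable borel"
    unfolding emeasure_prism[OF mP] by measurable
  have slices: "(\<integral>\<^sup>+x. ennreal (f (x \<bullet> u)) * indicator P x \<partial>lborel) = (\<integral>\<^sup>+z. ennreal (f z) * ?s z \<partial>lborel)"
    if [measurable]: "f \<in> borel_measurable borel" for f :: "real \<Rightarrow> real"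
  proof -
    have "(\<integral>\<^sup>+x. ennreal (f (x \<bullet> u)) * indicator P x \<partial>lborel) =
      (\<integral>\<^sup>+z. (\<integral>\<^sup>+x. indicator (slab u) x * (ennreal (f (level_proj u z x \<bullet> u)) * indicator P (level_proj u z x)) \<partial>lborel) \<partial>lborel)"
      by (rule nn_integral_slices[OF u]) measurable
    also have "\<dots> = (\<integral>\<^sup>+z. (\<integral>\<^sup>+x. ennreal (f z) * (indicator (slab u) x * indicator P (level_proj u z x)) \<partial>lborel) \<partial>lborel)"
      by (simp add: level_proj_inner[OF u] mult_ac)
    also have "\<dots> = (\<integral>\<^sup>+z. ennreal (f z) * ?s z \<partial>lborel)"
      unfolding emeasure_prism[OF mP] by (intro nn_integral_cong nn_integral_cmult) measurable
    finally show ?thesis .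
  qed
  have "(\<integral>\<^sup>+x. ennreal (?h - x \<bullet> u) * indicator P x \<partial>lborel) = (\<integral>\<^sup>+z. ennreal (?h - z) * ?s z \<partial>lborel)"
    by (rule slices) measurable
  also have "\<dots> = (\<integral>\<^sup>+z. ennreal (?h - - z) * ?s (- z) \<partial>lborel)"
    by (rule nn_integral_lborel_uminus[symmetric]) measurable
  also have "\<dots> = (\<integral>\<^sup>+z. ennreal (?h - - (z + (?b - ?h))) * ?s (- (z + (?b - ?h))) \<partial>lborel)"
    by (rule nn_integral_lborel_translate[symmetric]) measurable
  also have "\<dots> = (\<integral>\<^sup>+z. ennreal (z + ?b) * ?s z \<partial>lborel)"
  proof (rule nn_integral_cong_AE)
    have ae: "AE z in lborel. z \<noteq> - ?b \<and> z \<noteq> ?h"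
      using AE_lborel_singleton[of "- ?b"] AE_lborel_singleton[of ?h] by eventually_elim auto
    show "AE z in lborel. ennreal (?h - - (z + (?b - ?h))) * ?s (- (z + (?b - ?h))) = ennreal (z + ?b) * ?s z"
      using ae
    proof (rule eventually_mono)
      fix z assume z: "z \<noteq> - ?b \<and> z \<noteq> ?h"
      have "?s (?h - ?b - z) = ?s z"
      proof (cases "z \<in> {- ?b<..<?h}")
        case True
        then show ?thesis using section_symmetric[OF u True] by (simp add: Pb.emeasure_section)
      next
        case False
        then have "z \<notin> {- ?b..?h}" "?h - ?b - z \<notin> {- ?b..?h}" using z by auto
        then show ?thesis using Pb.prism_empty by simp
      qed
      then show "ennreal (?h - - (z + (?b - ?h))) * ?s (- (z + (?b - ?h))) = ennreal (z + ?b) * ?s z"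
        by (simp add: algebra_simps)
    qed
  qed
  also have "\<dots> = (\<integral>\<^sup>+x. ennreal (x \<bullet> u + ?b) * indicator P x \<partial>lborel)"
    by (rule slices[symmetric]) measurable
  finally have nn: "(\<integral>\<^sup>+x. ennreal (?h - x \<bullet> u) * indicator P x \<partial>lborel) = (\<integral>\<^sup>+x. ennreal (x \<bullet> u + ?b) * indicator P x \<partial>lborel)" .
  have int: "integrable lborel (\<lambda>x. indicator P x *\<^sub>R f x)" if "continuous_on P f" for f :: "'a \<Rightarrow> 'b::euclidean_space"
    using borel_integrable_compact[OF cP that] by (simp add: indicator_scaleR_eq_if)
  have eqn: "(\<integral>x. indicator P x *\<^sub>R f x \<partial>lborel) = enn2real (\<integral>\<^sup>+x. ennreal (f x) * indicator P x \<partial>lborel)"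
    if "\<And>x. x \<in> P \<Longrightarrow> 0 \<le> f x" "continuous_on P f" for f :: "'a \<Rightarrow> real"
  proof -
    have "(\<integral>x. indicator P x *\<^sub>R f x \<partial>lborel) = enn2real (\<integral>\<^sup>+x. ennreal (indicator P x *\<^sub>R f x) \<partial>lborel)"
      using int[OF that(2)] that(1) by (intro integral_eq_nn_integral) (auto simp: borel_measurable_integrable split: split_indicator)
    also have "(\<integral>\<^sup>+x. ennreal (indicator P x *\<^sub>R f x) \<partial>lborel) = (\<integral>\<^sup>+x. ennreal (f x) * indicator P x \<partial>lborel)"
      by (intro nn_integral_cong) (auto split: split_indicator)
    finally show ?thesis .
  qed
  have "(\<integral>x. indicator P x *\<^sub>R (?h - x \<bullet> u) \<partial>lborel) = (\<integral>x. indicator P x *\<^sub>R (x \<bullet> u + ?b) \<partial>lborel)"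
  proof -
    have "(\<integral>x. indicator P x *\<^sub>R (?h - x \<bullet> u) \<partial>lborel) = enn2real (\<integral>\<^sup>+x. ennreal (?h - x \<bullet> u) * indicator P x \<partial>lborel)"
      by (rule eqn) (use Pb.inner_bounds in \<open>auto intro!: continuous_intros\<close>)
    also have "\<dots> = (\<integral>x. indicator P x *\<^sub>R (x \<bullet> u + ?b) \<partial>lborel)"
      unfolding nn by (rule eqn[symmetric]) (use Pb.inner_bounds(1) in \<open>force intro!: continuous_intros\<close>)+
    finally show ?thesis .
  qed
  moreover have ii: "integrable lborel (\<lambda>x. indicator P x *\<^sub>R (x \<bullet> u))" by (intro int continuous_intros)
  moreover have ic: "integrable lborel (\<lambda>x. indicator P x *\<^sub>R (c::real))" for c by (intro int continuous_intros)
  moreover have "(\<integral>x. indicator P x *\<^sub>R (?h - x \<bullet> u) \<partial>lborel) = ?h * measure lborel P - (\<integral>x. indicator P x *\<^sub>R (x \<bullet> u) \<partial>lborel)"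
    unfolding scaleR_right_diff_distrib Bochner_Integration.integral_diff[OF ic ii] by (simp add: mult.commute)
  moreover have "(\<integral>x. indicator P x *\<^sub>R (x \<bullet> u + ?b) \<partial>lborel) = (\<integral>x. indicator P x *\<^sub>R (x \<bullet> u) \<partial>lborel) + ?b * measure lborel P"
    unfolding scaleR_right_distrib Bochner_Integration.integral_add[OF ii ic] by (simp add: mult.commute)
  moreover have "(\<integral>x. indicator P x *\<^sub>R (x \<bullet> u) \<partial>lborel) = (\<integral>x. indicator P x *\<^sub>R x \<partial>lborel) \<bullet> u"
    using integral_inner_left[of u lborel "\<lambda>x. indicator P x *\<^sub>R x"] int[of "\<lambda>x. x"] by simp
  ultimately show ?thesis by (simp add: algebra_simps)
qed

text \<open>The centroid is midway between the supporting hyperplanes for \<open>w\<close> and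
  \<open>- w\<close>, for every \<open>w\<close> in \<open>U\<close>. Reflection in it therefore
  exchanges the defining inequalities of \<open>P\<close>.\<close>

lemma symmetric: "centrally_symmetric P"
proof -
  define c where "c = (1 / measure lborel P) *\<^sub>R (\<integral>x. indicator P x *\<^sub>R x \<partial>lborel)"
  have c: "2 * (c \<bullet> w) = supp P w - supp P (- w)" if "w \<in> U" for w
    using first_moment[OF unit[OF that]] pos by (simp add: c_def field_simps)
  have in_P: "2 *\<^sub>R c - x \<in> P" if x: "x \<in> P" for x
  proof -
    have "(2 *\<^sub>R c - x) \<bullet> w \<le> supp P w" if "w \<in> U" for w
      using c[OF that] supp_upper[OF cP x, of "- w"] by (simp add: inner_diff_left)
    then show ?thesis using P_eq by blast
  qed
  have "(\<lambda>x. 2 *\<^sub>R c - x) ` P = P"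
  proof (intro equalityI subsetI)
    fix x assume "x \<in> P"
    then show "x \<in> (\<lambda>x. 2 *\<^sub>R c - x) ` P" using in_P[of x] by (intro image_eqI[of _ _ "2 *\<^sub>R c - x"]) auto
  qed (use in_P in auto)
  then show ?thesis unfolding centrally_symmetric_def by blast
qed

end

theorem centrally_symmetric_if_face_areas_symmetric:
  fixes P :: "'a::euclidean_space set"
  assumes P: "polytope P" "interior P \<noteq> {}"
    and a: "\<And>w. norm w = 1 \<Longrightarrow> face_area P (- w) = face_area P w"
  shows "centrally_symmetric P"
proof -
  obtain p where p: "p \<in> interior P" using P by auto
  then have "P \<noteq> {}" using interior_subset by auto
  obtain U where U: "finite U" "\<And>w. w \<in> U \<Longrightarrow> norm w = 1" "\<And>w. w \<in> U \<Longrightarrow> - w \<in> U"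
    "P = {x. \<forall>w\<in>U. x \<bullet> w \<le> supp P w}"
    using polytope_unit_normals[OF P(1) \<open>P \<noteq> {}\<close>] by blast
  interpret balanced_polytope U P p
  proof unfold_locales
    show "compact P" "convex P" using P(1) by (auto intro: polytope_imp_compact polytope_imp_convex)
    show "face_area P (- w) = face_area P w" if "w \<in> U" for w using a U(2)[OF that] by simp
  qed (fact U p)+
  show ?thesis by (rule symmetric)
qed

section \<open>Jumps of a convolution across a hyperplane\<close>

text \<open>Slower growth than any exponential. All rates \<open>e\<close> are required because
  \<open>e\<close> tends to 0 when face areas are compared.\<close>

definition tempered :: "'a::euclidean_space measure \<Rightarrow> bool" where
  "tempered \<mu> \<longleftrightarrow> sets \<mu> = sets borel \<and> (\<forall>e>0. (\<integral>\<^sup>+t. ennreal (exp (- e * norm t)) \<partial>\<mu>) < \<infinity>)"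

lemma sigma_finite_measure_balls:
  fixes \<mu> :: "'a::euclidean_space measure"
  assumes "sets \<mu> = sets borel" "\<And>n::nat. emeasure \<mu> (cball 0 (real n)) < \<infinity>"
  shows "sigma_finite_measure \<mu>"
proof
  have "\<Union>(range (\<lambda>n::nat. cball (0::'a) (real n))) = space \<mu>"
    using sets_eq_imp_space_eq[OF assms(1)] real_arch_simple by (auto simp: dist_norm)
  moreover have "a \<in> range (\<lambda>n::nat. cball (0::'a) (real n)) \<Longrightarrow> emeasure \<mu> a \<noteq> \<infinity>" for a
    using assms(2) by (auto simp: less_top)
  ultimately show "\<exists>A. countable A \<and> A \<subseteq> sets \<mu> \<and> \<Union>A = space \<mu> \<and> (\<forall>a\<in>A. emeasure \<mu> a \<noteq> \<infinity>)"
    using assms(1) by (intro exI[of _ "range (\<lambda>n::nat. cball (0::'a) (real n))"]) auto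
qed

lemma tempered_ball_finite:
  assumes "tempered \<mu>"
  shows "emeasure \<mu> (cball 0 r) < \<infinity>"
proof -
  have m: "sets \<mu> = sets borel" and f: "(\<integral>\<^sup>+t. ennreal (exp (- 1 * norm t)) \<partial>\<mu>) < \<infinity>"
    using assms unfolding tempered_def by (auto dest!: spec[of _ 1])
  have "emeasure \<mu> (cball 0 r) = (\<integral>\<^sup>+t. indicator (cball 0 r) t \<partial>\<mu>)"
    using m by simp
  also have "\<dots> \<le> (\<integral>\<^sup>+t. ennreal (exp r) * ennreal (exp (- 1 * norm t)) \<partial>\<mu>)"
    by (intro nn_integral_mono) (auto simp: ennreal_mult'[symmetric] exp_add[symmetric] split: split_indicator)
  also have "\<dots> = ennreal (exp r) * (\<integral>\<^sup>+t. ennreal (exp (- 1 * norm t)) \<partial>\<mu>)"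
    using m by (intro nn_integral_cmult) (simp add: measurable_cong_sets[OF m refl])
  also have "\<dots> < \<infinity>" using f by (simp add: ennreal_mult_less_top)
  finally show ?thesis .
qed

lemma tempered_sigma_finite:
  assumes "tempered \<mu>"
  shows "sigma_finite_measure \<mu>"
proof (rule sigma_finite_measure_balls)
  show "sets \<mu> = sets borel" using assms by (simp add: tempered_def)
qed (rule tempered_ball_finite[OF assms])

lemma emeasure_prism_cball_le:
  fixes u :: "'a::euclidean_space"
  assumes u: "norm u = 1"
  shows "emeasure lborel (prism u z (cball 0 r)) \<le> emeasure lborel (cball (0::'a) (2 * r + 1))"
proof (rule emeasure_mono)
  show "prism u z (cball 0 r) \<subseteq> cball 0 (2 * r + 1)"
  proof
    fix x assume x: "x \<in> prism u z (cball 0 r)"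
    then have p: "norm (level_proj u z x) \<le> r" and "x \<in> slab u" by (auto simp: prism_def)
    have "\<bar>z\<bar> \<le> norm (level_proj u z x)"
      using Cauchy_Schwarz_ineq2[of "level_proj u z x" u] u by (simp add: level_proj_inner)
    then show "x \<in> cball 0 (2 * r + 1)"
      using norm_level_proj_le[OF u \<open>x \<in> slab u\<close>, of z] p by simp
  qed
qed simp

text \<open>A null set has null slices at almost every level.\<close>

lemma AE_level_proj:
  fixes F G :: "'a::euclidean_space \<Rightarrow> ennreal"
  assumes u: "norm u = 1" and m[measurable]: "F \<in> borel_measurable borel" "G \<in> borel_measurable borel"
    and ae: "AE x in lborel. F x = G x"
  shows "AE z in lborel. AE x in lborel. x \<in> slab u \<longrightarrow> F (level_proj u z x) = G (level_proj u z x)"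
proof -
  define N where "N = {x \<in> space borel. F x \<noteq> G x}"
  have N [measurable]: "N \<in> sets borel" unfolding N_def by measurable
  have "AE x in lborel. x \<notin> N" using ae by (rule eventually_mono) (auto simp: N_def)
  then have "emeasure lborel N = 0" by (subst (asm) AE_iff_measurable[OF _ refl]) (auto simp: N_def)
  then have "(\<integral>\<^sup>+z. (\<integral>\<^sup>+x. indicator (slab u) x * indicator N (level_proj u z x) \<partial>lborel) \<partial>lborel) = (0::ennreal)"
    using nn_integral_slices[OF u, of "indicator N"] by simp
  then have "AE z in lborel. (\<integral>\<^sup>+x. indicator (slab u) x * indicator N (level_proj u z x) \<partial>lborel) = (0::ennreal)"
    by (subst (asm) nn_integral_0_iff_AE) (measurable)
  then show ?thesis
  proof (rule eventually_mono)
    fix z assume "(\<integral>\<^sup>+x. indicator (slab u) x * indicator N (level_proj u z x) \<partial>lborel) = (0::ennreal)"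
    then have "AE x in lborel. indicator (slab u) x * indicator N (level_proj u z x) = (0::ennreal)"
      by (subst (asm) nn_integral_0_iff_AE) (measurable)
    then show "AE x in lborel. x \<in> slab u \<longrightarrow> F (level_proj u z x) = G (level_proj u z x)"
      by (rule eventually_mono) (auto simp: N_def indicator_def split: if_splits)
  qed
qed

lemma AE_lborel_ex_interval:
  assumes "AE z in lborel. G z" "a < (b::real)"
  shows "\<exists>z\<in>{a<..<b}. G z"
proof (rule ccontr)
  assume c: "\<not> ?thesis"
  have "AE z in lborel. z \<notin> {a<..<b}" using assms(1) by (rule eventually_mono) (use c in auto)
  then have "{a<..<b} \<in> null_sets lborel" by (subst (asm) AE_iff_null_sets[symmetric]) auto
  then show False using assms(2) by (simp add: null_sets_def)
qed

text \<open>Convolution identities pass to slices only at almost every level, so one-sided limits at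
  \<open>c\<close> are taken along sequences of good levels.\<close>

lemma AE_lborel_sequence:
  assumes "AE z in lborel. G z"
  obtains zn where "\<And>n. G (zn n)" "\<And>n::nat. c < zn n" "\<And>n. zn n \<le> c + (1::real)" "zn \<longlonglongrightarrow> c"
proof -
  have "\<exists>z. G z \<and> c < z \<and> z < c + inverse (real (Suc n))" for n
    using AE_lborel_ex_interval[OF assms, of c "c + inverse (real (Suc n))"] by auto
  then obtain zn where zn: "\<And>n. G (zn n) \<and> c < zn n \<and> zn n < c + inverse (real (Suc n))" by metis
  have "(\<lambda>n. c + inverse (real (Suc n))) \<longlonglongrightarrow> c + 0"
    by (intro tendsto_intros LIMSEQ_inverse_real_of_nat)
  then have lim: "(\<lambda>n. c + inverse (real (Suc n))) \<longlonglongrightarrow> c" by simp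
  have "\<forall>n. c \<le> zn n" "\<forall>n. zn n \<le> c + inverse (real (Suc n))" using zn by (meson less_imp_le)+
  then have "zn \<longlonglongrightarrow> c"
    using tendsto_sandwich[OF always_eventually always_eventually tendsto_const lim, of zn] by blast
  moreover have "zn n \<le> c + 1" for n
  proof -
    have "inverse (real (Suc n)) \<le> 1" by (simp add: inverse_le_1_iff)
    then show ?thesis using zn[of n] by linarith
  qed
  moreover have "G (zn n)" "c < zn n" for n using zn[of n] by auto
  ultimately show ?thesis using that by blast
qed

lemma AE_lborel_sequence_left:
  assumes "AE z in lborel. G z"
  obtains zn where "\<And>n. G (zn n)" "\<And>n::nat. zn n < c" "\<And>n. c - (1::real) \<le> zn n" "zn \<longlonglongrightarrow> c"
proof -
  have "\<exists>z. G z \<and> z < c \<and> c - inverse (real (Suc n)) < z" for n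
    using AE_lborel_ex_interval[OF assms, of "c - inverse (real (Suc n))" c] by auto
  then obtain zn where zn: "\<And>n. G (zn n) \<and> zn n < c \<and> c - inverse (real (Suc n)) < zn n" by metis
  have "(\<lambda>n. c - inverse (real (Suc n))) \<longlonglongrightarrow> c - 0"
    by (intro tendsto_intros LIMSEQ_inverse_real_of_nat)
  then have lim: "(\<lambda>n. c - inverse (real (Suc n))) \<longlonglongrightarrow> c" by simp
  have "\<forall>n. zn n \<le> c" "\<forall>n. c - inverse (real (Suc n)) \<le> zn n" using zn by (meson less_imp_le)+
  then have "zn \<longlonglongrightarrow> c"
    using tendsto_sandwich[OF always_eventually always_eventually lim tendsto_const, of zn] by blast
  moreover have "c - 1 \<le> zn n" for n
  proof -
    have "inverse (real (Suc n)) \<le> 1" by (simp add: inverse_le_1_iff)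
    then show ?thesis using zn[of n] by linarith
  qed
  moreover have "G (zn n)" "zn n < c" for n using zn[of n] by auto
  ultimately show ?thesis using that by blast
qed

text \<open>\<open>\<psi>\<close> is a test function used on the hyperplane at level
  \<open>c\<close>; its decay makes sums over a tempered measure finite. It will be exp(-e |y|)
  itself for comparing total areas, and its restriction to a Borel set for localizing the
  balance.\<close>

locale jump =
  fixes u :: "'a::euclidean_space" and P :: "'a set" and \<mu> :: "'a measure" and \<psi> :: "'a \<Rightarrow> ennreal"
    and C e c :: real
  assumes u: "norm u = 1" and cP: "compact P" and convP: "convex P" and P_ne: "P \<noteq> {}"
    and \<mu>: "tempered \<mu>" and \<psi>_meas [measurable]: "\<psi> \<in> borel_measurable borel"
    and \<psi>_le: "\<And>y. \<psi> y \<le> ennreal (C * exp (- e * norm y))" and e: "e > 0" and C: "C \<ge> 0"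
begin

text \<open>\<open>weight z t\<close> is the slice of \<open>t + P\<close> at level \<open>z\<close>, weighted by \<open>\<psi>\<close> at level \<open>c\<close>. The tiles counted by
  \<open>top_mass\<close> and \<open>bottom_mass\<close> have their top and bottom face at level \<open>c\<close>; \<open>mass_above\<close> and
  \<open>mass_below\<close> are the limits of the total weight as \<open>z\<close> tends to \<open>c\<close> from above and from below.\<close>
definition weight :: "real \<Rightarrow> 'a \<Rightarrow> ennreal" where
  "weight z t = (\<integral>\<^sup>+x. indicator (slab u) x * (\<psi> (level_proj u c x) * indicator P (level_proj u z x - t)) \<partial>lborel)"

definition top_mass :: ennreal where
  "top_mass = (\<integral>\<^sup>+t. (if t \<bullet> u = c - supp P u then weight c t else 0) \<partial>\<mu>)"

definition bottom_mass :: ennreal where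
  "bottom_mass = (\<integral>\<^sup>+t. (if t \<bullet> u = c + supp P (- u) then weight c t else 0) \<partial>\<mu>)"

definition mass_above :: ennreal where
  "mass_above = (\<integral>\<^sup>+t. (if t \<bullet> u = c - supp P u then 0 else weight c t) \<partial>\<mu>)"

definition mass_below :: ennreal where
  "mass_below = (\<integral>\<^sup>+t. (if t \<bullet> u = c + supp P (- u) then 0 else weight c t) \<partial>\<mu>)"

lemma P_borel [measurable]: "P \<in> sets borel"
  using cP by (intro borel_compact)

lemma sets_\<mu> [measurable_cong]: "sets \<mu> = sets borel"
  using \<mu> by (simp add: tempered_def)

lemma weight_measurable [measurable]: "weight z \<in> borel_measurable borel"
  unfolding weight_def[abs_def] by measurable

lemma weight_level_measurable: "(\<lambda>t. if t \<bullet> u = d then weight z t else 0) \<in> borel_measurable borel"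
  "(\<lambda>t. if t \<bullet> u = d then 0 else weight z t) \<in> borel_measurable borel"
proof -
  have "closed {t. t \<bullet> u = d}" by (intro closed_Collect_eq continuous_intros)
  then have "{t \<in> space borel. t \<bullet> u = d} \<in> sets borel" by simp
  then show "(\<lambda>t. if t \<bullet> u = d then weight z t else 0) \<in> borel_measurable borel"
    "(\<lambda>t. if t \<bullet> u = d then 0 else weight z t) \<in> borel_measurable borel"
    by (auto intro!: measurable_If weight_measurable)
qed

text \<open>A dominating function for \<open>weight z t\<close> that does not depend on
  \<open>z\<close>: for \<open>z\<close> within distance 1 of \<open>c\<close>, a slice of the tile
  at \<open>t\<close> projects into a ball of radius \<open>R + 1\<close> around
  \<open>t\<close>.\<close>

definition dom :: "real \<Rightarrow> 'a \<Rightarrow> ennreal" where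
  "dom r t = (\<integral>\<^sup>+x. indicator (slab u) x * (\<psi> (level_proj u c x) * indicator (cball 0 r) (level_proj u c x - t)) \<partial>lborel)"

lemma dom_le:
  assumes r: "r \<ge> 0"
  shows "dom r t \<le> ennreal (C * exp (e * r)) * emeasure lborel (cball (0::'a) (2 * r + 1)) * ennreal (exp (- e * norm t))"
proof -
  have [measurable]: "cball (0::'a) r \<in> sets borel" by simp
  have "dom r t \<le> (\<integral>\<^sup>+x. ennreal (C * exp (e * r) * exp (- e * norm t)) *
      (indicator (slab u) x * indicator (cball 0 r) (level_proj u (c - t \<bullet> u) (x - t))) \<partial>lborel)"
    unfolding dom_def
  proof (rule nn_integral_mono)
    fix x
    have "\<psi> (level_proj u c x) \<le> ennreal (C * exp (e * r) * exp (- e * norm t))"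
      if "norm (level_proj u c x - t) \<le> r"
    proof -
      have "norm t \<le> norm (level_proj u c x) + r"
        using that norm_triangle_ineq4[of "level_proj u c x" "level_proj u c x - t"] by simp
      then have "e * norm t \<le> e * (norm (level_proj u c x) + r)" using e by (intro mult_left_mono) auto
      then have "- e * norm (level_proj u c x) \<le> e * r + - e * norm t" by (simp add: distrib_left)
      then have "C * exp (- e * norm (level_proj u c x)) \<le> C * (exp (e * r) * exp (- e * norm t))"
        using C unfolding exp_add[symmetric] by (intro mult_left_mono) auto
      then show ?thesis using \<psi>_le[of "level_proj u c x"] by (auto simp: mult.assoc intro: order_trans ennreal_leI)
    qed
    then show "indicator (slab u) x * (\<psi> (level_proj u c x) * indicator (cball 0 r) (level_proj u c x - t))
       \<le> ennreal (C * exp (e * r) * exp (- e * norm t)) *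
      (indicator (slab u) x * indicator (cball 0 r) (level_proj u (c - t \<bullet> u) (x - t)))"
      unfolding level_proj_minus[symmetric] by (auto split: split_indicator)
  qed
  also have "\<dots> = ennreal (C * exp (e * r) * exp (- e * norm t)) *
    (\<integral>\<^sup>+x. indicator (slab u) x * indicator (cball 0 r) (level_proj u (c - t \<bullet> u) (x - t)) \<partial>lborel)"
    by (rule nn_integral_cmult) measurable
  also have "(\<integral>\<^sup>+x. indicator (slab u) x * indicator (cball 0 r) (level_proj u (c - t \<bullet> u) (x - t)) \<partial>lborel)
    = emeasure lborel (prism u (c - t \<bullet> u) (cball (0::'a) r))"
    by (subst nn_integral_slab_translate[OF u]) (auto simp: emeasure_prism)
  also have "ennreal (C * exp (e * r) * exp (- e * norm t)) * \<dots> \<le>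
    ennreal (C * exp (e * r) * exp (- e * norm t)) * emeasure lborel (cball (0::'a) (2 * r + 1))"
    by (intro mult_left_mono emeasure_prism_cball_le u) auto
  finally show ?thesis using C by (simp add: ennreal_mult' mult_ac)
qed

lemma dom_finite: assumes "r \<ge> 0" shows "dom r t < \<infinity>"
  by (rule le_less_trans[OF dom_le[OF assms]])
     (use emeasure_bounded_finite[of "cball (0::'a) (2 * r + 1)"] in \<open>simp add: ennreal_mult_less_top\<close>)

lemma dom_measurable [measurable]: "dom r \<in> borel_measurable borel"
proof -
  have [measurable]: "cball (0::'a) r \<in> sets borel" by simp
  show ?thesis unfolding dom_def[abs_def] by measurable
qed

lemma dom_integral: assumes "r \<ge> 0" shows "(\<integral>\<^sup>+t. dom r t \<partial>\<mu>) < \<infinity>"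
proof -
  have "(\<integral>\<^sup>+t. dom r t \<partial>\<mu>) \<le> (\<integral>\<^sup>+t. ennreal (C * exp (e * r)) * emeasure lborel (cball (0::'a) (2 * r + 1)) * ennreal (exp (- e * norm t)) \<partial>\<mu>)"
    by (intro nn_integral_mono dom_le assms)
  also have "\<dots> = ennreal (C * exp (e * r)) * emeasure lborel (cball (0::'a) (2 * r + 1)) * (\<integral>\<^sup>+t. ennreal (exp (- e * norm t)) \<partial>\<mu>)"
    by (rule nn_integral_cmult) measurable
  also have "\<dots> < \<infinity>"
    using \<mu> e emeasure_bounded_finite[of "cball (0::'a) (2 * r + 1)"]
    by (auto simp: tempered_def ennreal_mult_less_top)
  finally show ?thesis .
qed

lemma radius: obtains R where "R \<ge> 0" "\<And>x. x \<in> P \<Longrightarrow> norm x \<le> R"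
proof -
  obtain R where "R > 0" "\<forall>x\<in>P. norm x \<le> R" using compact_imp_bounded[OF cP] unfolding bounded_pos by blast
  then show ?thesis using that[of R] by simp
qed

lemma integrand_le_dom:
  assumes R: "\<And>x. x \<in> P \<Longrightarrow> norm x \<le> R" and z: "\<bar>z - c\<bar> \<le> 1"
  shows "indicator P (level_proj u z x - t) \<le> (indicator (cball 0 (R + 1)) (level_proj u c x - t) :: ennreal)"
proof -
  have "norm (level_proj u c x - t) \<le> R + 1" if "level_proj u z x - t \<in> P"
  proof -
    have "level_proj u c x - t = (level_proj u z x - t) + (c - z) *\<^sub>R u"
      using level_proj_diff[of u c x z] by (simp add: algebra_simps)
    then have "norm (level_proj u c x - t) \<le> norm (level_proj u z x - t) + norm ((c - z) *\<^sub>R u)"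
      by (metis norm_triangle_ineq)
    then show ?thesis using R[OF that] z u by simp
  qed
  then show ?thesis by (auto split: split_indicator)
qed

lemma weight_le_dom:
  assumes R: "\<And>x. x \<in> P \<Longrightarrow> norm x \<le> R" and z: "\<bar>z - c\<bar> \<le> 1"
  shows "weight z t \<le> dom (R + 1) t"
  unfolding weight_def dom_def
proof (intro nn_integral_mono mult_left_mono)
  show "indicator P (level_proj u z x - t) \<le> (indicator (cball 0 (R + 1)) (level_proj u c x - t) :: ennreal)" for x
    using R z by (rule integrand_le_dom)
qed simp_all

lemma weight_outside:
  assumes "z \<notin> {- supp P (- u) + t \<bullet> u..supp P u + t \<bullet> u}"
  shows "weight z t = 0"
proof -
  have "level_proj u z x - t \<notin> P" for x
  proof
    assume "level_proj u z x - t \<in> P"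
    from supp_upper[OF cP this, of u] supp_lower[OF cP this, of u] show False
      using assms by (auto simp: inner_diff_left level_proj_inner[OF u])
  qed
  then show ?thesis by (simp add: weight_def)
qed

text \<open>Sections of a single tile vary continuously as long as the levels stay in its closed
  range; the jump comes only from tiles that are entered or left.\<close>

lemma weight_tendsto:
  assumes zn: "\<And>n. zn n \<in> {- supp P (- u) + t \<bullet> u..supp P u + t \<bullet> u}" "zn \<longlonglongrightarrow> c" "\<And>n. \<bar>zn n - c\<bar> \<le> 1"
  shows "(\<lambda>n. weight (zn n) t) \<longlonglongrightarrow> weight c t"
proof -
  obtain R where R: "R \<ge> 0" "\<And>x. x \<in> P \<Longrightarrow> norm x \<le> R" using radius by metis
  let ?P = "(+) t ` P"
  obtain a where a: "a \<in> P" "a \<bullet> u = - supp P (- u)" using supp_attained[OF cP P_ne, of "- u"] by (metis inner_minus_right minus_minus)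
  obtain b where b: "b \<in> P" "b \<bullet> u = supp P u" using supp_attained[OF cP P_ne, of u] by metis
  have ind: "indicator P (y - t) = (indicator ?P y :: ennreal)" for y
    by (auto simp: indicator_def image_iff)
  have "AE x in lborel. (\<lambda>n. indicator ?P (level_proj u (zn n) x) :: ennreal) \<longlonglongrightarrow> indicator ?P (level_proj u c x)"
  proof (rule AE_indicator_level_proj_tendsto[OF u])
    show "closed ?P" using cP by (intro closed_translation compact_imp_closed)
    show "convex ?P" using convP by (rule convex_translation)
    show "t + a \<in> ?P" "(t + a) \<bullet> u = - supp P (- u) + t \<bullet> u" using a by (auto simp: inner_add_left)
    show "t + b \<in> ?P" "(t + b) \<bullet> u = supp P u + t \<bullet> u" using b by (auto simp: inner_add_left)
  qed (use zn in auto)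
  then have ae: "AE x in lborel. (\<lambda>n. indicator P (level_proj u (zn n) x - t) :: ennreal) \<longlonglongrightarrow> indicator P (level_proj u c x - t)"
    unfolding ind .
  have [measurable]: "cball (0::'a) (R + 1) \<in> sets borel" by simp
  have fin: "\<psi> y < \<infinity>" for y using \<psi>_le[of y] by (auto elim: le_less_trans)
  show ?thesis
    unfolding weight_def
  proof (rule nn_integral_dominated_convergence[where w = "\<lambda>x. indicator (slab u) x * (\<psi> (level_proj u c x) * indicator (cball 0 (R + 1)) (level_proj u c x - t))"])
    show "AE x in lborel. indicator (slab u) x * (\<psi> (level_proj u c x) * indicator P (level_proj u (zn n) x - t))
      \<le> indicator (slab u) x * (\<psi> (level_proj u c x) * indicator (cball 0 (R + 1)) (level_proj u c x - t))" for n
      by (intro AE_I2 mult_left_mono integrand_le_dom[OF R(2) zn(3)]) auto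
    show "(\<integral>\<^sup>+x. indicator (slab u) x * (\<psi> (level_proj u c x) * indicator (cball 0 (R + 1)) (level_proj u c x - t)) \<partial>lborel) < \<infinity>"
      using dom_finite[of "R + 1" t] R(1) by (simp add: dom_def)
    show "AE x in lborel. (\<lambda>n. indicator (slab u) x * (\<psi> (level_proj u c x) * indicator P (level_proj u (zn n) x - t)))
      \<longlonglongrightarrow> indicator (slab u) x * (\<psi> (level_proj u c x) * indicator P (level_proj u c x - t))"
      using ae
    proof (rule eventually_mono)
      fix x assume "(\<lambda>n. indicator P (level_proj u (zn n) x - t) :: ennreal) \<longlonglongrightarrow> indicator P (level_proj u c x - t)"
      then show "(\<lambda>n. indicator (slab u) x * (\<psi> (level_proj u c x) * indicator P (level_proj u (zn n) x - t)))
      \<longlonglongrightarrow> indicator (slab u) x * (\<psi> (level_proj u c x) * indicator P (level_proj u c x - t))"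
        using fin[of "level_proj u c x"]
        by (intro ennreal_tendsto_cmult) (auto simp: ennreal_mult_less_top split: split_indicator)
    qed
  qed measurable
qed

text \<open>For each tile the levels are eventually all inside or all outside its range, so the
  weights converge to \<open>L t\<close>; domination by \<open>dom\<close> allows passing to the
  integral.\<close>

lemma mass_tendsto:
  assumes zn: "zn \<longlonglongrightarrow> c" "\<And>n. \<bar>zn n - c\<bar> \<le> 1" and [measurable]: "L \<in> borel_measurable borel"
    and L: "\<And>t. (\<forall>\<^sub>F n in sequentially. zn n \<in> {- supp P (- u) + t \<bullet> u..supp P u + t \<bullet> u}) \<and> L t = weight c t \<or>
      (\<forall>\<^sub>F n in sequentially. zn n \<notin> {- supp P (- u) + t \<bullet> u..supp P u + t \<bullet> u}) \<and> L t = 0"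
  shows "(\<lambda>n. \<integral>\<^sup>+t. weight (zn n) t \<partial>\<mu>) \<longlonglongrightarrow> (\<integral>\<^sup>+t. L t \<partial>\<mu>)"
proof -
  obtain R where R: "R \<ge> 0" "\<And>x. x \<in> P \<Longrightarrow> norm x \<le> R" using radius by metis
  have lim: "(\<lambda>n. weight (zn n) t) \<longlonglongrightarrow> L t" for t
  proof (cases "\<forall>\<^sub>F n in sequentially. zn n \<in> {- supp P (- u) + t \<bullet> u..supp P u + t \<bullet> u}")
    case True
    let ?I = "{- supp P (- u) + t \<bullet> u..supp P u + t \<bullet> u}"
    have "c \<in> ?I"
      by (rule Lim_in_closed_set[OF _ True _ zn(1)]) auto
    \<comment> \<open>Replaces the finitely many levels outside the range, which does not affect the
      limit.\<close>
    define yn where "yn n = (if zn n \<in> ?I then zn n else c)" for n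
    have ev: "\<forall>\<^sub>F n in sequentially. zn n = yn n" using True by (rule eventually_mono) (simp add: yn_def)
    have "yn \<longlonglongrightarrow> c" using zn(1) tendsto_cong[OF ev] by simp
    then have "(\<lambda>n. weight (yn n) t) \<longlonglongrightarrow> weight c t"
    proof (rule weight_tendsto[rotated])
      show "yn n \<in> ?I" "\<bar>yn n - c\<bar> \<le> 1" for n using \<open>c \<in> ?I\<close> zn(2)[of n] by (auto simp: yn_def)
    qed
    moreover have "\<forall>\<^sub>F n in sequentially. weight (yn n) t = weight (zn n) t" using ev by (rule eventually_mono) simp
    ultimately have "(\<lambda>n. weight (zn n) t) \<longlonglongrightarrow> weight c t" using tendsto_cong by fastforce
    moreover have "L t = weight c t"
    proof (rule ccontr)
      assume "L t \<noteq> weight c t"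
      then have "\<forall>\<^sub>F n in sequentially. zn n \<notin> ?I" using L[of t] by auto
      with True have "\<forall>\<^sub>F n in sequentially. False" by eventually_elim auto
      then show False by simp
    qed
    ultimately show ?thesis by simp
  next
    case False
    then have *: "\<forall>\<^sub>F n in sequentially. zn n \<notin> {- supp P (- u) + t \<bullet> u..supp P u + t \<bullet> u}" "L t = 0"
      using L[of t] by auto
    have "\<forall>\<^sub>F n in sequentially. weight (zn n) t = 0" using *(1) by (rule eventually_mono) (rule weight_outside)
    then show ?thesis unfolding *(2) by (rule tendsto_eventually)
  qed
  show ?thesis
  proof (rule nn_integral_dominated_convergence[where w = "dom (R + 1)"])
    show "AE t in \<mu>. weight (zn n) t \<le> dom (R + 1) t" for n
      by (intro AE_I2 weight_le_dom[OF R(2) zn(2)])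
    show "(\<integral>\<^sup>+t. dom (R + 1) t \<partial>\<mu>) < \<infinity>" using R by (intro dom_integral) auto
    show "AE t in \<mu>. (\<lambda>n. weight (zn n) t) \<longlonglongrightarrow> L t" using lim by auto
  qed measurable
qed

text \<open>From above, a tile with its top face at level \<open>c\<close> is missed by all
  \<open>zn n\<close> although \<open>c\<close> itself meets it; every other tile contributes its
  weight at \<open>c\<close>.\<close>

lemma mass_above_tendsto:
  assumes zn: "zn \<longlonglongrightarrow> c" "\<And>n. c < zn n" "\<And>n. zn n \<le> c + 1"
  shows "(\<lambda>n. \<integral>\<^sup>+t. weight (zn n) t \<partial>\<mu>) \<longlonglongrightarrow> mass_above"
  unfolding mass_above_def
proof (rule mass_tendsto[OF zn(1)])
  fix t
  let ?a = "- supp P (- u) + t \<bullet> u" and ?b = "supp P u + t \<bullet> u"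
  consider "?a \<le> c" "c < ?b" | "c < ?a" | "?b \<le> c" by linarith
  then show "(\<forall>\<^sub>F n in sequentially. zn n \<in> {?a..?b}) \<and> (if t \<bullet> u = c - supp P u then 0 else weight c t) = weight c t \<or>
      (\<forall>\<^sub>F n in sequentially. zn n \<notin> {?a..?b}) \<and> (if t \<bullet> u = c - supp P u then 0 else weight c t) = 0"
  proof cases
    case 1
    have "\<forall>\<^sub>F n in sequentially. zn n < ?b" using zn(1) 1(2) by (rule order_tendstoD)
    then have "\<forall>\<^sub>F n in sequentially. zn n \<in> {?a..?b}"
      by (rule eventually_mono) (use zn(2) 1(1) in \<open>auto intro: order_trans less_imp_le\<close>)
    then show ?thesis using 1 by auto
  next
    case 2
    have "\<forall>\<^sub>F n in sequentially. zn n < ?a" using zn(1) 2 by (rule order_tendstoD)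
    then have "\<forall>\<^sub>F n in sequentially. zn n \<notin> {?a..?b}" by (rule eventually_mono) auto
    then show ?thesis using 2 weight_outside[of c t] by auto
  next
    case 3
    then have "zn n \<notin> {?a..?b}" for n using zn(2)[of n] by auto
    then show ?thesis using 3 weight_outside[of c t] by (cases "?b = c") auto
  qed
next
  show "\<bar>zn n - c\<bar> \<le> 1" for n using zn(2,3)[of n] by simp
qed (rule weight_level_measurable)

lemma mass_below_tendsto:
  assumes zn: "zn \<longlonglongrightarrow> c" "\<And>n. zn n < c" "\<And>n. c - 1 \<le> zn n"
  shows "(\<lambda>n. \<integral>\<^sup>+t. weight (zn n) t \<partial>\<mu>) \<longlonglongrightarrow> mass_below"
  unfolding mass_below_def
proof (rule mass_tendsto[OF zn(1)])
  fix t
  let ?a = "- supp P (- u) + t \<bullet> u" and ?b = "supp P u + t \<bullet> u"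
  consider "?a < c" "c \<le> ?b" | "c \<le> ?a" | "?b < c" by linarith
  then show "(\<forall>\<^sub>F n in sequentially. zn n \<in> {?a..?b}) \<and> (if t \<bullet> u = c + supp P (- u) then 0 else weight c t) = weight c t \<or>
      (\<forall>\<^sub>F n in sequentially. zn n \<notin> {?a..?b}) \<and> (if t \<bullet> u = c + supp P (- u) then 0 else weight c t) = 0"
  proof cases
    case 1
    have "\<forall>\<^sub>F n in sequentially. ?a < zn n" using zn(1) 1(1) by (rule order_tendstoD)
    then have "\<forall>\<^sub>F n in sequentially. zn n \<in> {?a..?b}"
      by (rule eventually_mono) (use zn(2) 1(2) in \<open>auto intro: order_trans less_imp_le\<close>)
    then show ?thesis using 1 by auto
  next
    case 3
    have "\<forall>\<^sub>F n in sequentially. ?b < zn n" using zn(1) 3 by (rule order_tendstoD)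
    then have "\<forall>\<^sub>F n in sequentially. zn n \<notin> {?a..?b}" by (rule eventually_mono) auto
    then show ?thesis using 3 weight_outside[of c t] by auto
  next
    case 2
    then have "zn n \<notin> {?a..?b}" for n using zn(2)[of n] by auto
    then show ?thesis using 2 weight_outside[of c t] by (cases "?a = c") auto
  qed
next
  show "\<bar>zn n - c\<bar> \<le> 1" for n using zn(2,3)[of n] by simp
qed (rule weight_level_measurable)

text \<open>Both sides are the total weight at level \<open>c\<close> itself.\<close>

lemma mass_split: "mass_above + top_mass = mass_below + bottom_mass"
proof -
  have "mass_above + top_mass = (\<integral>\<^sup>+t. weight c t \<partial>\<mu>)"
    unfolding mass_above_def top_mass_def
    by (subst nn_integral_add[symmetric]) (auto intro!: nn_integral_cong weight_level_measurable simp: measurable_cong_sets[OF sets_\<mu> refl])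
  moreover have "mass_below + bottom_mass = (\<integral>\<^sup>+t. weight c t \<partial>\<mu>)"
    unfolding mass_below_def bottom_mass_def
    by (subst nn_integral_add[symmetric]) (auto intro!: nn_integral_cong weight_level_measurable simp: measurable_cong_sets[OF sets_\<mu> refl])
  ultimately show ?thesis by simp
qed

lemma mass_finite: "mass_above < \<infinity>" "mass_below < \<infinity>"
proof -
  obtain R where R: "R \<ge> 0" "\<And>x. x \<in> P \<Longrightarrow> norm x \<le> R" using radius by metis
  have "mass_above \<le> (\<integral>\<^sup>+t. dom (R + 1) t \<partial>\<mu>)" "mass_below \<le> (\<integral>\<^sup>+t. dom (R + 1) t \<partial>\<mu>)"
    unfolding mass_above_def mass_below_def using weight_le_dom[OF R(2), of c] by (auto intro!: nn_integral_mono)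
  then show "mass_above < \<infinity>" "mass_below < \<infinity>" using dom_integral[of "R + 1"] R(1) by auto
qed

lemma conv_measurable: "fun_measure_convolution (indicator P) \<mu> \<in> borel_measurable borel"
proof -
  interpret sigma_finite_measure \<mu> by (rule tempered_sigma_finite[OF \<mu>])
  show ?thesis unfolding fun_measure_convolution_def[abs_def] by measurable
qed

lemma integral_weight:
  "(\<integral>\<^sup>+t. weight z t \<partial>\<mu>) = (\<integral>\<^sup>+x. indicator (slab u) x * (\<psi> (level_proj u c x) *
     fun_measure_convolution (indicator P) \<mu> (level_proj u z x)) \<partial>lborel)"
proof -
  interpret M: sigma_finite_measure \<mu> by (rule tempered_sigma_finite[OF \<mu>])
  interpret pair_sigma_finite lborel \<mu> ..
  have "(\<integral>\<^sup>+t. weight z t \<partial>\<mu>) = (\<integral>\<^sup>+x. (\<integral>\<^sup>+t. indicator (slab u) x * (\<psi> (level_proj u c x) * indicator P (level_proj u z x - t)) \<partial>\<mu>) \<partial>lborel)"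
    unfolding weight_def by (rule Fubini') measurable
  also have "\<dots> = (\<integral>\<^sup>+x. indicator (slab u) x * (\<psi> (level_proj u c x) *
     fun_measure_convolution (indicator P) \<mu> (level_proj u z x)) \<partial>lborel)"
    unfolding fun_measure_convolution_def
    by (intro nn_integral_cong) (simp add: nn_integral_cmult flip: mult.assoc)
  finally show ?thesis .
qed

lemma AE_integral_weight:
  assumes [measurable]: "F \<in> borel_measurable borel" and ae: "AE x in lborel. fun_measure_convolution (indicator P) \<mu> x = F x"
  shows "AE z in lborel. (\<integral>\<^sup>+t. weight z t \<partial>\<mu>) = (\<integral>\<^sup>+x. indicator (slab u) x * (\<psi> (level_proj u c x) * F (level_proj u z x)) \<partial>lborel)"
  using AE_level_proj[OF u conv_measurable assms]
proof (rule eventually_mono)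
  fix z assume z: "AE x in lborel. x \<in> slab u \<longrightarrow> fun_measure_convolution (indicator P) \<mu> (level_proj u z x) = F (level_proj u z x)"
  show "(\<integral>\<^sup>+t. weight z t \<partial>\<mu>) = (\<integral>\<^sup>+x. indicator (slab u) x * (\<psi> (level_proj u c x) * F (level_proj u z x)) \<partial>lborel)"
    unfolding integral_weight
    by (intro nn_integral_cong_AE) (use z in \<open>auto elim!: eventually_mono split: split_indicator\<close>)
qed

text \<open>For the constant value 1 the weighted integral is the same at almost all levels, so the
  two one-sided limits agree and can be cancelled because they are finite.\<close>

lemma top_eq_bottom:
  assumes "AE x in lborel. fun_measure_convolution (indicator P) \<mu> x = 1"
  shows "top_mass = bottom_mass"
proof -
  have ae: "AE z in lborel. (\<integral>\<^sup>+t. weight z t \<partial>\<mu>) = (\<integral>\<^sup>+x. indicator (slab u) x * (\<psi> (level_proj u c x) * 1) \<partial>lborel)"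
    using AE_integral_weight[of "\<lambda>_. 1"] assms by simp
  obtain zn where zn: "\<And>n. (\<integral>\<^sup>+t. weight (zn n) t \<partial>\<mu>) = (\<integral>\<^sup>+x. indicator (slab u) x * (\<psi> (level_proj u c x) * 1) \<partial>lborel)"
    "\<And>n. c < zn n" "\<And>n. zn n \<le> c + 1" "zn \<longlonglongrightarrow> c"
    using AE_lborel_sequence[OF ae, of c] by metis
  obtain yn where yn: "\<And>n. (\<integral>\<^sup>+t. weight (yn n) t \<partial>\<mu>) = (\<integral>\<^sup>+x. indicator (slab u) x * (\<psi> (level_proj u c x) * 1) \<partial>lborel)"
    "\<And>n. yn n < c" "\<And>n. c - 1 \<le> yn n" "yn \<longlonglongrightarrow> c"
    using AE_lborel_sequence_left[OF ae, of c] by metis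
  have "mass_above = mass_below"
    using mass_above_tendsto[OF zn(4,2,3)] mass_below_tendsto[OF yn(4,2,3)] unfolding zn(1) yn(1)
    by (simp add: LIMSEQ_const_iff)
  then show ?thesis using mass_split mass_finite by (auto simp: ennreal_add_left_cancel)
qed

end

text \<open>Both convolutions have the same one-sided limits, hence the same jump at level
  \<open>c\<close>. The identity is arranged as sums because extended nonnegative values do not
  subtract well.\<close>

lemma jump_balance:
  fixes P Q :: "'a::euclidean_space set"
  assumes JP: "jump u P \<mu> \<psi> C e" and JQ: "jump u Q \<nu> \<psi> C e"
    and ae: "AE x in lborel. fun_measure_convolution (indicator P) \<mu> x = fun_measure_convolution (indicator Q) \<nu> x"
  shows "jump.top_mass u P \<mu> \<psi> c + jump.bottom_mass u Q \<nu> \<psi> c = jump.top_mass u Q \<nu> \<psi> c + jump.bottom_mass u P \<mu> \<psi> c"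
proof -
  interpret p: jump u P \<mu> \<psi> C e c by (rule JP)
  interpret q: jump u Q \<nu> \<psi> C e c by (rule JQ)
  have ae: "AE z in lborel. (\<integral>\<^sup>+t. p.weight z t \<partial>\<mu>) = (\<integral>\<^sup>+t. q.weight z t \<partial>\<nu>)"
    using p.AE_integral_weight[OF q.conv_measurable ae] by (simp add: q.integral_weight)
  obtain zn where zn: "\<And>n. (\<integral>\<^sup>+t. p.weight (zn n) t \<partial>\<mu>) = (\<integral>\<^sup>+t. q.weight (zn n) t \<partial>\<nu>)"
    "\<And>n. c < zn n" "\<And>n. zn n \<le> c + 1" "zn \<longlonglongrightarrow> c"
    using AE_lborel_sequence[OF ae, of c] by metis
  obtain yn where yn: "\<And>n. (\<integral>\<^sup>+t. p.weight (yn n) t \<partial>\<mu>) = (\<integral>\<^sup>+t. q.weight (yn n) t \<partial>\<nu>)"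
    "\<And>n. yn n < c" "\<And>n. c - 1 \<le> yn n" "yn \<longlonglongrightarrow> c"
    using AE_lborel_sequence_left[OF ae, of c] by metis
  have a: "p.mass_above = q.mass_above"
    using p.mass_above_tendsto[OF zn(4,2,3)] q.mass_above_tendsto[OF zn(4,2,3)] unfolding zn(1) by (rule LIMSEQ_unique)
  have b: "p.mass_below = q.mass_below"
    using p.mass_below_tendsto[OF yn(4,2,3)] q.mass_below_tendsto[OF yn(4,2,3)] unfolding yn(1) by (rule LIMSEQ_unique)
  have "(q.mass_above + q.mass_below) + (p.top_mass + q.bottom_mass) = (p.mass_above + p.top_mass) + (q.mass_below + q.bottom_mass)"
    unfolding a by (simp add: ac_simps)
  also have "\<dots> = (p.mass_below + p.bottom_mass) + (q.mass_above + q.top_mass)"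
    by (simp only: p.mass_split q.mass_split)
  also have "\<dots> = (q.mass_above + q.mass_below) + (q.top_mass + p.bottom_mass)"
    unfolding b by (simp add: ac_simps)
  finally show ?thesis using q.mass_finite by (auto simp: ennreal_add_left_cancel)
qed

section \<open>Weighted totals of opposite face areas over a group of levels\<close>

lemma section_area_bottom:
  assumes u: "norm u = 1" and P: "compact P"
  shows "section_area u P (- supp P (- u)) = face_area P (- u)"
proof -
  let ?z = "supp P (- u)"
  have uu: "u \<bullet> u = 1" using u by (simp add: dot_square_norm)
  have e: "level_proj (- u) z x = level_proj u (- z) x" for z and x :: 'a
    by (simp add: level_proj_def algebra_simps)
  have s: "level_proj u z (x + u) = level_proj u z x" for z x
    using level_proj_shift[OF u, of z x 1] by simp
  have "prism u (- ?z) P = (\<lambda>x. 1 *\<^sub>R x + u) ` prism (- u) ?z P"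
  proof (intro equalityI subsetI)
    fix x assume "x \<in> prism u (- ?z) P"
    then have "x - u \<in> prism (- u) ?z P"
      using s[of "- ?z" "x - u"] uu by (auto simp: prism_def slab_def e inner_diff_left)
    then show "x \<in> (\<lambda>x. 1 *\<^sub>R x + u) ` prism (- u) ?z P" by (intro image_eqI[of _ _ "x - u"]) auto
  next
    fix x assume "x \<in> (\<lambda>x. 1 *\<^sub>R x + u) ` prism (- u) ?z P"
    then show "x \<in> prism u (- ?z) P" using uu by (auto simp: prism_def slab_def e s inner_add_left)
  qed
  then show ?thesis
    unfolding section_area_def face_area_def
    using measure_affine[OF compact_prism[of "- u" P ?z], of 1 u] u P by simp
qed

definition level_mass :: "'a::euclidean_space \<Rightarrow> real \<Rightarrow> 'a measure \<Rightarrow> real \<Rightarrow> ennreal" where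
  "level_mass u e \<mu> s = (\<integral>\<^sup>+t. ennreal (exp (- e * norm t)) * indicator {t. t \<bullet> u = s} t \<partial>\<mu>)"

lemma level_set_borel [measurable]: "{t::'a::euclidean_space. t \<bullet> u = s} \<in> sets borel"
  by (intro borel_closed closed_Collect_eq continuous_intros)

text \<open>On a tile within distance \<open>R\<close> of its position \<open>t\<close>, the weight
  exp(-e |y|) differs from exp(-e |t|) by a factor between exp(-e R) and exp(e R). This replaces the
  weighted mass of a face by its area times the weighted mass of positions.\<close>

locale exp_jump = jump u P \<mu> "\<lambda>y. ennreal (exp (- e * norm y))" 1 e c
  for u :: "'a::euclidean_space" and P \<mu> e c +
  fixes R :: real
  assumes R: "\<And>x. x \<in> P \<Longrightarrow> norm x \<le> R"
begin

lemma exp_bounds: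
  assumes "norm (y - t) \<le> R"
  shows "exp (- e * norm y) \<le> exp (e * R) * exp (- e * norm t)"
    and "exp (- e * R) * exp (- e * norm t) \<le> exp (- e * norm y)"
proof -
  have "norm t \<le> norm y + R" "norm y \<le> norm t + R"
    using assms norm_triangle_ineq4[of y "y - t"] norm_triangle_ineq[of t "y - t"] by auto
  then have "e * norm t \<le> e * (norm y + R)" "e * norm y \<le> e * (norm t + R)" using e by (auto intro!: mult_left_mono)
  then show "exp (- e * norm y) \<le> exp (e * R) * exp (- e * norm t)"
    "exp (- e * R) * exp (- e * norm t) \<le> exp (- e * norm y)"
    unfolding exp_add[symmetric] by (auto simp: distrib_left)
qed

lemma section_integral:
  "(\<integral>\<^sup>+x. indicator (slab u) x * indicator P (level_proj u c x - t) \<partial>lborel) = ennreal (section_area u P (c - t \<bullet> u))"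
proof -
  have "(\<integral>\<^sup>+x. indicator (slab u) x * indicator P (level_proj u c x - t) \<partial>lborel) =
    (\<integral>\<^sup>+x. indicator (slab u) x * indicator P (level_proj u (c - t \<bullet> u) (x - t)) \<partial>lborel)"
    by (simp add: level_proj_minus)
  also have "\<dots> = emeasure lborel (prism u (c - t \<bullet> u) P)"
    by (subst nn_integral_slab_translate[OF u]) (auto simp: emeasure_prism)
  also have "\<dots> = ennreal (section_area u P (c - t \<bullet> u))"
    unfolding section_area_def by (intro emeasure_bounded_eq bounded_prism u compact_imp_bounded cP)
  finally show ?thesis .
qed

lemma weight_upper: "weight c t \<le> ennreal (exp (e * R)) * ennreal (section_area u P (c - t \<bullet> u)) * ennreal (exp (- e * norm t))"
proof -
  have "weight c t \<le> (\<integral>\<^sup>+x. (ennreal (exp (e * R)) * ennreal (exp (- e * norm t))) * (indicator (slab u) x * indicator P (level_proj u c x - t)) \<partial>lborel)"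
    unfolding weight_def
  proof (rule nn_integral_mono)
    fix x
    have "ennreal (exp (- e * norm (level_proj u c x))) \<le> ennreal (exp (e * R)) * ennreal (exp (- e * norm t))"
      if "level_proj u c x - t \<in> P"
      using exp_bounds(1)[OF R[OF that]] by (simp add: ennreal_mult'[symmetric])
    then show "indicator (slab u) x * (ennreal (exp (- e * norm (level_proj u c x))) * indicator P (level_proj u c x - t))
      \<le> (ennreal (exp (e * R)) * ennreal (exp (- e * norm t))) * (indicator (slab u) x * indicator P (level_proj u c x - t))"
      by (auto split: split_indicator)
  qed
  also have "\<dots> = (ennreal (exp (e * R)) * ennreal (exp (- e * norm t))) * ennreal (section_area u P (c - t \<bullet> u))"
    by (subst nn_integral_cmult) (auto simp: section_integral)
  finally show ?thesis by (simp add: mult_ac)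
qed

lemma weight_lower: "ennreal (exp (- e * R)) * ennreal (section_area u P (c - t \<bullet> u)) * ennreal (exp (- e * norm t)) \<le> weight c t"
proof -
  have "(ennreal (exp (- e * R)) * ennreal (exp (- e * norm t))) * ennreal (section_area u P (c - t \<bullet> u))
     = (\<integral>\<^sup>+x. (ennreal (exp (- e * R)) * ennreal (exp (- e * norm t))) * (indicator (slab u) x * indicator P (level_proj u c x - t)) \<partial>lborel)"
    by (subst nn_integral_cmult) (auto simp: section_integral)
  also have "\<dots> \<le> weight c t"
    unfolding weight_def
  proof (rule nn_integral_mono)
    fix x
    have "ennreal (exp (- e * R)) * ennreal (exp (- e * norm t)) \<le> ennreal (exp (- e * norm (level_proj u c x)))"
      if "level_proj u c x - t \<in> P"
      using exp_bounds(2)[OF R[OF that]] by (simp add: ennreal_mult'[symmetric])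
    then show "(ennreal (exp (- e * R)) * ennreal (exp (- e * norm t))) * (indicator (slab u) x * indicator P (level_proj u c x - t))
      \<le> indicator (slab u) x * (ennreal (exp (- e * norm (level_proj u c x))) * indicator P (level_proj u c x - t))"
      by (auto split: split_indicator)
  qed
  finally show ?thesis by (simp add: mult_ac)
qed

lemma level_bounds:
  "(\<integral>\<^sup>+t. (if t \<bullet> u = s then weight c t else 0) \<partial>\<mu>) \<le> ennreal (exp (e * R)) * ennreal (section_area u P (c - s)) * level_mass u e \<mu> s"
  "ennreal (exp (- e * R)) * ennreal (section_area u P (c - s)) * level_mass u e \<mu> s \<le> (\<integral>\<^sup>+t. (if t \<bullet> u = s then weight c t else 0) \<partial>\<mu>)"
proof -
  have m: "(\<lambda>t. ennreal (exp (- e * norm t)) * indicator {t. t \<bullet> u = s} t) \<in> borel_measurable \<mu>"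
    by measurable
  have "(\<integral>\<^sup>+t. (if t \<bullet> u = s then weight c t else 0) \<partial>\<mu>)
    \<le> (\<integral>\<^sup>+t. ennreal (exp (e * R)) * ennreal (section_area u P (c - s)) * (ennreal (exp (- e * norm t)) * indicator {t. t \<bullet> u = s} t) \<partial>\<mu>)"
    by (intro nn_integral_mono) (use weight_upper in \<open>auto simp: mult.assoc split: split_indicator\<close>)
  also have "\<dots> = ennreal (exp (e * R)) * ennreal (section_area u P (c - s)) * level_mass u e \<mu> s"
    unfolding level_mass_def by (rule nn_integral_cmult[OF m])
  finally show "(\<integral>\<^sup>+t. (if t \<bullet> u = s then weight c t else 0) \<partial>\<mu>) \<le> \<dots>" .
  have "ennreal (exp (- e * R)) * ennreal (section_area u P (c - s)) * level_mass u e \<mu> s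
    = (\<integral>\<^sup>+t. ennreal (exp (- e * R)) * ennreal (section_area u P (c - s)) * (ennreal (exp (- e * norm t)) * indicator {t. t \<bullet> u = s} t) \<partial>\<mu>)"
    unfolding level_mass_def by (rule nn_integral_cmult[OF m, symmetric])
  also have "\<dots> \<le> (\<integral>\<^sup>+t. (if t \<bullet> u = s then weight c t else 0) \<partial>\<mu>)"
    by (intro nn_integral_mono) (use weight_lower in \<open>auto simp: mult.assoc split: split_indicator\<close>)
  finally show "ennreal (exp (- e * R)) * ennreal (section_area u P (c - s)) * level_mass u e \<mu> s \<le> (\<integral>\<^sup>+t. (if t \<bullet> u = s then weight c t else 0) \<partial>\<mu>)" .
qed

lemma top_bounds:
  "top_mass \<le> ennreal (exp (e * R)) * ennreal (face_area P u) * level_mass u e \<mu> (c - supp P u)"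
  "ennreal (exp (- e * R)) * ennreal (face_area P u) * level_mass u e \<mu> (c - supp P u) \<le> top_mass"
proof -
  have "c - (c - supp P u) = supp P u" by simp
  then have "section_area u P (c - (c - supp P u)) = face_area P u" by (simp only: face_area_def section_area_def)
  note b = level_bounds[of "c - supp P u", unfolded this]
  show "top_mass \<le> ennreal (exp (e * R)) * ennreal (face_area P u) * level_mass u e \<mu> (c - supp P u)"
    unfolding top_mass_def by (rule b(1))
  show "ennreal (exp (- e * R)) * ennreal (face_area P u) * level_mass u e \<mu> (c - supp P u) \<le> top_mass"
    unfolding top_mass_def by (rule b(2))
qed

lemma bottom_bounds:
  "bottom_mass \<le> ennreal (exp (e * R)) * ennreal (face_area P (- u)) * level_mass u e \<mu> (c + supp P (- u))"
  "ennreal (exp (- e * R)) * ennreal (face_area P (- u)) * level_mass u e \<mu> (c + supp P (- u)) \<le> bottom_mass"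
proof -
  have "c - (c + supp P (- u)) = - supp P (- u)" by simp
  then have "section_area u P (c - (c + supp P (- u))) = face_area P (- u)" by (simp only: section_area_bottom[OF u cP])
  note b = level_bounds[of "c + supp P (- u)", unfolded this]
  show "bottom_mass \<le> ennreal (exp (e * R)) * ennreal (face_area P (- u)) * level_mass u e \<mu> (c + supp P (- u))"
    unfolding bottom_mass_def by (rule b(1))
  show "ennreal (exp (- e * R)) * ennreal (face_area P (- u)) * level_mass u e \<mu> (c + supp P (- u)) \<le> bottom_mass"
    unfolding bottom_mass_def by (rule b(2))
qed

end

definition lattice_mass :: "'a::euclidean_space \<Rightarrow> real \<Rightarrow> 'a measure \<Rightarrow> real set \<Rightarrow> ennreal" where
  "lattice_mass u e \<mu> L = (\<integral>\<^sup>+s. level_mass u e \<mu> s \<partial>count_space L)"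

lemma lattice_mass_shift:
  assumes "\<And>s. s \<in> L \<Longrightarrow> s + d \<in> L" "\<And>s. s \<in> L \<Longrightarrow> s - d \<in> L"
  shows "(\<integral>\<^sup>+s. level_mass u e \<mu> (s + d) \<partial>count_space L) = lattice_mass u e \<mu> L"
  unfolding lattice_mass_def
proof (rule nn_integral_bij_count_space)
  show "bij_betw (\<lambda>s. s + d) L L"
    by (rule bij_betw_byWitness[where f' = "\<lambda>s. s - d"]) (use assms in auto)
qed

text \<open>A position lies at one level only, so summing over levels counts it at most once;
  countability of \<open>L\<close> permits exchanging sum and integral.\<close>

lemma lattice_mass_finite:
  assumes \<mu>: "tempered \<mu>" and e: "e > 0" and L: "countable L"
  shows "lattice_mass u e \<mu> L < \<infinity>"
proof -
  have sets [measurable_cong]: "sets \<mu> = sets borel" using \<mu> by (simp add: tempered_def)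
  have "lattice_mass u e \<mu> L = (\<integral>\<^sup>+t. (\<integral>\<^sup>+s. ennreal (exp (- e * norm t)) * indicator {t. t \<bullet> u = s} t \<partial>count_space L) \<partial>\<mu>)"
    unfolding lattice_mass_def level_mass_def
    by (rule nn_integral_count_space_nn_integral[OF L, symmetric]) measurable
  also have "\<dots> \<le> (\<integral>\<^sup>+t. ennreal (exp (- e * norm t)) \<partial>\<mu>)"
  proof (rule nn_integral_mono)
    fix t
    have "(\<integral>\<^sup>+s. ennreal (exp (- e * norm t)) * indicator {t. t \<bullet> u = s} t \<partial>count_space L)
      = (\<integral>\<^sup>+s. ennreal (exp (- e * norm t)) * indicator ({t \<bullet> u} \<inter> L) s \<partial>count_space L)"
      by (intro nn_integral_cong) (auto split: split_indicator)
    also have "\<dots> = ennreal (exp (- e * norm t)) * emeasure (count_space L) ({t \<bullet> u} \<inter> L)"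
      by (rule nn_integral_cmult_indicator) simp
    also have "\<dots> \<le> ennreal (exp (- e * norm t)) * 1"
      by (intro mult_left_mono; cases "t \<bullet> u \<in> L") (auto simp: emeasure_count_space_finite)
    finally show "(\<integral>\<^sup>+s. ennreal (exp (- e * norm t)) * indicator {t. t \<bullet> u = s} t \<partial>count_space L) \<le> ennreal (exp (- e * norm t))"
      by simp
  qed
  also have "\<dots> < \<infinity>" using \<mu> e by (auto simp: tempered_def)
  finally show ?thesis .
qed

lemma lattice_mass_pos:
  assumes sets [measurable_cong]: "sets \<mu> = sets borel" and "0 < emeasure \<mu> {0}" "0 \<in> L"
  shows "0 < lattice_mass u e \<mu> L"
proof -
  have "emeasure \<mu> {0} = (\<integral>\<^sup>+t. indicator {0} t \<partial>\<mu>)" using sets by simp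
  also have "\<dots> \<le> level_mass u e \<mu> 0"
    unfolding level_mass_def by (intro nn_integral_mono) (auto split: split_indicator)
  also have "\<dots> = (\<integral>\<^sup>+s. level_mass u e \<mu> s * indicator {0} s \<partial>count_space L)"
    using assms(3) by (subst nn_integral_indicator_singleton) auto
  also have "\<dots> \<le> lattice_mass u e \<mu> L"
    unfolding lattice_mass_def by (intro nn_integral_mono) (auto split: split_indicator)
  finally show ?thesis using assms(2) by (rule less_le_trans[rotated])
qed

lemma ennreal_mult_le_cancel_real:
  assumes "ennreal x * M \<le> ennreal y * M" "0 < M" "M < \<infinity>" "0 \<le> y"
  shows "x \<le> y"
proof -
  obtain m where m: "M = ennreal m" "0 < m" using assms(2,3) by (cases M) auto
  have "ennreal (x * m) \<le> ennreal (y * m)"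
    using assms(1,4) m by (simp add: ennreal_mult'' less_imp_le)
  then show ?thesis using m assms(4) by (auto simp: ennreal_le_iff2 mult_le_cancel_right mult_le_0_iff)
qed

text \<open>Every translate of a facet is matched by translates of opposite facets. Summing over a
  countable group of levels with a slowly varying weight compares the total areas.\<close>
lemma face_area_le:
  fixes P :: "'a::euclidean_space set"
  assumes u: "norm u = 1" and P: "compact P" "convex P" "P \<noteq> {}" and \<mu>: "tempered \<mu>" and \<nu>: "tempered \<nu>"
    and pos: "0 < emeasure \<mu> {0}"
    and ae: "AE x in lborel. fun_measure_convolution (indicator P) \<mu> x = fun_measure_convolution (indicator (uminus ` P)) \<nu> x"
  shows "face_area P u \<le> face_area P (- u)"
proof -
  define Q where "Q = uminus ` P"
  let ?h = "supp P u" and ?b = "supp P (- u)"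
  \<comment> \<open>Faces at level \<open>c\<close> come from positions at levels
    \<open>c - ?h\<close>, \<open>c + ?h\<close>, \<open>c - ?b\<close> and \<open>c + ?b\<close>.
    The group generated by \<open>?h\<close> and \<open>?b\<close> is invariant under all four
    shifts, so each sum over \<open>c\<close> gives the same total mass.\<close>
  define L where "L = (\<lambda>(i::int, j::int). real_of_int i * ?h + real_of_int j * ?b) ` UNIV"
  have cL: "countable L" unfolding L_def by simp
  have L0: "0 \<in> L" unfolding L_def by (intro image_eqI[of _ _ "(0, 0)"]) auto
  have Lsh: "s + (real_of_int k * ?h + real_of_int l * ?b) \<in> L" if "s \<in> L" for s k l
  proof -
    obtain i j where "s = real_of_int i * ?h + real_of_int j * ?b" using \<open>s \<in> L\<close> by (auto simp: L_def)
    then have "s + (real_of_int k * ?h + real_of_int l * ?b) = real_of_int (i + k) * ?h + real_of_int (j + l) * ?b"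
      by (simp add: algebra_simps)
    then show ?thesis unfolding L_def by (intro image_eqI[of _ _ "(i + k, j + l)"]) auto
  qed
  have Lh: "s + ?h \<in> L" "s - ?h \<in> L" "s + ?b \<in> L" "s - ?b \<in> L" if "s \<in> L" for s
    using Lsh[OF that, of 1 0] Lsh[OF that, of "-1" 0] Lsh[OF that, of 0 1] Lsh[OF that, of 0 "-1"] by auto
  obtain R where R: "\<And>x. x \<in> P \<Longrightarrow> norm x \<le> R" using compact_imp_bounded[OF P(1)] by (auto simp: bounded_iff)
  have Q: "compact Q" "convex Q" "Q \<noteq> {}" unfolding Q_def using P by (auto intro: compact_negations convex_negations)
  have RQ: "\<And>x. x \<in> Q \<Longrightarrow> norm x \<le> R" using R by (auto simp: Q_def)
  have sQ: "supp Q u = ?b" "supp Q (- u) = ?h" by (simp_all add: Q_def supp_uminus_image)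
  have fQ: "face_area Q u = face_area P (- u)" "face_area Q (- u) = face_area P u"
    using section_area_uminus[OF u P(1), of ?b] section_area_bottom[OF u P(1)] section_area_bottom[OF u Q(1)]
      section_area_uminus[OF u P(1), of "- ?h"]
    by (simp_all add: face_area_def section_area_def sQ Q_def[symmetric])
  have "face_area P u \<le> exp (2 * e * R) * face_area P (- u)" if e: "e > 0" for e
  proof -
    have JP: "jump u P \<mu> (\<lambda>y. ennreal (exp (- e * norm y))) 1 e" using u P \<mu> e by unfold_locales auto
    have JQ: "jump u Q \<nu> (\<lambda>y. ennreal (exp (- e * norm y))) 1 e" using u Q \<nu> e by unfold_locales auto
    have EP: "exp_jump u P \<mu> e R" using JP R by (simp add: exp_jump_def exp_jump_axioms_def)
    have EQ: "exp_jump u Q \<nu> e R" using JQ RQ by (simp add: exp_jump_def exp_jump_axioms_def)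
    let ?A = "ennreal (exp (- e * R)) * ennreal (face_area P u)" and ?B = "ennreal (exp (e * R)) * ennreal (face_area P (- u))"
    \<comment> \<open>Top faces of copies of \<open>P\<close> and bottom faces of copies of
      \<open>- P\<close> have area \<open>face_area P u\<close>; the other two kinds have area
      \<open>face_area P (- u)\<close>. The jump balance equates the two groups.\<close>
    have bal: "?A * (level_mass u e \<mu> (c - ?h) + level_mass u e \<nu> (c + ?h)) \<le> ?B * (level_mass u e \<nu> (c - ?b) + level_mass u e \<mu> (c + ?b))" for c
    proof -
      interpret p: exp_jump u P \<mu> e c R by (rule EP)
      interpret q: exp_jump u Q \<nu> e c R by (rule EQ)
      have "?A * (level_mass u e \<mu> (c - ?h) + level_mass u e \<nu> (c + ?h)) \<le> p.top_mass + q.bottom_mass"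
        unfolding distrib_left using p.top_bounds(2) q.bottom_bounds(2) by (intro add_mono) (auto simp: sQ fQ)
      also have "\<dots> = q.top_mass + p.bottom_mass"
        by (rule jump_balance[OF JP JQ]) (use ae in \<open>simp add: Q_def\<close>)
      also have "\<dots> \<le> ?B * (level_mass u e \<nu> (c - ?b) + level_mass u e \<mu> (c + ?b))"
        unfolding distrib_left using q.top_bounds(1) p.bottom_bounds(1) by (intro add_mono) (auto simp: sQ fQ)
      finally show ?thesis .
    qed
    let ?M = "lattice_mass u e \<mu> L + lattice_mass u e \<nu> L"
    have sh: "(\<integral>\<^sup>+c. level_mass u e m (c - ?h) \<partial>count_space L) = lattice_mass u e m L"
      "(\<integral>\<^sup>+c. level_mass u e m (c + ?h) \<partial>count_space L) = lattice_mass u e m L"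
      "(\<integral>\<^sup>+c. level_mass u e m (c - ?b) \<partial>count_space L) = lattice_mass u e m L"
      "(\<integral>\<^sup>+c. level_mass u e m (c + ?b) \<partial>count_space L) = lattice_mass u e m L" for m
      using lattice_mass_shift[of L "- ?h" u e m] lattice_mass_shift[of L ?h u e m]
        lattice_mass_shift[of L "- ?b" u e m] lattice_mass_shift[of L ?b u e m] Lh by simp_all
    have "?A * ?M = (\<integral>\<^sup>+c. ?A * (level_mass u e \<mu> (c - ?h) + level_mass u e \<nu> (c + ?h)) \<partial>count_space L)"
      by (simp add: nn_integral_cmult nn_integral_add sh)
    also have "\<dots> \<le> (\<integral>\<^sup>+c. ?B * (level_mass u e \<nu> (c - ?b) + level_mass u e \<mu> (c + ?b)) \<partial>count_space L)"
      by (intro nn_integral_mono bal)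
    also have "\<dots> = ?B * ?M"
      by (simp add: nn_integral_cmult nn_integral_add sh add.commute)
    finally have le: "ennreal (exp (- e * R) * face_area P u) * ?M \<le> ennreal (exp (e * R) * face_area P (- u)) * ?M"
      by (simp add: ennreal_mult')
    \<comment> \<open>The atom at 0 lies at level 0, which belongs to \<open>L\<close>; so the
      common total mass is positive and may be cancelled.\<close>
    have M0: "0 < ?M" using lattice_mass_pos[OF _ pos L0, of u e] \<mu> by (auto simp: tempered_def intro: add_pos_nonneg)
    have M1: "?M < \<infinity>" using lattice_mass_finite[OF \<mu> e cL] lattice_mass_finite[OF \<nu> e cL] by simp
    have "exp (- e * R) * face_area P u \<le> exp (e * R) * face_area P (- u)"
      by (rule ennreal_mult_le_cancel_real[OF le M0 M1]) (simp add: face_area_def)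
    then have "exp (e * R) * (exp (- e * R) * face_area P u) \<le> exp (e * R) * (exp (e * R) * face_area P (- u))"
      by (intro mult_left_mono) auto
    moreover have "exp (e * R) * exp (- e * R) = 1" "exp (e * R) * exp (e * R) = exp (2 * e * R)"
      by (simp_all flip: exp_add)
    ultimately show ?thesis by (simp only: mult.assoc[symmetric] mult_1)
  qed
  then have ev: "\<forall>\<^sub>F e in at_right 0. face_area P u \<le> exp (2 * e * R) * face_area P (- u)"
    by (auto simp: eventually_at_right_field intro!: exI[of _ 1])
  have "((\<lambda>e. exp (2 * e * R) * face_area P (- u)) \<longlongrightarrow> exp (2 * 0 * R) * face_area P (- u)) (at_right 0)"
    by (intro tendsto_intros)
  then have "face_area P u \<le> exp (2 * 0 * R) * face_area P (- u)"
    using ev by (rule tendsto_lowerbound) simp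
  then show ?thesis by simp
qed

text \<open>The assumptions do not mention a direction, so the area inequality holds for
  \<open>w\<close> and for \<open>- w\<close>. The two measures may differ; only
  \<open>\<mu>\<close> is asked to have an atom.\<close>

theorem centrally_symmetric_if_balanced_convolutions:
  fixes P :: "'a::euclidean_space set"
  assumes P: "polytope P" "interior P \<noteq> {}" and \<mu>: "tempered \<mu>" and \<nu>: "tempered \<nu>"
    and pos: "0 < emeasure \<mu> {0}"
    and ae: "AE x in lborel. fun_measure_convolution (indicator P) \<mu> x = fun_measure_convolution (indicator (uminus ` P)) \<nu> x"
  shows "centrally_symmetric P"
proof (rule centrally_symmetric_if_face_areas_symmetric[OF P])
  fix w :: 'a assume w: "norm w = 1"
  have cP: "compact P" "convex P" "P \<noteq> {}"
    using P by (auto intro: polytope_imp_compact polytope_imp_convex)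
  have "face_area P w \<le> face_area P (- w)" by (rule face_area_le[OF w cP \<mu> \<nu> pos ae])
  moreover have "face_area P (- w) \<le> face_area P (- (- w))"
    using w by (intro face_area_le[OF _ cP \<mu> \<nu> pos ae]) simp
  ultimately show "face_area P (- w) = face_area P w" by simp
qed

section \<open>Weak tilings\<close>

lemma nn_integral_exp_norm_finite:
  assumes e: "e > 0"
  shows "(\<integral>\<^sup>+x. ennreal (exp (- e * norm (x::'a::euclidean_space))) \<partial>lborel) < \<infinity>"
proof -
  let ?d = "DIM('a)"
  define V where "V = unit_ball_vol (real ?d)"
  \<comment> \<open>Half of the exponential decay absorbs the volume of the balls:
    \<open>y \<le> exp y\<close> for \<open>y = e (n + 1) / (2 d)\<close> gives
    \<open>(n + 1) ^ d \<le> (2 d / e) ^ d * exp (e (n + 1) / 2)\<close>, and a geometric series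
    remains.\<close>
  define K where "K = V * ((2 * ?d / e) ^ ?d * exp (e / 2))"
  have V: "V \<ge> 0" by (simp add: V_def)
  have K: "K \<ge> 0" using V e by (simp add: K_def)
  have pw: "exp (- e * n) * (V * (n + 1) ^ ?d) \<le> K * exp (- e / 2) ^ n" for n :: nat
  proof -
    define y where "y = e * (n + 1) / (2 * ?d)"
    have "y ^ ?d \<le> exp y ^ ?d"
      using e by (intro power_mono order_trans[OF _ exp_ge_add_one_self]) (auto simp: y_def)
    also have "\<dots> = exp (e / 2 * (n + 1))" by (simp add: y_def flip: exp_of_nat_mult)
    finally have "(2 * ?d / e) ^ ?d * y ^ ?d \<le> (2 * ?d / e) ^ ?d * exp (e / 2 * (n + 1))"
      using e by (intro mult_left_mono) auto
    moreover have "(2 * ?d / e) ^ ?d * y ^ ?d = (n + 1) ^ ?d"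
    proof -
      have "(2 * ?d / e) * y = n + 1" using e by (simp add: y_def)
      then show ?thesis unfolding power_mult_distrib[symmetric] by simp
    qed
    ultimately have "exp (- e * n) * (V * (n + 1) ^ ?d) \<le> exp (- e * n) * (V * ((2 * ?d / e) ^ ?d * exp (e / 2 * (n + 1))))"
      using V by (intro mult_left_mono) auto
    also have "\<dots> = V * (2 * ?d / e) ^ ?d * (exp (- e * n) * exp (e / 2 * (n + 1)))" by simp
    also have "exp (- e * n) * exp (e / 2 * (n + 1)) = exp (e / 2) * exp (- e / 2) ^ n"
      unfolding exp_of_nat_mult[symmetric] exp_add[symmetric] by (simp add: field_simps)
    finally show ?thesis by (simp add: K_def mult_ac)
  qed
  have "(\<integral>\<^sup>+x. ennreal (exp (- e * norm (x::'a))) \<partial>lborel)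
    \<le> (\<integral>\<^sup>+x. (\<Sum>n. ennreal (exp (- e * real n)) * indicator (cball (0::'a) (real n + 1)) x) \<partial>lborel)"
  proof (rule nn_integral_mono)
    fix x :: 'a
    define n where "n = nat \<lfloor>norm x\<rfloor>"
    have n: "real n \<le> norm x" "norm x \<le> real n + 1" unfolding n_def by (auto simp: of_nat_nat)
    have "ennreal (exp (- e * norm x)) \<le> ennreal (exp (- e * real n)) * indicator (cball (0::'a) (real n + 1)) x"
    proof -
      have "e * real n \<le> e * norm x" using n e by (intro mult_left_mono) auto
      then have "ennreal (exp (- e * norm x)) \<le> ennreal (exp (- e * real n))" by (intro ennreal_leI) simp
      then show ?thesis using n(2) by simp
    qed
    also have "\<dots> \<le> (\<Sum>n. ennreal (exp (- e * real n)) * indicator (cball (0::'a) (real n + 1)) x)"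
    proof -
      have "g n \<le> suminf g" for g :: "nat \<Rightarrow> ennreal" using sum_le_suminf[of g "{n}"] by simp
      then show ?thesis .
    qed
    finally show "ennreal (exp (- e * norm x)) \<le> (\<Sum>n. ennreal (exp (- e * real n)) * indicator (cball (0::'a) (real n + 1)) x)" .
  qed
  also have "\<dots> = (\<Sum>n. ennreal (exp (- e * real n)) * emeasure lborel (cball (0::'a) (real n + 1)))"
  proof -
    have m: "(\<lambda>x. ennreal (exp (- e * real n)) * indicator (cball (0::'a) (real n + 1)) x) \<in> borel_measurable lborel" for n
    proof -
      have [measurable]: "cball (0::'a) (real n + 1) \<in> sets borel" by simp
      show ?thesis by measurable
    qed
    have "(\<integral>\<^sup>+x. ennreal (exp (- e * real n)) * indicator (cball (0::'a) (real n + 1)) x \<partial>lborel)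
      = ennreal (exp (- e * real n)) * emeasure lborel (cball (0::'a) (real n + 1))" for n
      by (rule nn_integral_cmult_indicator) simp
    then show ?thesis unfolding nn_integral_suminf[OF m] by (simp only:)
  qed
  also have "\<dots> \<le> (\<Sum>n. ennreal (K * exp (- e / 2) ^ n))"
  proof (rule suminf_le)
    fix n
    have "ennreal (exp (- e * real n)) * emeasure lborel (cball (0::'a) (real n + 1)) = ennreal (exp (- e * n) * (V * (n + 1) ^ ?d))"
      by (simp add: emeasure_cball V_def ennreal_mult' add.commute)
    also have "\<dots> \<le> ennreal (K * exp (- e / 2) ^ n)" by (rule ennreal_leI[OF pw])
    finally show "ennreal (exp (- e * real n)) * emeasure lborel (cball (0::'a) (real n + 1)) \<le> ennreal (K * exp (- e / 2) ^ n)" .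
  qed auto
  also have "\<dots> < \<infinity>"
  proof -
    have "summable (\<lambda>n. K * exp (- e / 2) ^ n)" using e by (intro summable_mult summable_geometric) auto
    then have "(\<Sum>n. ennreal (K * exp (- e / 2) ^ n)) \<noteq> top" using K by (intro ennreal_suminf_neq_top) auto
    then show ?thesis by (simp only: less_top infinity_ennreal_def)
  qed
  finally show ?thesis .
qed

section \<open>From a tiling of the complement to a covering measure with an atom\<close>

definition add_atom :: "'a::euclidean_space measure \<Rightarrow> 'a measure" where
  "add_atom \<nu> = measure_of UNIV (sets borel) (\<lambda>X. emeasure \<nu> X + indicator X 0)"

lemma sets_add_atom: "sets (add_atom \<nu>) = sets borel"
proof -
  have "sets (add_atom \<nu>) = sigma_sets UNIV (sets borel)"
    unfolding add_atom_def by (rule sets_measure_of) simp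
  then show ?thesis using sets.sigma_sets_eq[of "borel :: 'a measure"] by simp
qed

lemma emeasure_add_atom:
  assumes "sets \<nu> = sets borel" "X \<in> sets borel"
  shows "emeasure (add_atom \<nu>) X = emeasure \<nu> X + indicator X 0"
proof (rule emeasure_measure_of[OF add_atom_def])
  show "positive (sets (add_atom \<nu>)) (\<lambda>X. emeasure \<nu> X + indicator X 0)"
    by (simp add: positive_def)
  show "countably_additive (sets (add_atom \<nu>)) (\<lambda>X. emeasure \<nu> X + indicator X 0)"
    unfolding countably_additive_def
  proof (intro allI impI)
    fix F :: "nat \<Rightarrow> 'a set"
    assume F: "range F \<subseteq> sets (add_atom \<nu>)" "disjoint_family F" "\<Union>(range F) \<in> sets (add_atom \<nu>)"
    have "(\<Sum>i. emeasure \<nu> (F i) + indicator (F i) 0) = (\<Sum>i. emeasure \<nu> (F i)) + (\<Sum>i. indicator (F i) 0)"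
      by (rule suminf_add[symmetric]) auto
    also have "(\<Sum>i. emeasure \<nu> (F i)) = emeasure \<nu> (\<Union>(range F))"
      using F assms(1) by (intro suminf_emeasure) (auto simp: sets_add_atom)
    also have "(\<Sum>i. indicator (F i) 0) = (indicator (\<Union>(range F)) 0 :: ennreal)"
      by (rule suminf_indicator[OF F(2)])
    finally show "(\<Sum>i. emeasure \<nu> (F i) + indicator (F i) 0) = emeasure \<nu> (\<Union>(range F)) + indicator (\<Union>(range F)) 0" .
  qed
  show "X \<in> sets (add_atom \<nu>)" using assms(2) by (simp add: sets_add_atom)
qed simp

lemma nn_integral_add_atom:
  assumes \<nu>: "sets \<nu> = sets borel" and f: "f \<in> borel_measurable borel"
  shows "(\<integral>\<^sup>+x. f x \<partial>add_atom \<nu>) = (\<integral>\<^sup>+x. f x \<partial>\<nu>) + f 0"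
proof -
  note [measurable_cong] = \<nu> sets_add_atom
  show ?thesis using f
  proof (induction rule: borel_measurable_induct)
    case (cong f g)
    then have "f = g" by auto
    then show ?case using cong by simp
  next
    case (set A)
    then show ?case using \<nu> by (simp add: emeasure_add_atom sets_add_atom)
  next
    case (mult u c)
    then have [measurable]: "u \<in> borel_measurable borel" by simp
    show ?case using mult by (simp add: nn_integral_cmult distrib_left)
  next
    case (add u v)
    then have [measurable]: "u \<in> borel_measurable borel" "v \<in> borel_measurable borel" by simp_all
    show ?case using add by (simp add: nn_integral_add ac_simps)
  next
    case (seq U)
    then have [measurable]: "\<And>i. U i \<in> borel_measurable borel" by simp
    have "(\<integral>\<^sup>+x. (SUP i. U i) x \<partial>add_atom \<nu>) = (SUP i. \<integral>\<^sup>+x. U i x \<partial>add_atom \<nu>)"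
      using seq(3) by (simp add: nn_integral_monotone_convergence_SUP image_image)
    also have "\<dots> = (SUP i. (\<integral>\<^sup>+x. U i x \<partial>\<nu>) + U i 0)" using seq by simp
    also have "\<dots> = (SUP i. \<integral>\<^sup>+x. U i x \<partial>\<nu>) + (SUP i. U i 0)"
      using seq(3) by (intro ennreal_SUP_add) (auto simp: incseq_def le_fun_def intro!: nn_integral_mono)
    also have "(SUP i. \<integral>\<^sup>+x. U i x \<partial>\<nu>) = (\<integral>\<^sup>+x. (SUP i. U i) x \<partial>\<nu>)"
      using seq(3) by (simp add: nn_integral_monotone_convergence_SUP image_image)
    finally show ?case by (simp add: image_image)
  qed
qed

lemma locally_finite_compact:
  assumes \<nu>: "locally_finite_borel_measure \<nu>" and K: "compact K"
  shows "emeasure \<nu> K < \<infinity>"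
proof -
  have sets: "sets \<nu> = sets borel" using \<nu> by (simp add: locally_finite_borel_measure_def)
  obtain W where W: "\<And>x. open (W x) \<and> x \<in> W x \<and> emeasure \<nu> (W x) < \<infinity>"
    using \<nu> unfolding locally_finite_borel_measure_def by metis
  obtain C where C: "C \<subseteq> K" "finite C" "K \<subseteq> (\<Union>c\<in>C. W c)"
  proof (rule compactE_image[OF K])
    show "\<And>T. T \<in> K \<Longrightarrow> open (W T)" "K \<subseteq> (\<Union>c\<in>K. W c)" using W by auto
  qed
  have "emeasure \<nu> K \<le> emeasure \<nu> (\<Union>c\<in>C. W c)"
    using C(3) W sets C(2) by (intro emeasure_mono) auto
  also have "\<dots> \<le> (\<Sum>c\<in>C. emeasure \<nu> (W c))"
    using W sets C(2) by (intro emeasure_subadditive_finite) auto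
  also have "\<dots> < \<infinity>" using W C(2) by (auto simp: less_top)
  finally show ?thesis .
qed

text \<open>By Tonelli, testing the identity against \<open>f\<close> gives the integral of
  \<open>f\<close>. The constant 1 shows that \<open>A\<close> has positive volume; exp(-e |x|),
  which is comparable to exp(-e |t|) on the tile at \<open>t\<close>, bounds the growth of
  \<open>\<mu>\<close>.\<close>

lemma tiling_measure_facts:
  fixes A :: "'a::euclidean_space set"
  assumes A: "compact A" and sets: "sets \<mu> = sets borel" and sf: "sigma_finite_measure \<mu>"
    and ae: "AE x in lborel. fun_measure_convolution (indicator A) \<mu> x = 1"
  shows "emeasure lborel A > 0" "tempered \<mu>"
proof -
  note [measurable_cong] = sets
  have [measurable]: "A \<in> sets borel" using A by (rule borel_compact)
  interpret M: sigma_finite_measure \<mu> by (rule sf)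
  interpret pair_sigma_finite lborel \<mu> ..
  have tonelli: "(\<integral>\<^sup>+t. (\<integral>\<^sup>+x. f x * indicator A (x - t) \<partial>lborel) \<partial>\<mu>) = (\<integral>\<^sup>+x. f x \<partial>lborel)"
    if [measurable]: "f \<in> borel_measurable borel" for f
  proof -
    have "(\<integral>\<^sup>+t. (\<integral>\<^sup>+x. f x * indicator A (x - t) \<partial>lborel) \<partial>\<mu>) = (\<integral>\<^sup>+x. (\<integral>\<^sup>+t. f x * indicator A (x - t) \<partial>\<mu>) \<partial>lborel)"
      by (rule Fubini') measurable
    also have "\<dots> = (\<integral>\<^sup>+x. f x * fun_measure_convolution (indicator A) \<mu> x \<partial>lborel)"
      unfolding fun_measure_convolution_def by (intro nn_integral_cong nn_integral_cmult) measurable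
    also have "\<dots> = (\<integral>\<^sup>+x. f x \<partial>lborel)"
      by (rule nn_integral_cong_AE) (use ae in \<open>auto elim!: eventually_mono\<close>)
    finally show ?thesis .
  qed
  have ind: "(\<integral>\<^sup>+x. indicator A (x - t) \<partial>lborel) = emeasure lborel A" for t
    using nn_integral_lborel_translate[of "indicator A" "- t"] by simp
  show pos: "emeasure lborel A > 0"
  proof (rule ccontr)
    assume "\<not> emeasure lborel A > 0"
    then have "(\<integral>\<^sup>+x. 1 \<partial>(lborel :: 'a measure)) = 0" using tonelli[of "\<lambda>_. 1"] ind by simp
    then show False by (simp add: emeasure_lborel_UNIV)
  qed
  obtain R where R: "\<And>x. x \<in> A \<Longrightarrow> norm x \<le> R" using compact_imp_bounded[OF A] by (auto simp: bounded_iff)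
  have "(\<integral>\<^sup>+t. ennreal (exp (- e * norm t)) \<partial>\<mu>) < \<infinity>" if e: "e > 0" for e
  proof -
    have "(\<integral>\<^sup>+t. ennreal (exp (- e * norm t)) \<partial>\<mu>) * emeasure lborel A
      = (\<integral>\<^sup>+t. (\<integral>\<^sup>+x. ennreal (exp (- e * norm t)) * indicator A (x - t) \<partial>lborel) \<partial>\<mu>)"
      by (simp add: nn_integral_multc nn_integral_cmult ind)
    also have "\<dots> \<le> (\<integral>\<^sup>+t. (\<integral>\<^sup>+x. ennreal (exp (e * R) * exp (- e * norm x)) * indicator A (x - t) \<partial>lborel) \<partial>\<mu>)"
    proof (intro nn_integral_mono)
      fix t x
      have "exp (- e * norm t) \<le> exp (e * R) * exp (- e * norm x)" if "x - t \<in> A"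
      proof -
        have "norm x \<le> norm t + R" using R[OF that] norm_triangle_ineq[of t "x - t"] by simp
        then have "e * norm x \<le> e * (norm t + R)" using e by (intro mult_left_mono) auto
        then show ?thesis unfolding exp_add[symmetric] by (simp add: distrib_left)
      qed
      then show "ennreal (exp (- e * norm t)) * indicator A (x - t) \<le> ennreal (exp (e * R) * exp (- e * norm x)) * indicator A (x - t)"
        by (auto split: split_indicator intro: ennreal_leI)
    qed
    also have "\<dots> = (\<integral>\<^sup>+x. ennreal (exp (e * R) * exp (- e * norm (x::'a))) \<partial>lborel)" by (rule tonelli) measurable
    also have "\<dots> = ennreal (exp (e * R)) * (\<integral>\<^sup>+x. ennreal (exp (- e * norm (x::'a))) \<partial>lborel)"
      by (subst nn_integral_cmult[symmetric]) (auto simp: ennreal_mult')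
    also have "\<dots> < \<infinity>" using nn_integral_exp_norm_finite[OF e, where 'a = 'a] by (simp add: ennreal_mult_less_top)
    finally show ?thesis using pos by (auto simp: ennreal_mult_less_top)
  qed
  then show "tempered \<mu>" using sets by (simp add: tempered_def)
qed

section \<open>Operations that preserve subexponential growth\<close>

lemma tempered_density_indicator:
  assumes \<mu>: "tempered \<mu>" and S [measurable]: "S \<in> sets borel"
  shows "tempered (density \<mu> (indicator S))"
proof -
  have sets [measurable_cong]: "sets \<mu> = sets borel" using \<mu> by (simp add: tempered_def)
  have "(\<integral>\<^sup>+t. ennreal (exp (- e * norm t)) \<partial>density \<mu> (indicator S)) \<le> (\<integral>\<^sup>+t. ennreal (exp (- e * norm t)) \<partial>\<mu>)" for e
    by (subst nn_integral_density) (auto intro!: nn_integral_mono split: split_indicator)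
  then show ?thesis using \<mu> sets unfolding tempered_def by (auto intro: le_less_trans)
qed

lemma tempered_translate:
  assumes \<mu>: "tempered \<mu>"
  shows "tempered (distr \<mu> borel (\<lambda>t. t + v))"
proof -
  have sets [measurable_cong]: "sets \<mu> = sets borel" using \<mu> by (simp add: tempered_def)
  have "(\<integral>\<^sup>+t. ennreal (exp (- e * norm t)) \<partial>distr \<mu> borel (\<lambda>t. t + v)) < \<infinity>" if e: "e > 0" for e
  proof -
    have "(\<integral>\<^sup>+t. ennreal (exp (- e * norm t)) \<partial>distr \<mu> borel (\<lambda>t. t + v)) = (\<integral>\<^sup>+t. ennreal (exp (- e * norm (t + v))) \<partial>\<mu>)"
      by (subst nn_integral_distr) auto
    also have "\<dots> \<le> (\<integral>\<^sup>+t. ennreal (exp (e * norm v)) * ennreal (exp (- e * norm t)) \<partial>\<mu>)"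
    proof (rule nn_integral_mono)
      fix t
      have "e * norm t \<le> e * (norm (t + v) + norm v)"
        using e norm_triangle_ineq4[of "t + v" v] by (intro mult_left_mono) auto
      then show "ennreal (exp (- e * norm (t + v))) \<le> ennreal (exp (e * norm v)) * ennreal (exp (- e * norm t))"
        by (simp add: ennreal_mult'[symmetric] exp_add[symmetric] distrib_left)
    qed
    also have "\<dots> = ennreal (exp (e * norm v)) * (\<integral>\<^sup>+t. ennreal (exp (- e * norm t)) \<partial>\<mu>)"
      by (rule nn_integral_cmult) measurable
    also have "\<dots> < \<infinity>" using \<mu> e by (auto simp: tempered_def ennreal_mult_less_top)
    finally show ?thesis .
  qed
  then show ?thesis by (simp add: tempered_def)
qed

lemma tempered_reflect:
  assumes \<mu>: "tempered \<mu>"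
  shows "tempered (distr \<mu> borel uminus)"
proof -
  have sets [measurable_cong]: "sets \<mu> = sets borel" using \<mu> by (simp add: tempered_def)
  have "(\<integral>\<^sup>+t. ennreal (exp (- e * norm t)) \<partial>distr \<mu> borel uminus) = (\<integral>\<^sup>+t. ennreal (exp (- e * norm t)) \<partial>\<mu>)" for e
    by (subst nn_integral_distr) auto
  then show ?thesis using \<mu> by (simp add: tempered_def)
qed

lemma nn_integral_eq_imp_AE_eq:
  assumes [measurable]: "f \<in> borel_measurable M" "g \<in> borel_measurable M"
    and "\<And>x. f x \<le> g x" "(\<integral>\<^sup>+x. f x \<partial>M) = (\<integral>\<^sup>+x. g x \<partial>M)" "(\<integral>\<^sup>+x. f x \<partial>M) < \<infinity>"
  shows "AE x in M. f x = g x"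
proof -
  have "(\<integral>\<^sup>+x. g x - f x \<partial>M) = (\<integral>\<^sup>+x. g x \<partial>M) - (\<integral>\<^sup>+x. f x \<partial>M)"
    using assms by (intro nn_integral_diff) (auto simp: less_top)
  then have "(\<integral>\<^sup>+x. g x - f x \<partial>M) = 0" using assms(5) unfolding assms(4) by (simp add: ennreal_diff_self less_top)
  then have "AE x in M. g x - f x = 0" by (subst (asm) nn_integral_0_iff_AE) auto
  then show ?thesis
  proof (rule eventually_mono)
    fix x assume "g x - f x = 0"
    then show "f x = g x" using assms(3)[of x] by (auto simp: diff_eq_0_iff_ennreal)
  qed
qed

section \<open>Facets and the prisms over them\<close>

lemma facet_unit_normal:
  fixes A :: "'a::euclidean_space set"
  assumes A: "polytope A" "interior A \<noteq> {}" and F: "F face_of A" "aff_dim F = int DIM('a) - 1"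
  obtains u where "norm u = 1" "F = {x \<in> A. x \<bullet> u = supp A u}"
proof -
  have cA: "compact A" using A(1) by (rule polytope_imp_compact)
  have "F exposed_face_of A"
    using exposed_face_of_polyhedron[OF polytope_imp_polyhedron[OF A(1)]] F(1) by blast
  then obtain a b where ab: "A \<subseteq> {x. a \<bullet> x \<le> b}" "F = A \<inter> {x. a \<bullet> x = b}"
    unfolding exposed_face_of_def by blast
  have dA: "aff_dim A = int DIM('a)"
    using affine_hull_nonempty_interior[OF A(2)] aff_dim_eq_full by blast
  have "F \<noteq> {}" using F(2) DIM_positive[where 'a = 'a] by (auto simp: aff_dim_empty_eq)
  then obtain f where f: "f \<in> F" by blast
  \<comment> \<open>A zero normal would expose all of \<open>A\<close>, whose dimension is
    full.\<close>
  have a0: "a \<noteq> 0"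
  proof
    assume "a = 0"
    then have "F = A" using ab f by auto
    then show False using F(2) dA by simp
  qed
  define u where "u = (1 / norm a) *\<^sub>R a"
  have u: "norm u = 1" using a0 by (simp add: u_def)
  have xu: "x \<bullet> u = (a \<bullet> x) / norm a" for x by (simp add: u_def inner_commute)
  have "supp A u = b / norm a"
  proof (rule antisym)
    show "supp A u \<le> b / norm a"
      using ab a0 f by (intro supp_least[OF cA]) (auto simp: xu divide_right_mono)
    show "b / norm a \<le> supp A u"
      using supp_upper[OF cA, of f u] f ab(2) by (simp add: xu)
  qed
  then have "F = {x \<in> A. x \<bullet> u = supp A u}" using ab(2) a0 by (auto simp: xu)
  then show ?thesis using that u by blast
qed

text \<open>Each inequality of \<open>A\<close> composed with the affine projection to level
  \<open>h\<close> is again a linear inequality, and the slab contributes two more.\<close>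

lemma polytope_prism:
  fixes A :: "'a::euclidean_space set"
  assumes A: "polytope A" "A \<noteq> {}" and u: "norm u = 1"
  shows "polytope (prism u h A)"
proof -
  obtain U where U: "finite U" "A = {x. \<forall>w\<in>U. x \<bullet> w \<le> supp A w}"
    by (rule polytope_unit_normals[OF A])
  define S where "S = insert {x. - u \<bullet> x \<le> 0} (insert {x. u \<bullet> x \<le> 1}
    ((\<lambda>w. {x. (w - (u \<bullet> w) *\<^sub>R u) \<bullet> x \<le> supp A w - h * (u \<bullet> w)}) ` U))"
  have lev: "level_proj u h x \<bullet> w \<le> supp A w \<longleftrightarrow> (w - (u \<bullet> w) *\<^sub>R u) \<bullet> x \<le> supp A w - h * (u \<bullet> w)" for x w
    by (simp add: level_proj_def inner_add_left inner_diff_left inner_commute algebra_simps)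
  have memA: "x \<in> A \<longleftrightarrow> (\<forall>w\<in>U. x \<bullet> w \<le> supp A w)" for x using U(2) by blast
  have "x \<in> prism u h A \<longleftrightarrow> x \<in> \<Inter>S" for x
    by (simp add: S_def prism_def slab_def memA lev inner_commute[of u x])
  then have "prism u h A = \<Inter>S" by blast
  moreover have "polyhedron (\<Inter>S)"
    using U(1) by (intro polyhedron_Inter) (auto simp: S_def polyhedron_halfspace_le simp del: inner_minus_left)
  moreover have "bounded (prism u h A)"
    by (intro bounded_prism u polytope_imp_bounded A)
  ultimately show ?thesis by (simp add: polytope_eq_bounded_polyhedron)
qed

text \<open>Otherwise the prism lies in a hyperplane with some normal \<open>a\<close>. Moving along
  \<open>u\<close> shows that \<open>a\<close> is orthogonal to \<open>u\<close>; as the facet spans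
  the whole hyperplane at level \<open>h\<close>, that hyperplane would be contained in the other
  one, but it contains \<open>f + a\<close>.\<close>

lemma interior_prism_facet:
  fixes A :: "'a::euclidean_space set"
  assumes A: "convex A" and u: "norm u = 1" and d: "aff_dim {x \<in> A. x \<bullet> u = h} = int DIM('a) - 1"
  shows "interior (prism u h A) \<noteq> {}"
proof
  let ?F = "{x \<in> A. x \<bullet> u = h}"
  assume "interior (prism u h A) = {}"
  then obtain a b where ab: "a \<noteq> 0" "prism u h A \<subseteq> {x. a \<bullet> x = b}"
    using empty_interior_subset_hyperplane[OF convex_prism[OF A]] by blast
  have uu: "u \<bullet> u = 1" using u by (simp add: dot_square_norm)
  have "?F \<noteq> {}"
  proof
    assume e: "?F = {}"
    show False using d DIM_positive[where 'a = 'a] unfolding e by simp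
  qed
  then obtain f where f: "f \<in> ?F" by blast
  have pr: "g + (s - h) *\<^sub>R u \<in> prism u h A" if "g \<in> ?F" "0 \<le> s" "s \<le> 1" for g s
    using that uu level_proj_shift[OF u, of h g "s - h"] level_proj_self[of g u h]
    by (auto simp: prism_def slab_def inner_add_left)
  have eq: "a \<bullet> (g + (s - h) *\<^sub>R u) = b" if "g \<in> ?F" "0 \<le> s" "s \<le> 1" for g s
    using pr[OF that] ab(2) by blast
  have au: "a \<bullet> u = 0" using eq[OF f, of 0] eq[OF f, of 1] by (simp add: inner_add_right algebra_simps)
  have sub: "?F \<subseteq> {x. a \<bullet> x = b}" 
  proof
    fix x assume "x \<in> ?F"
    from eq[OF this, of 0] have "a \<bullet> x + (0 - h) * (a \<bullet> u) = b"
      by (simp only: inner_add_right inner_scaleR_right)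
    then show "x \<in> {x. a \<bullet> x = b}" using au by simp
  qed
  have "?F \<subseteq> {x. u \<bullet> x = h}" by (auto simp: inner_commute)
  moreover have "aff_dim ?F = aff_dim {x. u \<bullet> x = h}" using d u by (subst aff_dim_hyperplane) auto
  ultimately have "affine hull ?F = affine hull {x. u \<bullet> x = h}" by (simp add: aff_dim_eq_full_gen)
  then have "{x. u \<bullet> x = h} \<subseteq> affine hull ?F" by (simp add: hull_subset)
  also have "\<dots> \<subseteq> {x. a \<bullet> x = b}" using sub by (intro hull_minimal affine_hyperplane)
  finally have hyp: "{x. u \<bullet> x = h} \<subseteq> {x. a \<bullet> x = b}" .
  have "f + a \<in> {x. u \<bullet> x = h}" using f au by (auto simp: inner_add_right inner_commute)
  with hyp have "f + a \<in> {x. a \<bullet> x = b}" by blast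
  then show False using sub f ab(1) by (auto simp: inner_add_right)
qed

text \<open>Adding the atom adds \<open>indicator A\<close> to the convolution, which turns the
  indicator of the complement into the constant 1. A convex set of positive volume has interior
  points.\<close>

lemma weak_tiling_measure:
  fixes A :: "'a::euclidean_space set"
  assumes cA: "compact A" "convex A" and w: "weakly_tiles_complement A"
  obtains \<mu> where "tempered \<mu>" "0 < emeasure \<mu> {0}" "interior A \<noteq> {}"
    "AE x in lborel. fun_measure_convolution (indicator A) \<mu> x = 1"
proof -
  have mA [measurable]: "A \<in> sets borel" using cA(1) by (rule borel_compact)
  obtain \<nu> where \<nu>: "locally_finite_borel_measure \<nu>"
    and ae\<nu>: "AE x in lebesgue. fun_measure_convolution (indicator A) \<nu> x = indicator (- A) x"
    using w unfolding weakly_tiles_complement_def by blast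
  have s\<nu>: "sets \<nu> = sets borel" using \<nu> by (simp add: locally_finite_borel_measure_def)
  define \<mu> where "\<mu> = add_atom \<nu>"
  have s\<mu> [measurable_cong]: "sets \<mu> = sets borel" by (simp add: \<mu>_def sets_add_atom)
  have conv: "fun_measure_convolution (indicator A) \<mu> x = fun_measure_convolution (indicator A) \<nu> x + indicator A x" for x
    unfolding fun_measure_convolution_def \<mu>_def by (subst nn_integral_add_atom[OF s\<nu>]) auto
  have ae: "AE x in lborel. fun_measure_convolution (indicator A) \<mu> x = 1"
    using ae\<nu> unfolding AE_completion_iff
    by (rule eventually_mono) (auto simp: conv split: split_indicator)
  have "sigma_finite_measure \<mu>"
  proof (rule sigma_finite_measure_balls[OF s\<mu>])
    fix n :: nat
    have "emeasure \<mu> (cball 0 (real n)) = emeasure \<nu> (cball 0 (real n)) + indicator (cball (0::'a) (real n)) 0"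
      unfolding \<mu>_def by (rule emeasure_add_atom[OF s\<nu>]) simp
    then show "emeasure \<mu> (cball 0 (real n)) < \<infinity>"
      using locally_finite_compact[OF \<nu> compact_cball[of 0 "real n"]] by (simp split: split_indicator)
  qed
  from tiling_measure_facts[OF cA(1) s\<mu> this ae]
  have posA: "emeasure lborel A > 0" and \<mu>: "tempered \<mu>" by auto
  have intA: "interior A \<noteq> {}"
  proof
    assume "interior A = {}"
    then have "negligible A" using negligible_convex_interior[OF cA(2)] by blast
    then have "emeasure lebesgue A = 0" by (simp add: negligible_iff_null_sets null_setsD1)
    then show False using posA by simp
  qed
  have atom: "0 < emeasure \<mu> {0}"
    unfolding \<mu>_def by (subst emeasure_add_atom[OF s\<nu>]) (auto intro: add_nonneg_pos)
  show ?thesis by (rule that[OF \<mu> atom intA ae])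
qed

text \<open>The constant 1 is invariant under reflection, so \<open>- A\<close> with the reflected
  measure also has convolution 1 almost everywhere.\<close>

lemma centrally_symmetric_if_tiling_measure:
  fixes A :: "'a::euclidean_space set"
  assumes pA: "polytope A" "interior A \<noteq> {}" and \<mu>: "tempered \<mu>" and atom: "0 < emeasure \<mu> {0}"
    and ae: "AE x in lborel. fun_measure_convolution (indicator A) \<mu> x = 1"
  shows "centrally_symmetric A"
proof -
  have cA: "compact A" using pA(1) by (rule polytope_imp_compact)
  have mA [measurable]: "A \<in> sets borel" using cA by (rule borel_compact)
  have s\<mu> [measurable_cong]: "sets \<mu> = sets borel" using \<mu> by (simp add: tempered_def)
  have conv_refl: "fun_measure_convolution (indicator (uminus ` A)) (distr \<mu> borel uminus) x = fun_measure_convolution (indicator A) \<mu> (- x)" for x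
  proof -
    have [measurable]: "uminus ` A \<in> sets borel" using cA by (intro borel_compact compact_negations)
    have "x + t \<in> uminus ` A \<longleftrightarrow> - x - t \<in> A" for t
      by (metis (no_types, lifting) add.inverse_inverse imageE image_eqI minus_add minus_diff_eq diff_minus_eq_add uminus_add_conv_diff add.commute)
    then have "indicator (uminus ` A) (x + t) = (indicator A (- x - t) :: ennreal)" for t
      by (simp add: indicator_def)
    then show ?thesis
      unfolding fun_measure_convolution_def by (subst nn_integral_distr) auto
  qed
  have "AE x in lborel. fun_measure_convolution (indicator A) \<mu> (- x) = 1"
  proof -
    have "AE x in distr lborel borel uminus. fun_measure_convolution (indicator A) \<mu> x = 1"
    proof -
      have eq: "distr lborel borel uminus = (lborel :: 'a measure)"
        using lborel_affine[of "-1" "0::'a"] by (simp add: density_1)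
      show ?thesis unfolding eq by (rule ae)
    qed
    then show ?thesis by (rule AE_distrD[rotated]) simp
  qed
  with ae have ae_sym: "AE x in lborel. fun_measure_convolution (indicator A) \<mu> x = fun_measure_convolution (indicator (uminus ` A)) (distr \<mu> borel uminus) x"
    by eventually_elim (simp add: conv_refl)
  show ?thesis
    by (rule centrally_symmetric_if_balanced_convolutions[OF pA \<mu> tempered_reflect[OF \<mu>] atom ae_sym])
qed

lemma centrally_symmetric_slice_if_prism:
  fixes A :: "'a::euclidean_space set"
  assumes u: "norm u = 1" and P: "centrally_symmetric (prism u h A)"
  shows "centrally_symmetric {x \<in> A. x \<bullet> u = h}"
proof -
  let ?P = "prism u h A" and ?F = "{x \<in> A. x \<bullet> u = h}"
  have uu: "u \<bullet> u = 1" using u by (simp add: dot_square_norm)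
  obtain k where k: "(\<lambda>x. 2 *\<^sub>R k - x) ` ?P = ?P" using P unfolding centrally_symmetric_def by blast
  have kP: "2 *\<^sub>R k - x \<in> ?P" if "x \<in> ?P" for x using k that by blast
  \<comment> \<open>The centre \<open>k\<close> of the prism must lie at level \<open>1 / 2\<close>;
    \<open>c\<close> is its projection to level \<open>h\<close>.\<close>
  define c where "c = k + (h - 1 / 2) *\<^sub>R u"
  have in_P: "f + (s - h) *\<^sub>R u \<in> ?P" if "f \<in> ?F" "0 \<le> s" "s \<le> 1" for f s
    using that uu level_proj_shift[OF u, of h f "s - h"] level_proj_self[of f u h]
    by (auto simp: prism_def slab_def inner_add_left)
  have in_F: "2 *\<^sub>R c - f \<in> ?F" if f: "f \<in> ?F" for f
  proof -
    have fu: "f \<bullet> u = h" using f by simp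
    let ?y = "f + (0 - h) *\<^sub>R u" and ?z = "f + (1 - h) *\<^sub>R u"
    have y: "2 *\<^sub>R k - ?y \<in> ?P" and z: "2 *\<^sub>R k - ?z \<in> ?P"
      by (rule kP[OF in_P[OF f]]; simp)+
    \<comment> \<open>The reflected copies of points at levels 0 and 1 have levels
      \<open>2 * (k \<bullet> u)\<close> and \<open>2 * (k \<bullet> u) - 1\<close>; both must be in
      the slab.\<close>
    have "(2 *\<^sub>R k - ?y) \<bullet> u \<le> 1" "0 \<le> (2 *\<^sub>R k - ?z) \<bullet> u"
      using y z by (auto simp: prism_def slab_def)
    then have ku: "2 * (k \<bullet> u) = 1" using fu uu by (simp add: inner_diff_left inner_add_left)
    have "level_proj u h (2 *\<^sub>R k - ?y) = 2 *\<^sub>R c - f"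
    proof -
      have "(2 *\<^sub>R k - ?y) \<bullet> u = 1" using ku fu uu by (simp add: inner_diff_left inner_add_left)
      then have "level_proj u h (2 *\<^sub>R k - ?y) = 2 *\<^sub>R k - f + (h *\<^sub>R u + (h - 1) *\<^sub>R u)"
        by (simp add: level_proj_def)
      also have "h *\<^sub>R u + (h - 1) *\<^sub>R u = (2 * (h - 1 / 2)) *\<^sub>R u"
        unfolding scaleR_add_left[symmetric] by (simp add: right_diff_distrib)
      finally show ?thesis by (simp add: c_def scaleR_right_distrib)
    qed
    then have "2 *\<^sub>R c - f \<in> A" using y by (simp add: prism_def)
    moreover have "(2 *\<^sub>R c - f) \<bullet> u = h"
    proof -
      have "c \<bullet> u = k \<bullet> u + (h - 1 / 2)" using uu by (simp add: c_def inner_add_left)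
      moreover have "(2 *\<^sub>R c - f) \<bullet> u = 2 * (c \<bullet> u) - f \<bullet> u" by (simp add: inner_diff_left)
      ultimately show ?thesis using ku fu by linarith
    qed
    ultimately show ?thesis by simp
  qed
  have "(\<lambda>x. 2 *\<^sub>R c - x) ` ?F = ?F"
  proof (intro equalityI subsetI)
    fix x assume "x \<in> ?F"
    then show "x \<in> (\<lambda>x. 2 *\<^sub>R c - x) ` ?F" using in_F[of x] by (intro image_eqI[of _ _ "2 *\<^sub>R c - x"]) auto
  qed (use in_F in auto)
  then show ?thesis unfolding centrally_symmetric_def by blast
qed

text \<open>Central symmetry of \<open>A\<close> makes the face opposite to \<open>F\<close> a
  reflected copy of \<open>F\<close>. So the balance of top and bottom faces in the hyperplane of
  \<open>F\<close> becomes an identity between convolutions of the prism over \<open>F\<close> and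
  of its reflection.\<close>

lemma centrally_symmetric_facet:
  fixes A :: "'a::euclidean_space set"
  assumes pA: "polytope A" and intA: "interior A \<noteq> {}" and \<mu>: "tempered \<mu>" and atom: "0 < emeasure \<mu> {0}"
    and ae: "AE x in lborel. fun_measure_convolution (indicator A) \<mu> x = 1" and symA: "centrally_symmetric A"
    and F: "F face_of A" "aff_dim F = int DIM('a) - 1"
  shows "centrally_symmetric F"
proof -
  have cA: "compact A" "convex A" using pA by (auto intro: polytope_imp_compact polytope_imp_convex)
  have neA: "A \<noteq> {}" using intA by auto
  have mA [measurable]: "A \<in> sets borel" using cA(1) by (rule borel_compact)
  have s\<mu> [measurable_cong]: "sets \<mu> = sets borel" using \<mu> by (simp add: tempered_def)
  obtain u where u: "norm u = 1" and Fu: "F = {x \<in> A. x \<bullet> u = supp A u}"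
    using facet_unit_normal[OF pA intA F] by metis
  have uu: "u \<bullet> u = 1" using u by (simp add: dot_square_norm)
  let ?h = "supp A u" and ?b = "supp A (- u)"
  define P where "P = prism u ?h A"
  obtain c0 where c0: "(\<lambda>x. 2 *\<^sub>R c0 - x) ` A = A" using symA unfolding centrally_symmetric_def by blast
  have refl: "2 *\<^sub>R c0 - x \<in> A \<longleftrightarrow> x \<in> A" for x
    using c0 by (metis (no_types, lifting) diff_diff_eq2 add_diff_cancel_left' imageE image_eqI)
  have c0u: "2 * (c0 \<bullet> u) = ?h - ?b"
  proof -
    obtain x where x: "x \<in> A" "x \<bullet> u = ?h" using supp_attained[OF cA(1) neA, of u] by metis
    obtain y where y: "y \<in> A" "y \<bullet> - u = ?b" using supp_attained[OF cA(1) neA, of "- u"] by metis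
    have m: "2 *\<^sub>R c0 - x \<in> A" "2 *\<^sub>R c0 - y \<in> A" using x y refl by auto
    have yu: "y \<bullet> u = - ?b" using y(2) by simp
    have "(2 *\<^sub>R c0 - x) \<bullet> - u = ?h - 2 * (c0 \<bullet> u)" "(2 *\<^sub>R c0 - y) \<bullet> u = 2 * (c0 \<bullet> u) + ?b"
      using x(2) yu by (simp_all add: inner_diff_left)
    with supp_upper[OF cA(1) m(1), of "- u"] supp_upper[OF cA(1) m(2), of u]
    have "?h - 2 * (c0 \<bullet> u) \<le> ?b" "2 * (c0 \<bullet> u) + ?b \<le> ?h" by (simp_all only:)
    then show ?thesis by linarith
  qed
  \<comment> \<open>\<open>2 *\<^sub>R c0\<close> undoes the reflection within the hyperplane. The
    multiple of \<open>u\<close> is fixed by the slab: for \<open>t \<bullet> u = ?h + ?b\<close>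
    the point \<open>t + v - x\<close> then has level \<open>1 - x \<bullet> u\<close>.\<close>
  define v where "v = 2 *\<^sub>R c0 + (1 - 2 * ?h) *\<^sub>R u"
  have vu: "v \<bullet> u = 1 - ?h - ?b" using c0u uu by (simp add: v_def inner_add_left)
  \<comment> \<open>\<open>\<mu>0\<close> keeps the translates with top face at level
    \<open>?h\<close>, \<open>\<nu>0\<close> those with bottom face there, moved by
    \<open>v\<close>.\<close>
  define \<mu>0 where "\<mu>0 = density \<mu> (indicator {t. t \<bullet> u = 0})"
  define \<nu>0 where "\<nu>0 = distr (density \<mu> (indicator {t. t \<bullet> u = ?h + ?b})) borel (\<lambda>t. t + v)"
  have t0: "tempered \<mu>0" "tempered \<nu>0"
    unfolding \<mu>0_def \<nu>0_def by (intro tempered_density_indicator tempered_translate \<mu> level_set_borel)+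
  define G where "G d y = (\<integral>\<^sup>+t. indicator {t. t \<bullet> u = d} t * indicator A (y - t) \<partial>\<mu>)" for d y
  interpret M: sigma_finite_measure \<mu> by (rule tempered_sigma_finite[OF \<mu>])
  have G_meas [measurable]: "G d \<in> borel_measurable borel" for d
    unfolding G_def[abs_def] by measurable
  have cP: "compact P" unfolding P_def by (rule compact_prism[OF u cA(1)])
  have mP [measurable]: "P \<in> sets borel" "uminus ` P \<in> sets borel"
    using cP by (auto intro!: borel_compact compact_negations)
  have convP: "fun_measure_convolution (indicator P) \<mu>0 x = indicator (slab u) x * G 0 (level_proj u ?h x)" for x
  proof -
    have "indicator {t. t \<bullet> u = 0} t * indicator P (x - t)
      = (indicator (slab u) x * (indicator {t. t \<bullet> u = 0} t * indicator A (level_proj u ?h x - t)) :: ennreal)" for t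
      unfolding level_proj_minus by (auto simp: P_def prism_def slab_def inner_diff_left split: split_indicator)
    then show ?thesis
      unfolding fun_measure_convolution_def \<mu>0_def G_def
      by (subst nn_integral_density) (auto simp: nn_integral_cmult)
  qed
  have convQ: "fun_measure_convolution (indicator (uminus ` P)) \<nu>0 x = indicator (slab u) x * G (?h + ?b) (level_proj u ?h x)" for x
  proof -
    have mem: "x - (t + v) \<in> uminus ` P \<longleftrightarrow> x \<in> slab u \<and> level_proj u ?h x - t \<in> A" if t: "t \<bullet> u = ?h + ?b" for t
    proof -
      have "x - (t + v) \<in> uminus ` P \<longleftrightarrow> t + v - x \<in> P"
        by (metis (no_types, lifting) add.inverse_inverse imageE image_eqI minus_diff_eq)
      moreover have "t + v - x \<in> slab u \<longleftrightarrow> x \<in> slab u"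
        using t vu by (auto simp: slab_def inner_diff_left inner_add_left)
      moreover have "level_proj u ?h (t + v - x) = 2 *\<^sub>R c0 - (level_proj u ?h x - t)"
      proof -
        have "(t + v - x) \<bullet> u = 1 - x \<bullet> u" using t vu by (simp add: inner_diff_left inner_add_left)
        then show ?thesis by (simp add: level_proj_def v_def algebra_simps flip: scaleR_add_left)
      qed
      ultimately show ?thesis unfolding P_def prism_def mem_Collect_eq by (simp only: refl)
    qed
    have "indicator {t. t \<bullet> u = ?h + ?b} t * indicator (uminus ` P) (x - (t + v))
      = (indicator (slab u) x * (indicator {t. t \<bullet> u = ?h + ?b} t * indicator A (level_proj u ?h x - t)) :: ennreal)" for t
      using mem[of t] by (auto split: split_indicator)
    then show ?thesis
      unfolding fun_measure_convolution_def \<nu>0_def G_def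
      by (subst nn_integral_distr, measurable, subst nn_integral_density) (auto simp: nn_integral_cmult)
  qed
  \<comment> \<open>The equality of top and bottom mass for an arbitrary test function, rewritten by
    Tonelli as an equality of integrals over the hyperplane.\<close>
  have bal: "(\<integral>\<^sup>+x. indicator (slab u) x * (\<psi> (level_proj u ?h x) * G 0 (level_proj u ?h x)) \<partial>lborel)
      = (\<integral>\<^sup>+x. indicator (slab u) x * (\<psi> (level_proj u ?h x) * G (?h + ?b) (level_proj u ?h x)) \<partial>lborel)
     \<and> (\<integral>\<^sup>+x. indicator (slab u) x * (\<psi> (level_proj u ?h x) * G 0 (level_proj u ?h x)) \<partial>lborel) < \<infinity>"
    if [measurable]: "\<psi> \<in> borel_measurable borel" and \<psi>: "\<And>y. \<psi> y \<le> ennreal (1 * exp (- 1 * norm y))" for \<psi> :: "'a \<Rightarrow> ennreal"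
  proof -
    interpret j: jump u A \<mu> \<psi> 1 1 ?h using u cA neA \<mu> \<psi> that(1) by unfold_locales auto
    interpret pair_sigma_finite lborel \<mu> ..
    have int: "(\<integral>\<^sup>+x. indicator (slab u) x * (\<psi> (level_proj u ?h x) * G d (level_proj u ?h x)) \<partial>lborel)
      = (\<integral>\<^sup>+t. (if t \<bullet> u = d then j.weight ?h t else 0) \<partial>\<mu>)" for d
    proof -
      have "(\<integral>\<^sup>+t. (if t \<bullet> u = d then j.weight ?h t else 0) \<partial>\<mu>) = (\<integral>\<^sup>+t. (\<integral>\<^sup>+x. indicator (slab u) x * (\<psi> (level_proj u ?h x) * (indicator {t. t \<bullet> u = d} t * indicator A (level_proj u ?h x - t))) \<partial>lborel) \<partial>\<mu>)"
        unfolding j.weight_def by (intro nn_integral_cong) auto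
      also have "\<dots> = (\<integral>\<^sup>+x. (\<integral>\<^sup>+t. indicator (slab u) x * (\<psi> (level_proj u ?h x) * (indicator {t. t \<bullet> u = d} t * indicator A (level_proj u ?h x - t))) \<partial>\<mu>) \<partial>lborel)"
        by (rule Fubini') measurable
      also have "\<dots> = (\<integral>\<^sup>+x. indicator (slab u) x * (\<psi> (level_proj u ?h x) * G d (level_proj u ?h x)) \<partial>lborel)"
        unfolding G_def by (intro nn_integral_cong) (simp add: nn_integral_cmult)
      finally show ?thesis ..
    qed
    have "j.top_mass = j.bottom_mass" by (rule j.top_eq_bottom[OF ae])
    moreover have "j.top_mass < \<infinity>"
    proof -
      obtain R where R: "R \<ge> 0" "\<And>x. x \<in> A \<Longrightarrow> norm x \<le> R" using j.radius by metis
      have "j.top_mass \<le> (\<integral>\<^sup>+t. j.dom (R + 1) t \<partial>\<mu>)"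
        unfolding j.top_mass_def using j.weight_le_dom[OF R(2), of ?h] by (auto intro!: nn_integral_mono)
      also have "\<dots> < \<infinity>" using R by (intro j.dom_integral) auto
      finally show ?thesis .
    qed
    moreover have "j.top_mass = (\<integral>\<^sup>+x. indicator (slab u) x * (\<psi> (level_proj u ?h x) * G 0 (level_proj u ?h x)) \<partial>lborel)"
      unfolding int j.top_mass_def by simp
    moreover have "j.bottom_mass = (\<integral>\<^sup>+x. indicator (slab u) x * (\<psi> (level_proj u ?h x) * G (?h + ?b) (level_proj u ?h x)) \<partial>lborel)"
      unfolding int j.bottom_mass_def by simp
    ultimately show ?thesis by simp
  qed
  have "AE x in lborel. x \<in> slab u \<longrightarrow> G 0 (level_proj u ?h x) = G (?h + ?b) (level_proj u ?h x)"
  proof -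
    have le: "AE x in lborel. x \<in> slab u \<longrightarrow> G d (level_proj u ?h x) \<le> G d' (level_proj u ?h x)"
      if d: "d = 0 \<and> d' = ?h + ?b \<or> d = ?h + ?b \<and> d' = 0" for d d'
    proof -
      \<comment> \<open>Testing on the set where the inequality fails: there the integrands are
        ordered, while their integrals are equal and finite, so the set meets the hyperplane in a
        null set.\<close>
      define S where "S = {y \<in> space borel. G d' y < G d y}"
      have S [measurable]: "S \<in> sets borel" unfolding S_def by measurable
      define \<psi> where "\<psi> y = ennreal (exp (- norm y)) * indicator S y" for y :: 'a
      have \<psi>m [measurable]: "\<psi> \<in> borel_measurable borel" unfolding \<psi>_def[abs_def] by measurable
      have \<psi>le: "\<psi> y \<le> ennreal (1 * exp (- 1 * norm y))" for y
        by (auto simp: \<psi>_def split: split_indicator)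
      note b = bal[OF \<psi>m \<psi>le]
      have "AE x in lborel. indicator (slab u) x * (\<psi> (level_proj u ?h x) * G d' (level_proj u ?h x))
        = indicator (slab u) x * (\<psi> (level_proj u ?h x) * G d (level_proj u ?h x))"
      proof (rule nn_integral_eq_imp_AE_eq)
        show "indicator (slab u) x * (\<psi> (level_proj u ?h x) * G d' (level_proj u ?h x))
          \<le> indicator (slab u) x * (\<psi> (level_proj u ?h x) * G d (level_proj u ?h x))" for x
        proof -
          have "\<psi> y * G d' y \<le> \<psi> y * G d y" for y
          proof (cases "y \<in> S")
            case True
            then have "G d' y \<le> G d y" by (simp add: S_def less_imp_le)
            then show ?thesis by (intro mult_left_mono) simp_all
          qed (simp add: \<psi>_def)
          then show ?thesis by (rule mult_left_mono) simp
        qed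
      qed (use b d in \<open>auto\<close>)
      then show ?thesis
      proof (rule eventually_mono)
        fix x assume x: "indicator (slab u) x * (\<psi> (level_proj u ?h x) * G d' (level_proj u ?h x))
          = indicator (slab u) x * (\<psi> (level_proj u ?h x) * G d (level_proj u ?h x))"
        show "x \<in> slab u \<longrightarrow> G d (level_proj u ?h x) \<le> G d' (level_proj u ?h x)"
        proof (intro impI, rule ccontr)
          assume xs: "x \<in> slab u" and "\<not> G d (level_proj u ?h x) \<le> G d' (level_proj u ?h x)"
          then have lt: "G d' (level_proj u ?h x) < G d (level_proj u ?h x)" by simp
          then have "\<psi> (level_proj u ?h x) = ennreal (exp (- norm (level_proj u ?h x)))"
            by (simp add: \<psi>_def S_def)
          then show False using x xs lt by (simp add: ennreal_mult_cancel_left)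
        qed
      qed
    qed
    have "AE x in lborel. x \<in> slab u \<longrightarrow> G 0 (level_proj u ?h x) \<le> G (?h + ?b) (level_proj u ?h x)"
      "AE x in lborel. x \<in> slab u \<longrightarrow> G (?h + ?b) (level_proj u ?h x) \<le> G 0 (level_proj u ?h x)"
      by (rule le, simp)+
    then show ?thesis by eventually_elim (auto intro: antisym)
  qed
  then have aeP: "AE x in lborel. fun_measure_convolution (indicator P) \<mu>0 x = fun_measure_convolution (indicator (uminus ` P)) \<nu>0 x"
    by (rule eventually_mono) (auto simp: convP convQ split: split_indicator)
  \<comment> \<open>The origin has level 0, so the atom survives the restriction to translates with
    top face at level \<open>?h\<close>.\<close>
  have atom0: "0 < emeasure \<mu>0 {0}"
    unfolding \<mu>0_def using atom by (subst emeasure_density) (auto simp: s\<mu>)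
  have "centrally_symmetric P"
  proof (rule centrally_symmetric_if_balanced_convolutions[OF _ _ t0 atom0 aeP])
    show "polytope P" unfolding P_def by (rule polytope_prism[OF pA neA u])
    show "interior P \<noteq> {}" unfolding P_def using F(2) Fu by (intro interior_prism_facet[OF cA(2) u]) simp
  qed
  then show ?thesis
    unfolding P_def Fu by (rule centrally_symmetric_slice_if_prism[OF u])
qed

theorem theorem2p2:
  fixes A :: "(real ^ 'n) set"
  assumes "polytope A"
    and "weakly_tiles_complement A"
  shows "centrally_symmetric A \<and>
    (\<forall>F. F face_of A \<and> aff_dim F = int CARD('n) - 1 \<longrightarrow> centrally_symmetric F)"
proof -
  obtain \<mu> where \<mu>: "tempered \<mu>" "0 < emeasure \<mu> {0}" and A: "interior A \<noteq> {}"
    and ae: "AE x in lborel. fun_measure_convolution (indicator A) \<mu> x = 1"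
    by (rule weak_tiling_measure[OF polytope_imp_compact[OF assms(1)] polytope_imp_convex[OF assms(1)] assms(2)])
  have "centrally_symmetric A"
    by (rule centrally_symmetric_if_tiling_measure[OF assms(1) A \<mu> ae])
  then show ?thesis
    using centrally_symmetric_facet[OF assms(1) A \<mu> ae] by simp
qed

end
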